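(* Let $N>2$ be an integer. Let $f_1\in C[0,\infty)\cap C^1(0,\infty)$ with $f_1(0)=0$, and put $F_1(s)=\int_0^s f_1(t)\,dt$. Assume: (a) there exists $b\ge 0$ such that $f_1(s)>0$ for $s>b$ and $f_1(s)\le 0$ for $s\in[0,b]$; moreover $f_1<0$ on $(0,\varepsilon)$ for some $\varepsilon>0$; and there exists a unique finite $\beta\ge b$ such that $F_1(\beta)=0$; (b) $(F_1/f_1)'(s)>\frac{N-2}{2N}$ for all $s>\beta$; (c) $s\mapsto f_1(s)/(s-b)$ is increasing for $s>b$; (d) $\alpha_*$ is an initial value such that the solution of $u''+\frac{N-1}{r}u'+f_1(u)=0$ $(r>0)$, $u(0)=\alpha_*$, $u'(0)=0$, is a ground state solution, i.e. $u(r)>0$ for all $r>0$ and $\lim_{r\to\infty}u(r)=0$. Let $\alpha_*<\gamma\le\infty$ and let $f_2$ be a positive continuous function on $[\alpha_*,\gamma)$. Then there exist positive constants $\bar\epsilon$ and $\bar A$ such that for any $0<\epsilon_1<\bar\epsilon$ and any $A_2>\bar A$ the problem $$\Delta u+f(u)=0 \ \text{ in } \mathbb R^N,\qquad \lim_{|x|\to\infty}u(x)=0,$$ with $f$ the continuous function on $[0,\gamma)$ given by $$f(s)=\begin{cases} f_1(s), & s\le \alpha_1:=\alpha_*+\epsilon_1,\\ L_1(s), & \alpha_1\le s\le \alpha_1+\epsilon_1,\\ A_2^2f_2(s), & s\ge \alpha_1+\epsilon_1,\end{cases}$$ where $L_1$ is the affine function whose graph is the line from $(\alpha_1,f_1(\alpha_1))$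 to $(\alpha_1+\epsilon_1,A_2^2f_2(\alpha_1+\epsilon_1))$, has at least two radially symmetric ground state solutions.
   Context: A ground state solution of $\Delta u+f(u)=0$ in $\mathbb R^N$, $\lim_{|x|\to\infty}u(x)=0$, is a nonconstant solution with $u(x)>0$ for all $x\in\mathbb R^N$. Radially symmetric (about the origin) ground states $u=u(r)$, $r=|x|$, are the solutions of $u''+\frac{N-1}{r}u'+f(u)=0$, $u(r)>0$ for all $r>0$, $u'(0)=0$, $\lim_{r\to\infty}u(r)=0$. *)

theory Defs
  imports "HOL-Analysis.Analysis"
begin

definition primitive0 :: "(real \<Rightarrow> real) \<Rightarrow> real \<Rightarrow> real" where
  "primitive0 f s = integral {0..s} f"

definition partial_deriv :: "'n::finite \<Rightarrow> (real ^ 'n \<Rightarrow> real) \<Rightarrow> real ^ 'n \<Rightarrow> real" where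
  "partial_deriv i u x = frechet_derivative u (at x) (axis i 1)"

definition laplacian :: "(real ^ 'n::finite \<Rightarrow> real) \<Rightarrow> real ^ 'n \<Rightarrow> real" where
  "laplacian u x = (\<Sum>i\<in>UNIV. partial_deriv i (partial_deriv i u) x)"

definition twice_cont_diff :: "(real ^ 'n::finite \<Rightarrow> real) \<Rightarrow> bool" where
  "twice_cont_diff u \<longleftrightarrow>
     (\<forall>x. u differentiable (at x)) \<and>
     (\<forall>i x. partial_deriv i u differentiable (at x)) \<and>
     (\<forall>i j. continuous_on UNIV (partial_deriv j (partial_deriv i u)))"

definition radially_symmetric :: "(real ^ 'n::finite \<Rightarrow> real) \<Rightarrow> bool" where
  "radially_symmetric u \<longleftrightarrow> (\<forall>x y. norm x = norm y \<longrightarrow> u x = u y)"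

(* The nonlinearity is only meaningful on D (a total HOL function has arbitrary values elsewhere),
   so a classical solution is required to take its values in D. *)
definition ground_state :: "real set \<Rightarrow> (real \<Rightarrow> real) \<Rightarrow> (real ^ 'n::finite \<Rightarrow> real) \<Rightarrow> bool" where
  "ground_state D f u \<longleftrightarrow>
     twice_cont_diff u \<and>
     (\<forall>x. u x \<in> D) \<and>
     (\<forall>x. laplacian u x + f (u x) = 0) \<and>
     (u \<longlongrightarrow> 0) at_infinity \<and>
     \<not> u constant_on UNIV \<and>
     (\<forall>x. u x > 0)"

(* u'' + (N-1)/r u' + f(u) = 0 for r > 0, u(0) = a, u'(0) = 0, for u of class C^1 on [0,\<infinity>).
   Here v is u' (one-sided at 0) and w is u''(r); continuity of u'' on r > 0 follows from the equation
   when f is continuous. *)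
definition radial_ivp :: "nat \<Rightarrow> (real \<Rightarrow> real) \<Rightarrow> real \<Rightarrow> (real \<Rightarrow> real) \<Rightarrow> bool" where
  "radial_ivp N f a u \<longleftrightarrow>
     u 0 = a \<and>
     (\<exists>v. v 0 = 0 \<and> continuous_on {0..} v \<and>
        (\<forall>r\<ge>0. (u has_real_derivative v r) (at r within {0..})) \<and>
        (\<forall>r>0. \<exists>w. (v has_real_derivative w) (at r) \<and>
                   w + (real N - 1) / r * v r + f (u r) = 0))"

definition chord :: "real \<Rightarrow> real \<Rightarrow> real \<Rightarrow> real \<Rightarrow> real \<Rightarrow> real" where
  "chord x0 y0 x1 y1 s = y0 + (y1 - y0) / (x1 - x0) * (s - x0)"

definition glued :: "(real \<Rightarrow> real) \<Rightarrow> (real \<Rightarrow> real) \<Rightarrow> real \<Rightarrow> real \<Rightarrow> real \<Rightarrow> real \<Rightarrow> real" where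
  "glued f1 f2 a \<epsilon>1 A2 s =
     (let \<alpha>1 = a + \<epsilon>1 in
      if s \<le> \<alpha>1 then f1 s
      else if s \<le> \<alpha>1 + \<epsilon>1 then chord \<alpha>1 (f1 \<alpha>1) (\<alpha>1 + \<epsilon>1) (A2\<^sup>2 * f2 (\<alpha>1 + \<epsilon>1)) s
      else A2\<^sup>2 * f2 s)"

end

theory Submission
  imports Defs "HOL-Complex_Analysis.Great_Picard"
begin

text \<open>
  Write f for the glued nonlinearity and \<alpha>* for the given initial value. One of the two ground
  states is the given one: it decreases from \<alpha>*, so it only meets values at which f and f1 agree.
  The second one has a larger initial value and comes from shooting between \<alpha>* + \<epsilon>1 and
  \<alpha>* + \<delta>, where \<delta> is small but does not depend on \<epsilon>1 and A2. Solutions from the lower end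
  change sign; those from the upper end are \<open>trapped\<close>, that is, their energy u'^2/2 + F(u) is
  negative at some radius up to which they are positive, and since the energy never increases they can
  neither reach 0 nor tend to 0 afterwards. A solution between these two alternatives is positive and
  tends to 0.

  Lower end. For f1 itself a solution that starts above an untrapped one changes sign
  (\<open>larger_solution_crosses\<close>). On the part where solutions decrease, use the value s of the solution as
  independent variable, and consider the radius r(s) and the slope p(s) = -u'. Growth of f1(s)/(s - b)
  forces the graphs of the two solutions to intersect at a level s \<ge> b. The condition on (F1/f1)' makes
  the functional r p + 2 r F/p - 2 N F/f positive above \<beta>, and a comparison of this functional for the two
  solutions shows that the larger solution stays ahead down to the level \<beta>. Below \<beta>, where F < 0,
  the comparison of r * sqrt (p^2 + 2 F) keeps it ahead all the way to the level 0, which it therefore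
  passes with positive speed. The same theorem, used with \<alpha>* as the larger value, says that every
  solution with initial value in (0, \<alpha>*) is trapped.

  Upper end. When A2 is large, the solution from \<alpha>* + \<delta> falls to the level \<alpha>* within a radius that
  tends to 0, but r p at that level stays between two positive multiples of \<delta>
  (\<open>steep_passage\<close>). From there on the equation is the one with f1, and the solution differs from a
  regular solution by a multiple of r^(2 - N), which decays with A2. The regular part starts
  approximately at \<alpha>* - r p/(N - 2), so in the limit it is a solution with an initial
  value in (0, \<alpha>*), hence trapped; the solutions from \<alpha>* + \<delta> are then trapped for large A2
  (\<open>steep_sequence_absurd\<close>).

  Shooting. As f2 is only continuous, initial values do not determine solutions, and there is no
  continuous dependence on the initial value. Tonelli's equation with a retarded argument does have unique,
  continuously dependent solutions, and these converge to solutions of the given equation. Connectedness of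
  the interval of initial values then gives solutions whose minimum over a prescribed interval [0, T] has
  a prescribed value e (\<open>rsol_touching\<close>); the limit T \<rightarrow> \<infinity>, e \<rightarrow> 0 yields a nonnegative, untrapped
  solution (\<open>shooting\<close>). It could still vanish at some radius together with its derivative. Such a
  dead core requires, in essence, that 1/sqrt |F| is integrable at 0, and in that case the given ground
  state would have to vanish at a finite radius as well (\<open>no_dead_core\<close>).
\<close>

section \<open>The radial equation in integral form\<close>

text \<open>
  Integrating (t^(N-1) v)' = - t^(N-1) G twice expresses the derivative \<open>vel\<close> and the value \<open>pos\<close> of a
  radial function through a given right-hand side. Division by zero gives \<open>vel\<close> the correct value 0 at the
  origin.
\<close>
definition vel :: "nat \<Rightarrow> (real \<Rightarrow> real) \<Rightarrow> real \<Rightarrow> real" where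
  "vel N G t = - integral {0..t} (\<lambda>\<tau>. \<tau> ^ (N - 1) * G \<tau>) / t ^ (N - 1)"

definition pos :: "nat \<Rightarrow> real \<Rightarrow> (real \<Rightarrow> real) \<Rightarrow> real \<Rightarrow> real" where
  "pos N a G r = a + integral {0..r} (vel N G)"

text \<open>
  The derivative is carried along as an argument v because energy, flux and slope, on which all estimates
  rest, are functions of the pair; at the origin it is one-sided.
\<close>
definition rsol :: "nat \<Rightarrow> (real \<Rightarrow> real) \<Rightarrow> real \<Rightarrow> (real \<Rightarrow> real) \<Rightarrow> (real \<Rightarrow> real) \<Rightarrow> bool" where
  "rsol N g a u v \<longleftrightarrow> u 0 = a \<and> v 0 = 0 \<and> continuous_on {0..} v \<and>
     (\<forall>r\<ge>0. (u has_real_derivative v r) (at r within {0..})) \<and>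
     (\<forall>r>0. (v has_real_derivative (- (real N - 1) / r * v r - g (u r))) (at r))"

lemma at_within_nonneg: "(0::real) < t \<Longrightarrow> at t within {0..} = at t"
  by (rule at_within_interior) auto

lemma vel_0 [simp]: "vel N G 0 = 0"
  by (simp add: vel_def)

text \<open>
  The weight \<tau>^(N-1) is at most t^(N-1), so after the division only the length of the interval remains.
  This linear bound is what controls the singular coefficient (N-1)/r at the origin.
\<close>
lemma abs_vel_le:
  assumes "continuous_on {0..} G" "\<And>\<tau>. 0 \<le> \<tau> \<Longrightarrow> \<tau> \<le> t \<Longrightarrow> \<bar>G \<tau>\<bar> \<le> M" "0 \<le> t"
  shows "\<bar>vel N G t\<bar> \<le> M * t"
proof (cases "t = 0")
  case False
  with assms have t: "t > 0" by simp
  have c: "continuous_on {0..t} (\<lambda>\<tau>. \<tau> ^ (N - 1) * G \<tau>)"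
    by (intro continuous_intros continuous_on_subset[OF assms(1)]) auto
  have "norm (integral {0..t} (\<lambda>\<tau>. \<tau> ^ (N - 1) * G \<tau>)) \<le> (t ^ (N - 1) * M) * (t - 0)"
  proof (rule integral_bound)
    show "0 \<le> t" by fact
    show "continuous_on {0..t} (\<lambda>\<tau>. \<tau> ^ (N - 1) * G \<tau>)" by fact
    fix \<tau> assume "\<tau> \<in> {0..t}"
    then show "norm (\<tau> ^ (N - 1) * G \<tau>) \<le> t ^ (N - 1) * M"
      using assms(2)[of \<tau>] by (auto simp: abs_mult power_abs intro!: mult_mono power_mono)
  qed
  then have "\<bar>integral {0..t} (\<lambda>\<tau>. \<tau> ^ (N - 1) * G \<tau>)\<bar> / t ^ (N - 1) \<le> M * t"
    using t by (simp add: field_simps)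
  then show ?thesis using t by (simp add: vel_def)
qed simp

lemma integral_deriv:
  fixes G :: "real \<Rightarrow> real"
  assumes "continuous_on {0..} G" "0 \<le> t"
  shows "((\<lambda>t. integral {0..t} G) has_real_derivative G t) (at t within {0..})"
proof -
  have "((\<lambda>t. integral {0..t} G) has_real_derivative G t) (at t within {0..t+1})"
    using assms by (intro integral_has_real_derivative continuous_on_subset[OF assms(1)]) auto
  moreover have "at t within {0..t+1} = at t within {0..}"
    by (rule at_within_nhd[of _ "{..<t+1}"]) auto
  ultimately show ?thesis by simp
qed

lemma vel_deriv:
  assumes G: "continuous_on {0..} G" and t: "0 < t" and N: "2 \<le> N"
  shows "(vel N G has_real_derivative (- (real N - 1) / t * vel N G t - G t)) (at t)"
proof -
  obtain k where k: "N = Suc (Suc k)" using N by (metis add_2_eq_Suc le_Suc_ex)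
  have c: "continuous_on {0..} (\<lambda>\<tau>. \<tau> ^ (N - 1) * G \<tau>)"
    by (intro continuous_intros G)
  have "((\<lambda>t. integral {0..t} (\<lambda>\<tau>. \<tau> ^ (N - 1) * G \<tau>)) has_real_derivative t ^ (N - 1) * G t) (at t)"
    using integral_deriv[OF c, of t] t by (simp add: at_within_nonneg)
  then have "((\<lambda>t. - integral {0..t} (\<lambda>\<tau>. \<tau> ^ (N - 1) * G \<tau>) / t ^ (N - 1)) has_real_derivative
      (- (t ^ (N - 1) * G t) * t ^ (N - 1) - (- integral {0..t} (\<lambda>\<tau>. \<tau> ^ (N - 1) * G \<tau>)) * (real (N - 1) * t ^ (N - 1 - 1)))
      / (t ^ (N - 1) * t ^ (N - 1))) (at t)"
    by (intro DERIV_divide DERIV_minus DERIV_pow[unfolded One_nat_def[symmetric]]) (use t in auto)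
  moreover have "(- (t ^ (N - 1) * G t) * t ^ (N - 1) - (- integral {0..t} (\<lambda>\<tau>. \<tau> ^ (N - 1) * G \<tau>)) * (real (N - 1) * t ^ (N - 1 - 1)))
      / (t ^ (N - 1) * t ^ (N - 1)) = - (real N - 1) / t * vel N G t - G t"
    using t unfolding vel_def k by (simp add: field_simps)
  ultimately show ?thesis unfolding vel_def[abs_def] by simp
qed

lemma vel_continuous:
  assumes G: "continuous_on {0..} G" and N: "2 \<le> N"
  shows "continuous_on {0..} (vel N G)"
  unfolding continuous_on_eq_continuous_within
proof
  fix t :: real assume "t \<in> {0..}"
  show "continuous (at t within {0..}) (vel N G)"
  proof (cases "t = 0")
    case False
    with \<open>t \<in> {0..}\<close> have "t > 0" by simp
    then show ?thesis
      using DERIV_isCont[OF vel_deriv[OF G _ N]] by (simp add: at_within_nonneg)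
  next
    case True
    have "compact (G ` {0..1})"
      by (intro compact_continuous_image continuous_on_subset[OF G]) auto
    then obtain M where M: "\<And>\<tau>. \<tau> \<in> {0..1} \<Longrightarrow> \<bar>G \<tau>\<bar> \<le> M"
      using compact_imp_bounded bounded_real by (metis imageI)
    have "((\<lambda>s. vel N G s) \<longlongrightarrow> 0) (at 0 within {0..})"
    proof (rule Lim_null_comparison)
      show "\<forall>\<^sub>F s in at 0 within {0..}. norm (vel N G s) \<le> M * s"
        unfolding eventually_at
        by (rule exI[of _ 1]) (auto simp: dist_real_def intro!: abs_vel_le[OF G] M)
      show "((*) M \<longlongrightarrow> 0) (at 0 within {0..})"
        by (auto intro!: tendsto_eq_intros)
    qed
    then show ?thesis using True by (simp add: continuous_within)
  qed
qed

lemma pos_0 [simp]: "pos N a G 0 = a"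
  by (simp add: pos_def)

lemma pos_deriv:
  assumes G: "continuous_on {0..} G" and N: "2 \<le> N" and "0 \<le> t"
  shows "(pos N a G has_real_derivative vel N G t) (at t within {0..})"
  unfolding pos_def[abs_def]
  by (auto intro!: derivative_eq_intros integral_deriv vel_continuous assms)

lemma vel_cong: "(\<And>\<tau>. 0 \<le> \<tau> \<Longrightarrow> \<tau> \<le> t \<Longrightarrow> G \<tau> = H \<tau>) \<Longrightarrow> vel N G t = vel N H t"
  unfolding vel_def
  by (rule arg_cong[where f = "\<lambda>I. - I / t ^ (N - 1)"], rule Henstock_Kurzweil_Integration.integral_cong) auto

lemma pos_cong: "(\<And>\<tau>. 0 \<le> \<tau> \<Longrightarrow> \<tau> \<le> r \<Longrightarrow> G \<tau> = H \<tau>) \<Longrightarrow> pos N a G r = pos N a H r"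
  unfolding pos_def
  by (rule arg_cong[where f = "\<lambda>I. a + I"], rule Henstock_Kurzweil_Integration.integral_cong, rule vel_cong) auto

text \<open>
  Being a solution is a fixed-point property of \<open>pos\<close> (the converse is \<open>rsol_vel\<close> and \<open>rsol_pos\<close> below).
  Limits are recognised as solutions through it, since integrals pass to limits and derivatives do not.
\<close>
lemma rsol_if_pos:
  assumes G: "continuous_on {0..} (\<lambda>r. g (u r))" and N: "2 \<le> N"
    and u: "\<And>r. r \<ge> 0 \<Longrightarrow> u r = pos N a (\<lambda>r. g (u r)) r"
  shows "rsol N g a u (vel N (\<lambda>r. g (u r)))"
  unfolding rsol_def
proof (intro conjI allI impI)
  show "u 0 = a" using u[of 0] by simp
  fix r :: real assume r: "r \<ge> 0"
  show "(u has_real_derivative vel N (\<lambda>r. g (u r)) r) (at r within {0..})"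
    by (rule has_field_derivative_transform_within[OF pos_deriv[OF G N r], of 1]) (use r u in auto)
qed (use vel_continuous[OF G N] vel_deriv[OF G _ N] in auto)

lemma rsol_D:
  assumes "rsol N g a u v"
  shows "u 0 = a" "v 0 = 0" "continuous_on {0..} v" "continuous_on {0..} u"
    "\<And>r. r > 0 \<Longrightarrow> (u has_real_derivative v r) (at r)"
    "\<And>r. r > 0 \<Longrightarrow> (v has_real_derivative (- (real N - 1) / r * v r - g (u r))) (at r)"
proof -
  show "u 0 = a" "v 0 = 0" "continuous_on {0..} v" 
    "\<And>r. r > 0 \<Longrightarrow> (v has_real_derivative (- (real N - 1) / r * v r - g (u r))) (at r)"
    using assms by (auto simp: rsol_def)
  show "\<And>r. r > 0 \<Longrightarrow> (u has_real_derivative v r) (at r)"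
    using assms unfolding rsol_def by (metis at_within_nonneg less_eq_real_def)
  show "continuous_on {0..} u"
    using assms unfolding rsol_def by (intro DERIV_continuous_on[of _ _ v]) auto
qed

lemma flux_deriv_general:
  assumes v: "(v has_real_derivative (- (real N - 1) / r * v r - c)) (at r)" and r: "r > 0" and N: "2 \<le> N"
  shows "((\<lambda>r. r ^ (N - 1) * v r) has_real_derivative (- (r ^ (N - 1) * c))) (at r)"
proof -
  obtain k where k: "N = Suc (Suc k)" using N by (metis add_2_eq_Suc le_Suc_ex)
  have "((\<lambda>r. r ^ (N - 1) * v r) has_real_derivative
      (real (N - 1) * r ^ (N - 1 - 1)) * v r + (- (real N - 1) / r * v r - c) * r ^ (N - 1)) (at r)"
    by (intro DERIV_mult DERIV_pow[unfolded One_nat_def[symmetric]] v)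
  moreover have "(real (N - 1) * r ^ (N - 1 - 1)) * v r + (- (real N - 1) / r * v r - c) * r ^ (N - 1)
      = - (r ^ (N - 1) * c)"
    using r unfolding k by (simp add: field_simps)
  ultimately show ?thesis by simp
qed

lemma flux_deriv:
  assumes "rsol N g a u v" "r > 0" "2 \<le> N"
  shows "((\<lambda>r. r ^ (N - 1) * v r) has_real_derivative (- (r ^ (N - 1) * g (u r)))) (at r)"
  by (rule flux_deriv_general[OF rsol_D(6)[OF assms(1,2)] assms(2,3)])

lemma rsol_vel:
  assumes s: "rsol N g a u v" and N: "2 \<le> N" and g: "continuous_on UNIV g" and t: "t \<ge> 0"
  shows "v t = vel N (\<lambda>r. g (u r)) t"
proof (cases "t = 0")
  case False
  have "((\<lambda>r. - (r ^ (N - 1) * g (u r))) has_integral (t ^ (N - 1) * v t - 0 ^ (N - 1) * v 0)) {0..t}"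
  proof (rule fundamental_theorem_of_calculus_interior)
    show "continuous_on {0..t} (\<lambda>r. r ^ (N - 1) * v r)"
      by (intro continuous_intros continuous_on_subset[OF rsol_D(3)[OF s]]) auto
  qed (use t flux_deriv[OF s _ N] in \<open>auto simp: has_real_derivative_iff_has_vector_derivative\<close>)
  then have "((\<lambda>r. r ^ (N - 1) * g (u r)) has_integral - (t ^ (N - 1) * v t)) {0..t}"
    using has_integral_neg[of "\<lambda>r. - (r ^ (N - 1) * g (u r))" "t ^ (N - 1) * v t" "{0..t}"] rsol_D(2)[OF s] by simp
  then show ?thesis using t False by (simp add: vel_def integral_unique)
qed (use rsol_D[OF s] in simp)

lemma rsol_pos:
  assumes s: "rsol N g a u v" and N: "2 \<le> N" and g: "continuous_on UNIV g" and r: "r \<ge> 0"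
  shows "u r = pos N a (\<lambda>r. g (u r)) r"
proof -
  have "(v has_integral (u r - u 0)) {0..r}"
  proof (rule fundamental_theorem_of_calculus_interior[OF r])
    show "continuous_on {0..r} u" by (rule continuous_on_subset[OF rsol_D(4)[OF s]]) auto
  qed (use rsol_D(5)[OF s] in \<open>simp add: has_real_derivative_iff_has_vector_derivative[symmetric]\<close>)
  then have "integral {0..r} v = u r - a" using rsol_D[OF s] by (simp add: integral_unique)
  moreover have "integral {0..r} v = integral {0..r} (vel N (\<lambda>r. g (u r)))"
    by (rule Henstock_Kurzweil_Integration.integral_cong) (auto intro: rsol_vel[OF s N g])
  ultimately show ?thesis by (simp add: pos_def)
qed

lemma rsol_comp_continuous:
  assumes "rsol N g a u v" "continuous_on UNIV g"
  shows "continuous_on {0..} (\<lambda>r. g (u r))"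
  by (rule continuous_on_compose2[OF assms(2) rsol_D(4)[OF assms(1)]]) auto

lemma vel_const: "t \<ge> 0 \<Longrightarrow> 2 \<le> N \<Longrightarrow> vel N (\<lambda>_. c) t = - c * t / real N"
proof -
  assume t: "t \<ge> 0" and N: "2 \<le> N"
  obtain k where k: "N = Suc (Suc k)" using N by (metis add_2_eq_Suc le_Suc_ex)
  have "((\<lambda>\<tau>. \<tau> ^ (N - 1) * c) has_integral (t ^ N * (c / real N) - 0 ^ N * (c / real N))) {0..t}"
  proof (rule fundamental_theorem_of_calculus[OF t])
    fix x :: real
    have "((\<lambda>x. x ^ N * (c / real N)) has_real_derivative (real N * x ^ (N - 1) * 1) * (c / real N)) (at x within {0..t})"
      using N by (auto intro!: derivative_eq_intros)
    then show "((\<lambda>x. x ^ N * (c / real N)) has_vector_derivative x ^ (N - 1) * c) (at x within {0..t})"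
      using N by (simp add: has_real_derivative_iff_has_vector_derivative)
  qed
  then have "integral {0..t} (\<lambda>\<tau>. \<tau> ^ (N - 1) * c) = t ^ N * (c / real N) - 0 ^ N * (c / real N)"
    by (rule integral_unique)
  then have "integral {0..t} (\<lambda>\<tau>. \<tau> ^ (N - 1) * c) = t ^ N * (c / real N)"
    using N by (simp only: zero_power)
  moreover have "t ^ N = t * t ^ (N - 1)" by (simp add: k)
  ultimately show ?thesis
    unfolding vel_def by (cases "t = 0") auto
qed

text \<open>
  Near the origin G is almost the constant G 0, for which \<open>vel\<close> is linear. The limit is the second
  derivative at the origin; it makes the lift to Euclidean space twice differentiable there and determines the
  behaviour of level functions near the top level.
\<close>
lemma vel_over_r_tendsto:
  assumes G: "continuous_on {0..} G" and N: "2 \<le> N"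
  shows "((\<lambda>t. vel N G t / t) \<longlongrightarrow> - G 0 / real N) (at_right 0)"
proof (rule tendstoI)
  fix e :: real assume e: "e > 0"
  have "\<exists>d>0. \<forall>x\<in>{0..}. dist x 0 < d \<longrightarrow> dist (G x) (G 0) < e/2"
    using G[unfolded continuous_on_iff, rule_format, of 0 "e/2"] e by auto
  then obtain d where d: "d > 0" "\<And>x. x \<ge> 0 \<Longrightarrow> x < d \<Longrightarrow> \<bar>G x - G 0\<bar> < e/2"
    by (auto simp: dist_real_def)
  have "dist (vel N G t / t) (- G 0 / real N) < e" if t: "t > 0" "t < d" for t
  proof -
    have c: "continuous_on {0..} (\<lambda>x. G x - G 0)" by (intro continuous_intros G)
    have i: "(\<lambda>\<tau>. \<tau> ^ (N - 1) * G \<tau>) integrable_on {0..t}" "(\<lambda>\<tau>. \<tau> ^ (N - 1) * G 0) integrable_on {0..t}"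
      by (intro integrable_continuous_real continuous_intros continuous_on_subset[OF G], simp)
         (intro integrable_continuous_real continuous_intros)
    have "vel N (\<lambda>x. G x - G 0) t = vel N G t - vel N (\<lambda>_. G 0) t"
    proof -
      have "integral {0..t} (\<lambda>\<tau>. \<tau> ^ (N - 1) * (G \<tau> - G 0))
          = integral {0..t} (\<lambda>\<tau>. \<tau> ^ (N - 1) * G \<tau>) - integral {0..t} (\<lambda>\<tau>. \<tau> ^ (N - 1) * G 0)"
        unfolding right_diff_distrib by (rule integral_diff[OF i])
      moreover have "- (A - B) / p = - A / p - (- B / p)" for A B p :: real
        by (simp add: divide_inverse algebra_simps)
      ultimately show ?thesis unfolding vel_def by (simp only:)
    qed
    also have "\<dots> = vel N G t + G 0 * t / real N" using t N by (simp add: vel_const)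
    finally have *: "vel N (\<lambda>x. G x - G 0) t / t = vel N G t / t + G 0 / real N"
      using t by (simp add: add_divide_distrib)
    have "\<bar>vel N (\<lambda>x. G x - G 0) t\<bar> \<le> e/2 * t"
    proof (rule abs_vel_le[OF c])
      fix \<tau> assume "0 \<le> \<tau>" "\<tau> \<le> t"
      then have "\<bar>G \<tau> - G 0\<bar> < e/2" using t by (intro d(2)) auto
      then show "\<bar>G \<tau> - G 0\<bar> \<le> e/2" by simp
    qed (use t in simp)
    then have "\<bar>vel N (\<lambda>x. G x - G 0) t / t\<bar> \<le> e/2" using t
      by (simp add: abs_divide pos_divide_le_eq)
    then have "\<bar>vel N G t / t + G 0 / real N\<bar> < e" using e unfolding * by linarith
    then show ?thesis unfolding dist_real_def by (simp only: minus_divide_left[symmetric] diff_minus_eq_add)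
  qed
  then show "\<forall>\<^sub>F t in at_right 0. dist (vel N G t / t) (- G 0 / real N) < e"
    unfolding eventually_at_right_field using d(1) by blast
qed

lemma inverse_power_deriv:
  assumes "t > 0" "3 \<le> N"
  shows "((\<lambda>t. inverse (t ^ (N - 2))) has_real_derivative (- (real N - 2) / t ^ (N - 1))) (at t)"
proof -
  define k where "k = N - 3"
  have k: "N - 2 = Suc k" "N - 1 = Suc (Suc k)" "real N - 2 = real (Suc k)" using assms(2) unfolding k_def by auto
  have "((\<lambda>t. inverse (t ^ Suc k)) has_real_derivative (- (real (Suc k) * t ^ (Suc k - Suc 0) * inverse ((t ^ Suc k)\<^sup>2)))) (at t)"
    by (rule DERIV_inverse_fun[unfolded numeral_2_eq_2[symmetric], OF DERIV_pow]) (use assms in simp)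
  moreover have "- (real (Suc k) * t ^ (Suc k - Suc 0) * inverse ((t ^ Suc k)\<^sup>2)) = - real (Suc k) / t ^ Suc (Suc k)"
    using assms(1) by (simp add: field_simps power2_eq_square del: of_nat_Suc)
  ultimately show ?thesis unfolding k by simp
qed

text \<open>
  The solution for a constant right-hand side c is the parabola a - c t^2/(2 N); compare fluxes, then
  integrate.
\<close>
lemma below_parabola:
  assumes s: "rsol N g a u v" and N: "2 \<le> N" and t: "0 < t" and c: "\<And>x. 0 < x \<Longrightarrow> x < t \<Longrightarrow> c \<le> g (u x)"
  shows "v t \<le> - (c / real N) * t"
    and "u t \<le> a - c / (2 * real N) * t\<^sup>2"
proof -
  have N0: "real N > 0" using N by simp
  have vx: "v x \<le> - (c / real N) * x" if x: "0 < x" "x \<le> t" for x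
  proof -
    have "x ^ (N - 1) * v x + c / real N * x ^ N \<le> 0 ^ (N - 1) * v 0 + c / real N * 0 ^ N"
    proof (rule DERIV_nonpos_imp_decreasing_open[of 0 x "\<lambda>t. t ^ (N - 1) * v t + c / real N * t ^ N"])
      fix y assume y: "0 < y" "y < x"
      have "((\<lambda>t. t ^ (N - 1) * v t + c / real N * t ^ N) has_real_derivative
          (- (y ^ (N - 1) * g (u y)) + c / real N * (real N * y ^ (N - 1)))) (at y)"
        by (intro DERIV_add flux_deriv[OF s _ N] DERIV_cmult DERIV_pow[unfolded One_nat_def[symmetric]]) (use y in auto)
      moreover have "y ^ (N - 1) * c \<le> y ^ (N - 1) * g (u y)" using y x c by (intro mult_left_mono) auto
      then have "- (y ^ (N - 1) * g (u y)) + c / real N * (real N * y ^ (N - 1)) \<le> 0"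
        using N0 by (simp add: mult.commute)
      ultimately show "\<exists>z. ((\<lambda>t. t ^ (N - 1) * v t + c / real N * t ^ N) has_real_derivative z) (at y) \<and> z \<le> 0" by blast
    next
      show "continuous_on {0..x} (\<lambda>t. t ^ (N - 1) * v t + c / real N * t ^ N)"
        by (intro continuous_intros continuous_on_subset[OF rsol_D(3)[OF s]]) auto
    qed (use x in simp)
    moreover have "(0::real) ^ N = 0" using N by (simp add: zero_power)
    ultimately have "x ^ (N - 1) * v x + c / real N * x ^ N \<le> 0"
      by (simp only: rsol_D(2)[OF s] mult_zero_right add_0_right)
    moreover have "x ^ N = x ^ (N - 1) * x" using N by (cases N) auto
    ultimately have "x ^ (N - 1) * (v x + c / real N * x) \<le> 0" by (simp add: algebra_simps)
    then have "v x + c / real N * x \<le> 0" using x by (meson mult_pos_pos not_le zero_less_power)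
    then show ?thesis by simp
  qed
  show "v t \<le> - (c / real N) * t" using vx t by simp
  have "u t + c / (2 * real N) * t\<^sup>2 \<le> u 0 + c / (2 * real N) * 0\<^sup>2"
  proof (rule DERIV_nonpos_imp_decreasing_open[of 0 t "\<lambda>t. u t + c / (2 * real N) * t\<^sup>2"])
    fix x assume x: "0 < x" "x < t"
    have "((\<lambda>t. u t + c / (2 * real N) * t\<^sup>2) has_real_derivative (v x + c / (2 * real N) * (2 * x))) (at x)"
      by (intro DERIV_add rsol_D(5)[OF s x(1)] DERIV_cmult) (auto intro!: derivative_eq_intros)
    moreover have "v x + c / (2 * real N) * (2 * x) \<le> 0" using vx[of x] x by simp
    ultimately show "\<exists>z. ((\<lambda>t. u t + c / (2 * real N) * t\<^sup>2) has_real_derivative z) (at x) \<and> z \<le> 0" by blast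
  next
    show "continuous_on {0..t} (\<lambda>t. u t + c / (2 * real N) * t\<^sup>2)"
      by (intro continuous_intros continuous_on_subset[OF rsol_D(4)[OF s]]) auto
  qed (use t in simp)
  then show "u t \<le> a - c / (2 * real N) * t\<^sup>2" using rsol_D(1)[OF s] by simp
qed

lemma rsol_reflect:
  assumes s: "rsol N g a u v"
  shows "rsol N (\<lambda>s. - g (- s)) (- a) (\<lambda>r. - u r) (\<lambda>r. - v r)"
proof -
  have "((\<lambda>r. - v r) has_real_derivative (- (real N - 1) / r * (- v r) - (- g (- (- u r))))) (at r)" if "r > 0" for r
  proof -
    have alg: "- (A * V - G) = A * (- V) - (- G)" for A V G :: real by simp
    from DERIV_minus[OF rsol_D(6)[OF s that]] show ?thesis by (simp only: alg minus_minus)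
  qed
  moreover have "((\<lambda>r. - u r) has_real_derivative - v r) (at r within {0..})" if "r \<ge> 0" for r
    using s that unfolding rsol_def by (intro DERIV_minus) auto
  ultimately show ?thesis
    using rsol_D(1-3)[OF s] unfolding rsol_def by (auto intro: continuous_intros)
qed

lemma above_parabola:
  assumes s: "rsol N g a u v" and N: "2 \<le> N" and t: "0 < t" and c: "\<And>x. 0 < x \<Longrightarrow> x < t \<Longrightarrow> g (u x) \<le> c"
  shows "v t \<ge> - (c / real N) * t"
    and "u t \<ge> a - c / (2 * real N) * t\<^sup>2"
  using below_parabola[OF rsol_reflect[OF s] N t, of "- c"] c by simp_all

section \<open>Compactness of families of solutions\<close>

text \<open>
  The Lipschitz constant depends on G only through its bound, so bounded right-hand sides give an
  equicontinuous family.
\<close>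
lemma pos_lipschitz:
  assumes G: "continuous_on {0..} G" "\<And>\<tau>. \<tau> \<ge> 0 \<Longrightarrow> \<bar>G \<tau>\<bar> \<le> M" and N: "2 \<le> N"
    and x: "0 \<le> x" "x \<le> T" and y: "0 \<le> y" "y \<le> T"
  shows "\<bar>pos N a G x - pos N a G y\<bar> \<le> M * T * \<bar>x - y\<bar>"
proof -
  have M: "M \<ge> 0" using G(2)[of 0] by simp
  have "norm (pos N a G x - pos N a G y) \<le> M * T * norm (x - y)"
  proof (rule field_differentiable_bound[of "{0..T}" _ "vel N G"])
    fix z assume z: "z \<in> {0..T}"
    show "(pos N a G has_field_derivative vel N G z) (at z within {0..T})"
      using z by (intro DERIV_subset[OF pos_deriv[OF G(1) N]]) auto
    have "\<bar>vel N G z\<bar> \<le> M * z" using z by (intro abs_vel_le[OF G(1)] G(2)) auto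
    also have "\<dots> \<le> M * T" using z M by (intro mult_left_mono) auto
    finally show "norm (vel N G z) \<le> M * T" by simp
  qed (use x y in auto)
  then show ?thesis by simp
qed

lemma pos_converges_along:
  assumes G: "\<And>n. continuous_on {0..} (G n)" "\<And>n \<tau>. \<tau> \<ge> 0 \<Longrightarrow> \<bar>G n \<tau>\<bar> \<le> M" and N: "2 \<le> N"
    and u: "\<And>r. r \<ge> 0 \<Longrightarrow> (\<lambda>n. pos N (a n) (G n) r) \<longlonglongrightarrow> u r"
    and X: "X \<longlonglongrightarrow> x" "\<And>n. X n \<ge> 0"
  shows "(\<lambda>n. pos N (a n) (G n) (X n)) \<longlonglongrightarrow> u x"
proof -
  have x: "x \<ge> 0" using X by (intro LIMSEQ_le_const[OF X(1)]) auto
  have ev: "eventually (\<lambda>n. X n \<le> x + 1) sequentially"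
    using order_tendstoD(2)[OF X(1), of "x + 1"] by (auto elim: eventually_mono)
  have "(\<lambda>n. pos N (a n) (G n) (X n) - pos N (a n) (G n) x) \<longlonglongrightarrow> 0"
  proof (rule Lim_null_comparison)
    show "\<forall>\<^sub>F n in sequentially. norm (pos N (a n) (G n) (X n) - pos N (a n) (G n) x) \<le> M * (x + 1) * \<bar>X n - x\<bar>"
      using ev by eventually_elim (use x X(2) in \<open>auto intro!: pos_lipschitz[OF G N]\<close>)
    show "(\<lambda>n. M * (x + 1) * \<bar>X n - x\<bar>) \<longlonglongrightarrow> 0"
      by (rule tendsto_mult_right_zero, rule tendsto_rabs_zero, rule LIM_zero[OF X(1)])
  qed
  from tendsto_add[OF this u[OF x]] show ?thesis by simp
qed

text \<open>
  This is the Arzela-Ascoli argument: a diagonal subsequence converges at all rational radii, and the common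
  Lipschitz bound carries convergence over to the other radii.
\<close>
lemma pos_compactness:
  assumes G: "\<And>n. continuous_on {0..} (G n)" "\<And>n \<tau>. \<tau> \<ge> 0 \<Longrightarrow> \<bar>G n \<tau>\<bar> \<le> M" and N: "2 \<le> N"
    and A: "\<And>n. \<bar>a n\<bar> \<le> A"
  obtains k :: "nat \<Rightarrow> nat" and u where "strict_mono k"
    "\<And>r. r \<ge> 0 \<Longrightarrow> (\<lambda>n. pos N (a (k n)) (G (k n)) r) \<longlonglongrightarrow> u r"
proof -
  have M: "M \<ge> 0" using G(2)[of 0] by fastforce
  have A0: "A \<ge> 0" using A[of 0] by linarith
  \<comment> \<open>the diagonal argument is stated for functions bounded by 1, so divide by a bound\<close>
  define D where "D q = 1 + A + M * q * q" for q :: real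
  have D: "D q > 0" for q using A0 M unfolding D_def by (simp add: add_pos_nonneg mult.assoc)
  let ?S = "\<rat> \<inter> {0::real..}"
  have c: "countable ?S" by (intro countable_Int1 countable_rat)
  have nb: "norm (pos N (a n) (G n) q / D q) \<le> 1" if "q \<in> ?S" for n q
  proof -
    have "\<bar>pos N (a n) (G n) q - pos N (a n) (G n) 0\<bar> \<le> M * q * \<bar>q - 0\<bar>"
      using that by (intro pos_lipschitz[OF G N]) auto
    then have "\<bar>pos N (a n) (G n) q\<bar> \<le> D q"
      using A[of n] that unfolding D_def by simp
    then show ?thesis using D[of q] by (simp add: abs_divide)
  qed
  have "\<exists>k :: nat \<Rightarrow> nat. strict_mono k \<and>
      (\<forall>q \<in> ?S. \<exists>l. (\<lambda>n. pos N (a (k n)) (G (k n)) q / D q) \<longlonglongrightarrow> l)"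
    by (rule function_convergent_subsequence[of ?S "\<lambda>n q. pos N (a n) (G n) q / D q" 1, OF c nb])
       blast+
  then obtain k :: "nat \<Rightarrow> nat" where k: "strict_mono k"
    "\<And>q. q \<in> ?S \<Longrightarrow> \<exists>l. (\<lambda>n. pos N (a (k n)) (G (k n)) q / D q) \<longlonglongrightarrow> l"
    by blast
  have conv: "convergent (\<lambda>n. pos N (a (k n)) (G (k n)) q)" if q: "q \<in> ?S" for q
  proof -
    obtain l where "(\<lambda>n. pos N (a (k n)) (G (k n)) q / D q) \<longlonglongrightarrow> l" using k(2)[OF q] by blast
    from tendsto_mult_left[OF this, of "D q"] show ?thesis
      using D[of q] unfolding convergent_def by auto
  qed
  have "Cauchy (\<lambda>n. pos N (a (k n)) (G (k n)) x)" if x: "x \<ge> 0" for x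
  proof (rule metric_CauchyI)
    fix e :: real assume e: "e > 0"
    define d where "d = e / (3 * (M * (x + 1) + 1))"
    have B: "M * (x + 1) \<ge> 0" using M x by simp
    have d: "d > 0" using e B unfolding d_def by (simp add: add_nonneg_pos)
    obtain q where q: "q \<in> \<rat>" "x < q" "q < x + min d 1"
      using Rats_dense_in_real[of x "x + min d 1"] d by auto
    have close: "\<bar>pos N (a n) (G n) x - pos N (a n) (G n) q\<bar> \<le> e / 3" for n
    proof -
      have "\<bar>pos N (a n) (G n) x - pos N (a n) (G n) q\<bar> \<le> M * (x + 1) * \<bar>x - q\<bar>"
        using q x by (intro pos_lipschitz[OF G N]) auto
      also have "\<dots> \<le> M * (x + 1) * d"
        using q B by (intro mult_left_mono) auto
      also have "\<dots> \<le> (M * (x + 1) + 1) * d" using d by (simp add: distrib_right)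
      also have "\<dots> = e / 3" unfolding d_def using B by (simp add: field_simps)
      finally show ?thesis .
    qed
    have "q \<in> ?S" using q x by simp
    then obtain n0 where
      n0: "\<And>m n. m \<ge> n0 \<Longrightarrow> n \<ge> n0 \<Longrightarrow> dist (pos N (a (k m)) (G (k m)) q) (pos N (a (k n)) (G (k n)) q) < e / 3"
      using metric_CauchyD[OF convergent_Cauchy[OF conv[OF \<open>q \<in> ?S\<close>]], of "e/3"] e by auto
    have "dist (pos N (a (k m)) (G (k m)) x) (pos N (a (k n)) (G (k n)) x) < e"
      if "m \<ge> n0" "n \<ge> n0" for m n
      using n0[OF that] close[of "k m"] close[of "k n"] unfolding dist_real_def by linarith
    then show "\<exists>n0. \<forall>m\<ge>n0. \<forall>n\<ge>n0. dist (pos N (a (k m)) (G (k m)) x) (pos N (a (k n)) (G (k n)) x) < e"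
      by blast
  qed
  then have "\<exists>l. (\<lambda>n. pos N (a (k n)) (G (k n)) x) \<longlonglongrightarrow> l" if "x \<ge> 0" for x
    using that real_Cauchy_convergent unfolding convergent_def by blast
  then have "(\<lambda>n. pos N (a (k n)) (G (k n)) r) \<longlonglongrightarrow> lim (\<lambda>n. pos N (a (k n)) (G (k n)) r)" if "r \<ge> 0" for r
    using that convergent_LIMSEQ_iff unfolding convergent_def by blast
  with k(1) show thesis by (rule that)
qed

text \<open>
  Dominated convergence passes to the limit in both integrations. The weight vanishes at the origin, so
  convergence of the right-hand sides at positive radii suffices.
\<close>
lemma pos_limit_rsol:
  assumes G: "\<And>n. continuous_on {0..} (G n)" "\<And>n \<tau>. \<tau> \<ge> 0 \<Longrightarrow> \<bar>G n \<tau>\<bar> \<le> M" and N: "2 \<le> N"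
    and u: "\<And>r. r \<ge> 0 \<Longrightarrow> (\<lambda>n. pos N (a n) (G n) r) \<longlonglongrightarrow> u r"
    and g: "continuous_on UNIV g"
    and lim: "\<And>\<tau>. \<tau> > 0 \<Longrightarrow> (\<lambda>n. G n \<tau>) \<longlonglongrightarrow> g (u \<tau>)"
  shows "rsol N g (u 0) u (vel N (\<lambda>r. g (u r)))"
    and "\<And>t. t \<ge> 0 \<Longrightarrow> (\<lambda>n. vel N (G n) t) \<longlonglongrightarrow> vel N (\<lambda>r. g (u r)) t"
proof -
  have M: "M \<ge> 0" using G(2)[of 0] by fastforce
  have lip: "\<bar>u x - u y\<bar> \<le> M * T * \<bar>x - y\<bar>" if "0 \<le> x" "x \<le> T" "0 \<le> y" "y \<le> T" for x y T
  proof (rule LIMSEQ_le_const2)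
    show "(\<lambda>n. \<bar>pos N (a n) (G n) x - pos N (a n) (G n) y\<bar>) \<longlonglongrightarrow> \<bar>u x - u y\<bar>"
      using that by (intro tendsto_intros u) auto
  qed (use that in \<open>auto intro!: pos_lipschitz[OF G N]\<close>)
  have cu: "continuous_on {0..} u"
    unfolding continuous_on_sequentially
  proof (intro allI ballI impI)
    fix X x assume x: "x \<in> {0::real..}" and X: "(\<forall>n. X n \<in> {0..}) \<and> X \<longlonglongrightarrow> x"
    have ev: "eventually (\<lambda>n. X n \<le> x + 1) sequentially"
      using X order_tendstoD(2)[of X x sequentially "x + 1"] by (auto elim: eventually_mono)
    have "(\<lambda>n. u (X n) - u x) \<longlonglongrightarrow> 0"
    proof (rule Lim_null_comparison)
      show "\<forall>\<^sub>F n in sequentially. norm (u (X n) - u x) \<le> M * (x + 1) * \<bar>X n - x\<bar>"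
        using ev by eventually_elim (use x X in \<open>auto intro!: lip\<close>)
      show "(\<lambda>n. M * (x + 1) * \<bar>X n - x\<bar>) \<longlonglongrightarrow> 0"
        by (rule tendsto_mult_right_zero, rule tendsto_rabs_zero, rule LIM_zero) (use X in simp)
    qed
    then show "(u \<circ> X) \<longlonglongrightarrow> u x" by (simp add: LIM_zero_iff o_def)
  qed
  have cg: "continuous_on {0..} (\<lambda>r. g (u r))"
    by (rule continuous_on_compose2[OF g cu]) auto
  have vlim: "(\<lambda>n. vel N (G n) t) \<longlonglongrightarrow> vel N (\<lambda>r. g (u r)) t" if t: "t \<ge> 0" for t
  proof -
    have "(\<lambda>n. integral {0..t} (\<lambda>\<tau>. \<tau> ^ (N - 1) * G n \<tau>)) \<longlonglongrightarrow> integral {0..t} (\<lambda>\<tau>. \<tau> ^ (N - 1) * g (u \<tau>))"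
    proof (rule dominated_convergence(2))
      show "(\<lambda>\<tau>. \<tau> ^ (N - 1) * G n \<tau>) integrable_on {0..t}" for n
        by (intro integrable_continuous_real continuous_intros continuous_on_subset[OF G(1)]) simp
      show "(\<lambda>\<tau>. t ^ (N - 1) * M) integrable_on {0..t}"
        by (intro integrable_continuous_real continuous_intros)
      show "norm (\<tau> ^ (N - 1) * G n \<tau>) \<le> t ^ (N - 1) * M" if "\<tau> \<in> {0..t}" for n \<tau>
        using that G(2)[of \<tau> n] by (auto simp: abs_mult power_abs intro!: mult_mono power_mono)
      show "(\<lambda>n. \<tau> ^ (N - 1) * G n \<tau>) \<longlonglongrightarrow> \<tau> ^ (N - 1) * g (u \<tau>)" if "\<tau> \<in> {0..t}" for \<tau>
      proof (cases "\<tau> = 0")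
        case True
        then have "\<tau> ^ (N - 1) = 0" using N by simp
        then show ?thesis by (simp only: mult_zero_left tendsto_const)
      next
        case False
        with that show ?thesis by (intro tendsto_mult_left lim) auto
      qed
    qed
    then show ?thesis
      unfolding vel_def divide_inverse by (intro tendsto_mult_right tendsto_minus)
  qed
  then show "\<And>t. t \<ge> 0 \<Longrightarrow> (\<lambda>n. vel N (G n) t) \<longlonglongrightarrow> vel N (\<lambda>r. g (u r)) t" .
  have "u r = pos N (u 0) (\<lambda>r. g (u r)) r" if r: "r \<ge> 0" for r
  proof -
    have "(\<lambda>n. integral {0..r} (vel N (G n))) \<longlonglongrightarrow> integral {0..r} (vel N (\<lambda>r. g (u r)))"
    proof (rule dominated_convergence(2))
      show "vel N (G n) integrable_on {0..r}" for n
        by (intro integrable_continuous_real continuous_on_subset[OF vel_continuous[OF G(1) N]]) simp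
      show "(\<lambda>\<tau>. M * r) integrable_on {0..r}"
        by (intro integrable_continuous_real continuous_intros)
      show "norm (vel N (G n) t) \<le> M * r" if "t \<in> {0..r}" for n t
      proof -
        have "\<bar>vel N (G n) t\<bar> \<le> M * t" using that by (intro abs_vel_le[OF G(1)] G(2)) auto
        also have "\<dots> \<le> M * r" using that M by (intro mult_left_mono) auto
        finally show ?thesis by simp
      qed
    qed (use vlim in simp)
    moreover have "(\<lambda>n. a n) \<longlonglongrightarrow> u 0" using u[of 0] by simp
    ultimately have "(\<lambda>n. pos N (a n) (G n) r) \<longlonglongrightarrow> pos N (u 0) (\<lambda>r. g (u r)) r"
      unfolding pos_def by (intro tendsto_add)
    then show ?thesis using u[OF r] LIMSEQ_unique by blast
  qed
  then show "rsol N g (u 0) u (vel N (\<lambda>r. g (u r)))"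
    by (rule rsol_if_pos[where g = g and u = u, OF cg N])
qed

text \<open>
  For a merely continuous nonlinearity this replaces continuous dependence on the initial value. Convergence
  along convergent sequences of radii is what is needed to follow moving points such as minima.
\<close>
lemma rsol_compactness:
  assumes s: "\<And>n. rsol N g (a n) (u n) (v n)" and N: "2 \<le> N"
    and g: "continuous_on UNIV g" "\<And>s. \<bar>g s\<bar> \<le> M" and A: "\<And>n. \<bar>a n\<bar> \<le> A"
  obtains k :: "nat \<Rightarrow> nat" and l U V where "strict_mono k" "(\<lambda>n. a (k n)) \<longlonglongrightarrow> l" "rsol N g l U V"
    "\<And>x X. X \<longlonglongrightarrow> x \<Longrightarrow> (\<And>n. X n \<ge> 0) \<Longrightarrow> (\<lambda>n. u (k n) (X n)) \<longlonglongrightarrow> U x"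
    "\<And>r. r \<ge> 0 \<Longrightarrow> (\<lambda>n. v (k n) r) \<longlonglongrightarrow> V r"
proof -
  let ?G = "\<lambda>n r. g (u n r)"
  have G: "continuous_on {0..} (?G n)" for n by (rule rsol_comp_continuous[OF s g(1)])
  obtain k :: "nat \<Rightarrow> nat" and U where k: "strict_mono k"
    "\<And>r. r \<ge> 0 \<Longrightarrow> (\<lambda>n. pos N (a (k n)) (?G (k n)) r) \<longlonglongrightarrow> U r"
    by (rule pos_compactness[of ?G M N a A]; (rule G g(2) N A | blast))
  have al: "(\<lambda>n. pos N (a (k n)) (?G (k n)) (X n)) \<longlonglongrightarrow> U x" if "X \<longlonglongrightarrow> x" "\<And>n. X n \<ge> 0" for X x
    by (rule pos_converges_along[of "\<lambda>n. ?G (k n)" M]) (use G g(2) N k(2) that in auto)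
  have al': "(\<lambda>n. u (k n) (X n)) \<longlonglongrightarrow> U x" if "X \<longlonglongrightarrow> x" "\<And>n. X n \<ge> 0" for X x
    using al[OF that] rsol_pos[OF s N g(1) that(2)] by simp
  have lim: "(\<lambda>n. ?G (k n) t) \<longlonglongrightarrow> g (U t)" if "t > 0" for t
  proof -
    have "(\<lambda>n. u (k n) t) \<longlonglongrightarrow> U t" using al'[of "\<lambda>_. t" t] that by simp
    then show ?thesis by (rule continuous_on_tendsto_compose[OF g(1)]) auto
  qed
  have L: "rsol N g (U 0) U (vel N (\<lambda>r. g (U r)))"
    "\<And>t. t \<ge> 0 \<Longrightarrow> (\<lambda>n. vel N (?G (k n)) t) \<longlonglongrightarrow> vel N (\<lambda>r. g (U r)) t"
    by (rule pos_limit_rsol[where G = "\<lambda>n. ?G (k n)" and a = "\<lambda>n. a (k n)" and M = M];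
        (rule G g N | erule k(2) lim | assumption))+
  show thesis
  proof (rule that[OF k(1) _ L(1)])
    show "(\<lambda>n. a (k n)) \<longlonglongrightarrow> U 0" using k(2)[of 0] by simp
    show "(\<lambda>n. v (k n) r) \<longlonglongrightarrow> vel N (\<lambda>r. g (U r)) r" if "r \<ge> 0" for r
      using L(2)[OF that] rsol_vel[OF s N g(1) that] by simp
  qed (use al' in auto)
qed

section \<open>Solutions with a prescribed minimum\<close>

text \<open>
  The right-hand side is evaluated at the radius \<tau> - h, and at the origin while that is negative. An
  equation with retarded argument is solved by successive integration over intervals of length h, without
  any choice; iteration k is correct on [0, k h].
\<close>
primrec tonelli :: "nat \<Rightarrow> (real \<Rightarrow> real) \<Rightarrow> real \<Rightarrow> nat \<Rightarrow> real \<Rightarrow> real \<Rightarrow> real" where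
  "tonelli N g h 0 a = (\<lambda>r. a)"
| "tonelli N g h (Suc k) a = pos N a (\<lambda>\<tau>. g (tonelli N g h k a (max 0 (\<tau> - h))))"

text \<open>
  The endpoint becomes a parameter of the integrand, so that continuity of integrals in a parameter over a fixed
  interval yields continuity jointly in the initial value and the radius.
\<close>
lemma integral_stretch_unit:
  fixes f :: "real \<Rightarrow> real"
  assumes f: "continuous_on {0..} f" and t: "0 \<le> t"
  shows "integral {0..t} f = t * integral {0..1} (\<lambda>x. f (t * x))"
proof (cases "t = 0")
  case False
  with t have t: "t > 0" by simp
  have "f integrable_on {0..t}"
    by (intro integrable_continuous_real continuous_on_subset[OF f]) simp
  then have "(f has_integral integral {0..t} f) (cbox 0 t)" by (simp add: integrable_integral)
  from has_integral_affinity'[OF this t, of 0]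
  have "((\<lambda>x. f (t * x)) has_integral (integral {0..t} f / t)) {0..1}"
    using t by (simp add: field_simps)
  then have "integral {0..1} (\<lambda>x. f (t * x)) = integral {0..t} f / t" by (rule integral_unique)
  then show ?thesis using t by simp
qed simp

lemma joint_slice:
  fixes f :: "real \<Rightarrow> real \<Rightarrow> real"
  assumes "continuous_on (UNIV \<times> {0..}) (\<lambda>p. f (fst p) (snd p))"
  shows "continuous_on {0..} (f a)"
proof -
  have "continuous_on {0..} (\<lambda>r. f (fst (a, r)) (snd (a, r)))"
    by (rule continuous_on_compose2[OF assms, of _ "\<lambda>r. (a, r)"]) (auto intro!: continuous_intros)
  then show ?thesis by simp
qed

lemma joint_unit_integral:
  fixes f :: "real \<Rightarrow> real \<Rightarrow> real"
  assumes f: "continuous_on (UNIV \<times> {0..}) (\<lambda>p. f (fst p) (snd p))" and c: "continuous_on UNIV c"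
  shows "continuous_on (UNIV \<times> {0..}) (\<lambda>p. integral {0..1} (\<lambda>x. c x * f (fst p) (snd p * x)))"
proof -
  have "continuous_on ((UNIV \<times> {0::real..}) \<times> cbox 0 1) (\<lambda>(p, x). c x * f (fst p) (snd p * x))"
    unfolding case_prod_beta
  proof (intro continuous_on_mult)
    show "continuous_on ((UNIV \<times> {0::real..}) \<times> cbox 0 1) (\<lambda>q. c (snd q))"
      by (rule continuous_on_compose2[OF c]) (auto intro!: continuous_intros)
    have "continuous_on ((UNIV \<times> {0::real..}) \<times> cbox 0 1)
        (\<lambda>q. f (fst (fst (fst q), snd (fst q) * snd q)) (snd (fst (fst q), snd (fst q) * snd q)))"
      by (rule continuous_on_compose2[OF f, where f = "\<lambda>q. (fst (fst q), snd (fst q) * snd q)"])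
         (auto intro!: continuous_intros)
    then show "continuous_on ((UNIV \<times> {0::real..}) \<times> cbox 0 1) (\<lambda>q. f (fst (fst q)) (snd (fst q) * snd q))"
      by simp
  qed
  from integral_continuous_on_param[OF this] show ?thesis by simp
qed

lemma vel_joint:
  fixes G :: "real \<Rightarrow> real \<Rightarrow> real"
  assumes G: "continuous_on (UNIV \<times> {0..}) (\<lambda>p. G (fst p) (snd p))" and N: "2 \<le> N"
  shows "continuous_on (UNIV \<times> {0..}) (\<lambda>p. vel N (G (fst p)) (snd p))"
proof -
  have eq: "vel N (G a) t = - (t * integral {0..1} (\<lambda>x. x ^ (N - 1) * G a (t * x)))" if t: "t \<ge> 0" for a t
  proof (cases "t = 0")
    case False
    with t have t: "t > 0" by simp
    have "integral {0..t} (\<lambda>\<tau>. \<tau> ^ (N - 1) * G a \<tau>)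
        = t * integral {0..1} (\<lambda>x. (t * x) ^ (N - 1) * G a (t * x))"
      by (rule integral_stretch_unit) (use t joint_slice[OF G] in \<open>auto intro!: continuous_intros\<close>)
    also have "integral {0..1} (\<lambda>x. (t * x) ^ (N - 1) * G a (t * x))
        = t ^ (N - 1) * integral {0..1} (\<lambda>x. x ^ (N - 1) * G a (t * x))"
      unfolding integral_mult_right[symmetric] by (simp only: power_mult_distrib mult.assoc)
    finally show ?thesis using t unfolding vel_def by simp
  qed simp
  have "continuous_on (UNIV \<times> {0..}) (\<lambda>p. - (snd p * integral {0..1} (\<lambda>x. x ^ (N - 1) * G (fst p) (snd p * x))))"
    by (intro continuous_intros joint_unit_integral[OF G])
  then show ?thesis by (rule continuous_on_eq) (use eq in auto)
qed

lemma pos_joint: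
  fixes G :: "real \<Rightarrow> real \<Rightarrow> real"
  assumes G: "continuous_on (UNIV \<times> {0..}) (\<lambda>p. G (fst p) (snd p))" and N: "2 \<le> N"
  shows "continuous_on (UNIV \<times> {0..}) (\<lambda>p. pos N (fst p) (G (fst p)) (snd p))"
proof -
  have "continuous_on (UNIV \<times> {0..}) (\<lambda>p. fst p + snd p * integral {0..1} (\<lambda>x. 1 * vel N (G (fst p)) (snd p * x)))"
    by (intro continuous_intros joint_unit_integral[where f = "\<lambda>a. vel N (G a)"] vel_joint[OF G N])
  then show ?thesis
  proof (rule continuous_on_eq)
    fix p :: "real \<times> real" assume "p \<in> UNIV \<times> {0..}"
    then show "fst p + snd p * integral {0..1} (\<lambda>x. 1 * vel N (G (fst p)) (snd p * x)) = pos N (fst p) (G (fst p)) (snd p)"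
      unfolding pos_def using integral_stretch_unit[OF vel_continuous[OF joint_slice[OF G] N], of "snd p"] by auto
  qed
qed

lemma tonelli_joint:
  assumes g: "continuous_on UNIV g" and N: "2 \<le> N"
  shows "continuous_on (UNIV \<times> {0..}) (\<lambda>p. tonelli N g h k (fst p) (snd p))"
proof (induction k)
  case (Suc k)
  have "continuous_on (UNIV \<times> {0..}) (\<lambda>p. g (tonelli N g h k (fst (fst p, max 0 (snd p - h))) (snd (fst p, max 0 (snd p - h)))))"
    by (rule continuous_on_compose2[OF g], rule continuous_on_compose2[OF Suc])
       (auto intro!: continuous_intros)
  then have "continuous_on (UNIV \<times> {0..}) (\<lambda>p. pos N (fst p) (\<lambda>\<tau>. g (tonelli N g h k (fst p) (max 0 (\<tau> - h)))) (snd p))"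
    by (intro pos_joint[where G = "\<lambda>a \<tau>. g (tonelli N g h k a (max 0 (\<tau> - h)))"] N) simp
  then show ?case by simp
qed (auto intro!: continuous_intros)

lemma tonelli_stable:
  assumes h: "h \<ge> 0"
  shows "0 \<le> r \<Longrightarrow> r \<le> real k * h \<Longrightarrow> tonelli N g h (Suc k) a r = tonelli N g h k a r"
proof (induction k arbitrary: r)
  case (Suc k)
  have "tonelli N g h (Suc (Suc k)) a r = pos N a (\<lambda>\<tau>. g (tonelli N g h (Suc k) a (max 0 (\<tau> - h)))) r" by (rule fun_cong) (rule tonelli.simps)
  also have "\<dots> = pos N a (\<lambda>\<tau>. g (tonelli N g h k a (max 0 (\<tau> - h)))) r"
  proof (rule pos_cong)
    fix \<tau> assume \<tau>: "0 \<le> \<tau>" "\<tau> \<le> r"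
    have "max 0 (\<tau> - h) \<le> real k * h" using \<tau> Suc.prems h by (simp add: algebra_simps)
    then have "tonelli N g h (Suc k) a (max 0 (\<tau> - h)) = tonelli N g h k a (max 0 (\<tau> - h))"
      by (intro Suc.IH) simp_all
    then show "g (tonelli N g h (Suc k) a (max 0 (\<tau> - h))) = g (tonelli N g h k a (max 0 (\<tau> - h)))" by (rule arg_cong)
  qed
  finally show ?case by simp
qed simp

text \<open>
  The delay is h = 1/(n+1), and (n+1)^2 iterations are correct on [0, n+1], an interval that exhausts all
  radii. The additional iteration presents the approximant as \<open>pos\<close> of its predecessor.
\<close>
definition delayed :: "nat \<Rightarrow> (real \<Rightarrow> real) \<Rightarrow> nat \<Rightarrow> real \<Rightarrow> real \<Rightarrow> real" where
  "delayed N g n = tonelli N g (1 / real (Suc n)) (Suc (Suc n * Suc n))"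

text \<open>
  The approximant is \<open>pos\<close> with the retarded right-hand side. Along the compact subsequence the retarded
  argument tends to the undelayed one, and convergence along convergent radii identifies the limit of the
  right-hand sides.
\<close>
lemma delayed_limit:
  assumes g: "continuous_on UNIV g" "\<And>s. \<bar>g s\<bar> \<le> M" and N: "2 \<le> N"
    and A: "\<And>n. \<bar>\<alpha> n\<bar> \<le> A" and m: "strict_mono m"
  obtains k :: "nat \<Rightarrow> nat" and l U V where "strict_mono k" "(\<lambda>n. \<alpha> (k n)) \<longlonglongrightarrow> l" "rsol N g l U V"
    "\<And>X x. X \<longlonglongrightarrow> x \<Longrightarrow> (\<And>n. X n \<ge> 0) \<Longrightarrow> (\<lambda>n. delayed N g (m (k n)) (\<alpha> (k n)) (X n)) \<longlonglongrightarrow> U x"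
proof -
  define G where "G n \<tau> = g (tonelli N g (1 / real (Suc (m n))) (Suc (m n) * Suc (m n)) (\<alpha> n) (max 0 (\<tau> - 1 / real (Suc (m n)))))" for n \<tau>
  have W: "delayed N g (m n) (\<alpha> n) = pos N (\<alpha> n) (G n)" for n
    unfolding delayed_def G_def by (rule tonelli.simps)
  have G: "continuous_on {0..} (G n)" for n
    unfolding G_def
    by (rule continuous_on_compose2[OF g(1)], rule continuous_on_compose2[OF joint_slice[OF tonelli_joint[OF g(1) N]]])
       (auto intro!: continuous_intros)
  have GM: "\<bar>G n \<tau>\<bar> \<le> M" for n \<tau> unfolding G_def by (rule g(2))
  obtain k :: "nat \<Rightarrow> nat" and U where k: "strict_mono k"
    "\<And>r. r \<ge> 0 \<Longrightarrow> (\<lambda>n. pos N (\<alpha> (k n)) (G (k n)) r) \<longlonglongrightarrow> U r"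
    by (rule pos_compactness[of G M N \<alpha> A]; (rule G GM N A | blast))
  have along: "(\<lambda>n. pos N (\<alpha> (k n)) (G (k n)) (X n)) \<longlonglongrightarrow> U x" if "X \<longlonglongrightarrow> x" "\<And>n. X n \<ge> 0" for X x
    by (rule pos_converges_along[where G = "\<lambda>n. G (k n)" and M = M]; (rule G GM N that | erule k(2)))
  have mk: "strict_mono (m \<circ> k)" using m k(1) by (rule strict_mono_o)
  have h0: "(\<lambda>n. 1 / real (Suc (m (k n)))) \<longlonglongrightarrow> 0"
    using LIMSEQ_subseq_LIMSEQ[OF LIMSEQ_Suc[OF lim_1_over_n] mk] by (simp add: o_def)
  have lim: "(\<lambda>n. G (k n) \<tau>) \<longlonglongrightarrow> g (U \<tau>)" if \<tau>: "\<tau> > 0" for \<tau>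
  proof -
    define X where "X n = max 0 (\<tau> - 1 / real (Suc (m (k n))))" for n
    have "X \<longlonglongrightarrow> max 0 (\<tau> - 0)" unfolding X_def by (intro tendsto_intros h0)
    then have X: "X \<longlonglongrightarrow> \<tau>" using \<tau> by simp
    have X0: "X n \<ge> 0" for n unfolding X_def by simp
    have "(\<lambda>n. g (pos N (\<alpha> (k n)) (G (k n)) (X n))) \<longlonglongrightarrow> g (U \<tau>)"
      by (rule continuous_on_tendsto_compose[OF g(1) along[OF X X0]]) auto
    moreover have "\<forall>\<^sub>F n in sequentially. g (pos N (\<alpha> (k n)) (G (k n)) (X n)) = G (k n) \<tau>"
    proof -
      obtain n0 :: nat where n0: "\<tau> \<le> real n0" using real_arch_simple by blast
      show ?thesis unfolding eventually_sequentially
      proof (intro exI[of _ n0] allI impI)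
        fix n assume n: "n \<ge> n0"
        let ?m = "m (k n)"
        have "n \<le> ?m" using seq_suble[OF mk, of n] by simp
        then have "\<tau> \<le> real (Suc ?m)" using n0 n by linarith
        moreover have "X n \<le> \<tau>" using \<tau> unfolding X_def by simp
        ultimately have "X n \<le> real (Suc ?m)" by linarith
        also have "\<dots> = real (Suc ?m * Suc ?m) * (1 / real (Suc ?m))"
          by (simp del: of_nat_Suc mult_Suc mult_Suc_right)
        finally have "delayed N g ?m (\<alpha> (k n)) (X n) = tonelli N g (1 / real (Suc ?m)) (Suc ?m * Suc ?m) (\<alpha> (k n)) (X n)"
          unfolding delayed_def using X0 by (intro tonelli_stable) auto
        then show "g (pos N (\<alpha> (k n)) (G (k n)) (X n)) = G (k n) \<tau>"
          unfolding W[symmetric] by (simp only: G_def X_def)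
      qed
    qed
    ultimately show ?thesis by (rule Lim_transform_eventually)
  qed
  have s: "rsol N g (U 0) U (vel N (\<lambda>r. g (U r)))"
    by (rule pos_limit_rsol[where G = "\<lambda>n. G (k n)" and a = "\<lambda>n. \<alpha> (k n)" and M = M];
        (rule G GM N g(1) | erule k(2) lim | assumption))
  show thesis
  proof (rule that[OF k(1) _ s])
    show "(\<lambda>n. \<alpha> (k n)) \<longlonglongrightarrow> U 0" using k(2)[of 0] by simp
  qed (unfold W, rule along)
qed

text \<open>
  The set is the projection of a compact set.
\<close>
lemma closed_exists_compact_le:
  fixes f :: "real \<times> real \<Rightarrow> real"
  assumes f: "continuous_on ({a..d} \<times> {0..T}) f"
  shows "closed {\<alpha> \<in> {a..d}. \<exists>x\<in>{0..T}. f (\<alpha>, x) \<le> e}"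
proof -
  let ?K = "{p \<in> {a..d} \<times> {0..T}. f p \<le> e}"
  have "closed ?K"
    by (intro continuous_on_closed_Collect_le f continuous_intros closed_Times closed_atLeastAtMost)
  moreover have "compact ({a..d} \<times> {0..T})" by (intro compact_Times compact_Icc)
  ultimately have "compact (({a..d} \<times> {0..T}) \<inter> ?K)" by (rule compact_Int_closed[rotated])
  moreover have "({a..d} \<times> {0..T}) \<inter> ?K = ?K" by blast
  ultimately have "compact ?K" by simp
  then have "closed (fst ` ?K)"
    by (intro compact_imp_closed compact_continuous_image continuous_intros)
  moreover have "fst ` ?K = {\<alpha> \<in> {a..d}. \<exists>x\<in>{0..T}. f (\<alpha>, x) \<le> e}" by force
  ultimately show ?thesis by simp
qed

text \<open>
  Initial values whose approximant stays at or above e on [0, T], and those whose approximant reaches e or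
  less there, form two closed sets that cover an interval. By connectedness they meet, or one of them is empty.
\<close>
lemma delayed_alternative:
  assumes g: "continuous_on UNIV g" and N: "2 \<le> N" and ad: "a \<le> d"
  obtains \<alpha> where "\<alpha> \<in> {a..d}" "\<forall>x\<in>{0..T}. delayed N g n \<alpha> x \<ge> e" "\<exists>x\<in>{0..T}. delayed N g n \<alpha> x \<le> e"
    | "\<forall>x\<in>{0..T}. delayed N g n a x \<ge> e"
    | "\<exists>x\<in>{0..T}. delayed N g n d x \<le> e"
proof -
  let ?W = "delayed N g n"
  have J: "continuous_on (UNIV \<times> {0..}) (\<lambda>p. ?W (fst p) (snd p))"
    unfolding delayed_def by (rule tonelli_joint[OF g N])
  let ?C = "{\<alpha> \<in> {a..d}. \<forall>x\<in>{0..T}. ?W \<alpha> x \<ge> e}" and ?C' = "{\<alpha> \<in> {a..d}. \<exists>x\<in>{0..T}. ?W \<alpha> x \<le> e}"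
  have "closed ?C'"
    using closed_exists_compact_le[of a d T "\<lambda>p. ?W (fst p) (snd p)" e,
        OF continuous_on_subset[OF J]] by (simp add: Sigma_mono)
  have eqC: "?C = {a..d} \<inter> (\<Inter>x\<in>{0..T}. {\<alpha> \<in> {a..d}. e \<le> ?W \<alpha> x})" by auto
  have "closed {\<alpha> \<in> {a..d}. e \<le> ?W \<alpha> x}" if x: "x \<in> {0..T}" for x
  proof (intro continuous_on_closed_Collect_le continuous_intros)
    show "continuous_on {a..d} (\<lambda>\<alpha>. ?W \<alpha> x)"
    proof -
      have "continuous_on {a..d} (\<lambda>\<alpha>. ?W (fst (\<alpha>, x)) (snd (\<alpha>, x)))"
        by (rule continuous_on_compose2[OF J, of _ "\<lambda>\<alpha>. (\<alpha>, x)"]) (use x in \<open>auto intro!: continuous_intros\<close>)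
      then show ?thesis by simp
    qed
  qed
  then have "closed ?C" unfolding eqC by (intro closed_Int closed_INT ballI closed_atLeastAtMost)
  have cover: "{a..d} \<subseteq> ?C \<union> ?C'" by force
  have "?C \<inter> ?C' \<noteq> {} \<or> ?C = {} \<or> ?C' = {}"
  proof (rule ccontr)
    assume ne: "\<not> ?thesis"
    have "?C \<inter> ?C' \<inter> {a..d} = {}" "?C \<inter> {a..d} \<noteq> {}" "?C' \<inter> {a..d} \<noteq> {}" using ne by blast+
    with \<open>closed ?C\<close> \<open>closed ?C'\<close> cover
    have "\<exists>A B. closed A \<and> closed B \<and> {a..d} \<subseteq> A \<union> B \<and> A \<inter> B \<inter> {a..d} = {} \<and> A \<inter> {a..d} \<noteq> {} \<and> B \<inter> {a..d} \<noteq> {}"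
      by (intro exI[of _ ?C] exI[of _ ?C'] conjI)
    moreover have "connected {a..d}" by simp
    ultimately show False unfolding connected_closed by (rule notE[rotated])
  qed
  then consider "?C \<inter> ?C' \<noteq> {}" | "?C = {}" | "?C' = {}" by blast
  then show thesis
  proof cases
    case 1
    then show ?thesis using that(1) by blast
  next
    case 2
    then have "d \<notin> ?C" by blast
    then have "\<not> (\<forall>x\<in>{0..T}. e \<le> ?W d x)" using ad by simp
    then have "\<exists>x\<in>{0..T}. ?W d x \<le> e" by (meson linear)
    then show ?thesis by (rule that(3))
  next
    case 3
    then have "a \<notin> ?C'" by blast
    then have "\<not> (\<exists>x\<in>{0..T}. ?W a x \<le> e)" using ad by simp
    then have "\<forall>x\<in>{0..T}. ?W a x \<ge> e" by (meson linear)
    then show ?thesis by (rule that(2))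
  qed
qed

text \<open>
  One of the three alternatives for the approximants occurs infinitely often. The last two survive in the limit as
  statements about solutions at an end of the interval and contradict \<open>low\<close> or \<open>high\<close>, so the first one
  holds, and its limit is a solution with minimum e.
\<close>
lemma rsol_touching:
  assumes g: "continuous_on UNIV g" "\<And>s. \<bar>g s\<bar> \<le> M" and N: "2 \<le> N" and ad: "a \<le> d" and T: "T \<ge> 0"
    and low: "\<And>u v. rsol N g a u v \<Longrightarrow> \<exists>x\<in>{0..T}. u x < e"
    and high: "\<And>u v. rsol N g d u v \<Longrightarrow> \<forall>x\<in>{0..T}. u x > e"
  shows "\<exists>\<alpha>\<in>{a..d}. \<exists>u v. rsol N g \<alpha> u v \<and> (\<forall>x\<in>{0..T}. u x \<ge> e) \<and> (\<exists>x\<in>{0..T}. u x \<le> e)"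
proof -
  let ?W = "delayed N g"
  let ?P1 = "\<lambda>n. \<exists>\<alpha>\<in>{a..d}. (\<forall>x\<in>{0..T}. ?W n \<alpha> x \<ge> e) \<and> (\<exists>x\<in>{0..T}. ?W n \<alpha> x \<le> e)"
  let ?P2 = "\<lambda>n. \<forall>x\<in>{0..T}. ?W n a x \<ge> e" and ?P3 = "\<lambda>n. \<exists>x\<in>{0..T}. ?W n d x \<le> e"
  have A: "\<bar>\<alpha>\<bar> \<le> \<bar>a\<bar> + \<bar>d\<bar>" if "\<alpha> \<in> {a..d}" for \<alpha> using that by auto
  have key: "\<exists>U V l k. rsol N g l U V \<and> strict_mono k \<and> (\<lambda>n. \<alpha> (k n)) \<longlonglongrightarrow> l \<and>
      ((\<forall>n. \<exists>x\<in>{0..T}. ?W (m n) (\<alpha> n) x \<le> e) \<longrightarrow> (\<exists>x\<in>{0..T}. U x \<le> e)) \<and>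
      ((\<forall>n. \<forall>x\<in>{0..T}. ?W (m n) (\<alpha> n) x \<ge> e) \<longrightarrow> (\<forall>x\<in>{0..T}. U x \<ge> e))"
    if \<alpha>: "\<And>n. \<alpha> n \<in> {a..d}" and m: "strict_mono m" for \<alpha> :: "nat \<Rightarrow> real" and m :: "nat \<Rightarrow> nat"
  proof -
    \<comment> \<open>a point where the approximant is at most e, if there is one; its limit is such a point for the limit solution\<close>
    define x where "x n = (if \<exists>x\<in>{0..T}. ?W (m n) (\<alpha> n) x \<le> e then SOME x. x \<in> {0..T} \<and> ?W (m n) (\<alpha> n) x \<le> e else 0)" for n
    have xT: "x n \<in> {0..T} \<and> ((\<exists>x\<in>{0..T}. ?W (m n) (\<alpha> n) x \<le> e) \<longrightarrow> ?W (m n) (\<alpha> n) (x n) \<le> e)" for n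
    proof (cases "\<exists>x\<in>{0..T}. ?W (m n) (\<alpha> n) x \<le> e")
      case True
      then have "x n = (SOME x. x \<in> {0..T} \<and> ?W (m n) (\<alpha> n) x \<le> e)" unfolding x_def by (simp only: if_True)
      moreover have "\<exists>x. x \<in> {0..T} \<and> ?W (m n) (\<alpha> n) x \<le> e" using True by blast
      ultimately show ?thesis using someI_ex[of "\<lambda>x. x \<in> {0..T} \<and> ?W (m n) (\<alpha> n) x \<le> e"] by simp
    next
      case False
      then have "x n = 0" unfolding x_def by (simp only: if_False)
      then show ?thesis using T False by simp
    qed
    have "seq_compact {0..T}" by (intro compact_imp_seq_compact compact_Icc)
    then obtain l0 r where r: "l0 \<in> {0..T}" "strict_mono r" "(x \<circ> r) \<longlonglongrightarrow> l0"
      by (rule seq_compactE[of _ x]) (use xT in blast)+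
    have mr: "strict_mono (\<lambda>n. m (r n))" using m r(2) by (simp add: strict_mono_def)
    have A': "\<bar>\<alpha> (r n)\<bar> \<le> \<bar>a\<bar> + \<bar>d\<bar>" for n by (rule A[OF \<alpha>])
    obtain k l U V where k: "strict_mono k" "(\<lambda>n. \<alpha> (r (k n))) \<longlonglongrightarrow> l" "rsol N g l U V"
      "\<And>X x. X \<longlonglongrightarrow> x \<Longrightarrow> (\<And>n. X n \<ge> 0) \<Longrightarrow> (\<lambda>n. ?W (m (r (k n))) (\<alpha> (r (k n))) (X n)) \<longlonglongrightarrow> U x"
      by (rule delayed_limit[of g M N "\<lambda>n. \<alpha> (r n)" "\<bar>a\<bar> + \<bar>d\<bar>" "\<lambda>n. m (r n)"]; (rule g N A' mr | blast))
    have rk: "strict_mono (\<lambda>n. r (k n))" using r(2) k(1) by (simp add: strict_mono_def)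
    have xk: "(\<lambda>n. x (r (k n))) \<longlonglongrightarrow> l0" using LIMSEQ_subseq_LIMSEQ[OF r(3) k(1)] by (simp add: o_def)
    have q1: "\<exists>x\<in>{0..T}. U x \<le> e" if ex: "\<forall>n. \<exists>x\<in>{0..T}. ?W (m n) (\<alpha> n) x \<le> e"
    proof
      show "l0 \<in> {0..T}" by (rule r)
      have "(\<lambda>n. ?W (m (r (k n))) (\<alpha> (r (k n))) (x (r (k n)))) \<longlonglongrightarrow> U l0"
        by (rule k(4)[OF xk]) (use xT in auto)
      moreover have "\<exists>n0. \<forall>n\<ge>n0. ?W (m (r (k n))) (\<alpha> (r (k n))) (x (r (k n))) \<le> e" using ex xT by blast
      ultimately show "U l0 \<le> e" by (rule LIMSEQ_le_const2)
    qed
    have q2: "\<forall>x\<in>{0..T}. U x \<ge> e" if ge: "\<forall>n. \<forall>x\<in>{0..T}. ?W (m n) (\<alpha> n) x \<ge> e"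
    proof
      fix y assume y: "y \<in> {0..T}"
      have "(\<lambda>n. ?W (m (r (k n))) (\<alpha> (r (k n))) y) \<longlonglongrightarrow> U y"
        by (rule k(4)) (use y in auto)
      moreover have "\<exists>n0. \<forall>n\<ge>n0. e \<le> ?W (m (r (k n))) (\<alpha> (r (k n))) y" using ge y by blast
      ultimately show "e \<le> U y" by (rule LIMSEQ_le_const)
    qed
    show ?thesis
      by (intro exI[of _ U] exI[of _ V] exI[of _ l] exI[of _ "\<lambda>n. r (k n)"] conjI impI k(2,3) rk;
          (rule q1 q2; assumption))
  qed
  have "?P1 n \<or> ?P2 n \<or> ?P3 n" for n
    by (rule delayed_alternative[OF g(1) N ad, where T = T and n = n and e = e]) blast+
  then have eq: "{n. ?P1 n} \<union> {n. ?P2 n} \<union> {n. ?P3 n} = UNIV" by blast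
  have "infinite ({n. ?P1 n} \<union> {n. ?P2 n} \<union> {n. ?P3 n})" unfolding eq by simp
  then consider "infinite {n. ?P1 n}" | "infinite {n. ?P2 n}" | "infinite {n. ?P3 n}"
    unfolding finite_Un by blast
  then show ?thesis
  proof cases
    case 1
    obtain m :: "nat \<Rightarrow> nat" where m: "strict_mono m" "\<And>n. ?P1 (m n)"
      using infinite_enumerate[OF 1] by blast
    have "\<forall>n. \<exists>\<alpha>. \<alpha> \<in> {a..d} \<and> (\<forall>x\<in>{0..T}. ?W (m n) \<alpha> x \<ge> e) \<and> (\<exists>x\<in>{0..T}. ?W (m n) \<alpha> x \<le> e)"
      using m(2) by blast
    from choice[OF this] obtain \<alpha> where \<alpha>: "\<And>n. \<alpha> n \<in> {a..d}" "\<And>n. \<forall>x\<in>{0..T}. ?W (m n) (\<alpha> n) x \<ge> e"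
      "\<And>n. \<exists>x\<in>{0..T}. ?W (m n) (\<alpha> n) x \<le> e" by blast
    obtain U V l k where L: "rsol N g l U V" "(\<lambda>n. \<alpha> (k n)) \<longlonglongrightarrow> l" "\<exists>x\<in>{0..T}. U x \<le> e" "\<forall>x\<in>{0..T}. U x \<ge> e"
      using key[of \<alpha> m, OF \<alpha>(1) m(1)] \<alpha>(2,3) by blast
    have "l \<in> {a..d}"
      by (rule closed_sequentially[OF closed_atLeastAtMost _ L(2)]) (use \<alpha>(1) in blast)
    with L show ?thesis by blast
  next
    case 2
    obtain m :: "nat \<Rightarrow> nat" where m: "strict_mono m" "\<And>n. ?P2 (m n)"
      using infinite_enumerate[OF 2] by blast
    have a: "a \<in> {a..d}" using ad by simp
    obtain U V l k where L: "rsol N g l U V" "(\<lambda>n. a) \<longlonglongrightarrow> l" "\<forall>x\<in>{0..T}. U x \<ge> e"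
      using key[of "\<lambda>_. a" m, OF a m(1)] m(2) by blast
    then have "rsol N g a U V" using LIMSEQ_unique[OF tendsto_const L(2)] by simp
    from low[OF this] L(3) show ?thesis by force
  next
    case 3
    obtain m :: "nat \<Rightarrow> nat" where m: "strict_mono m" "\<And>n. ?P3 (m n)"
      using infinite_enumerate[OF 3] by blast
    have d: "d \<in> {a..d}" using ad by simp
    obtain U V l k where L: "rsol N g l U V" "(\<lambda>n. d) \<longlonglongrightarrow> l" "\<exists>x\<in>{0..T}. U x \<le> e"
      using key[of "\<lambda>_. d" m, OF d m(1)] m(2) by blast
    then have "rsol N g d U V" using LIMSEQ_unique[OF tendsto_const L(2)] by simp
    from high[OF this] L(3) show ?thesis by force
  qed
qed

section \<open>Energy and the decreasing part of a solution\<close>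

lemma first_zero:
  fixes f :: "real \<Rightarrow> real"
  assumes f: "continuous_on {p..q} f" and "p \<le> q" "f p > 0" "f q \<le> 0"
  obtains c where "p < c" "c \<le> q" "f c = 0" "\<And>x. p \<le> x \<Longrightarrow> x < c \<Longrightarrow> f x > 0"
proof -
  let ?S = "{x \<in> {p..q}. f x \<le> 0}"
  have "closed ?S" by (intro continuous_on_closed_Collect_le f continuous_intros)
  then have "compact ({p..q} \<inter> ?S)" by (intro compact_Int_closed compact_Icc)
  moreover have "{p..q} \<inter> ?S = ?S" by blast
  ultimately have "compact ?S" by simp
  moreover have "q \<in> ?S" using assms by simp
  ultimately obtain c where c: "c \<in> ?S" "\<And>x. x \<in> ?S \<Longrightarrow> c \<le> x"
    using compact_attains_inf[of ?S] by blast
  have pos: "f x > 0" if "p \<le> x" "x < c" for x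
  proof (rule ccontr)
    assume "\<not> f x > 0"
    with that c(1) have "x \<in> ?S" by auto
    from c(2)[OF this] that show False by simp
  qed
  have pc: "p < c" using c(1) assms(3) by (cases "p = c") auto
  have "f c = 0"
  proof (rule ccontr)
    assume "f c \<noteq> 0"
    with c(1) have "f c < 0" by simp
    have "\<exists>x\<ge>p. x \<le> c \<and> f x = f c / 2"
      by (rule IVT2'[of f c _ p]) (use assms(3) \<open>f c < 0\<close> pc c(1) in \<open>auto intro: continuous_on_subset[OF f]\<close>)
    then obtain x where x: "p \<le> x" "x \<le> c" "f x = f c / 2" by blast
    with \<open>f c < 0\<close> have "x \<in> ?S" "x \<noteq> c" using c(1) by auto
    with c(2) x(2) show False by force
  qed
  with c(1) pc pos show thesis by (intro that[of c]) auto
qed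

text \<open>
  Boundedness gives the compactness results above, and the extension by 0 to the negative axis makes the energy of
  a solution nonnegative once it is at or below the level 0. Both are obtained later by changing the given
  nonlinearity outside the range of the solutions of interest.
\<close>
locale nonlinearity =
  fixes N :: nat and g :: "real \<Rightarrow> real" and b \<beta> M :: real
  assumes N3: "3 \<le> N"
    and g_cont: "continuous_on UNIV g"
    and g_bound: "\<bar>g s\<bar> \<le> M"
    and g_zero: "s \<le> 0 \<Longrightarrow> g s = 0"
    and b_pos: "0 < b" and b_less: "b < \<beta>"
    and g_nonpos: "0 \<le> s \<Longrightarrow> s \<le> b \<Longrightarrow> g s \<le> 0"
    and g_pos: "b < s \<Longrightarrow> 0 < g s"
    and F_beta: "primitive0 g \<beta> = 0"
    and F_neg: "0 < s \<Longrightarrow> s < \<beta> \<Longrightarrow> primitive0 g s < 0"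
begin

abbreviation F where "F \<equiv> primitive0 g"

definition energy :: "(real \<Rightarrow> real) \<Rightarrow> (real \<Rightarrow> real) \<Rightarrow> real \<Rightarrow> real" where
  "energy u v r = (v r)\<^sup>2 / 2 + F (u r)"

text \<open>
  Below \<beta> the primitive F is negative down to the level 0. A positive solution that has lost so much energy
  cannot climb back to the level 0 of energy, which it would need in order to vanish or to tend to 0.
\<close>
definition trapped :: "(real \<Rightarrow> real) \<Rightarrow> (real \<Rightarrow> real) \<Rightarrow> bool" where
  "trapped u v \<longleftrightarrow> (\<exists>R\<ge>0. (\<forall>r\<in>{0..R}. u r > 0) \<and> energy u v R < 0)"

lemma N2: "2 \<le> N" using N3 by simp

lemma F_zero: "s \<le> 0 \<Longrightarrow> F s = 0"
  by (cases "s = 0") (auto simp: primitive0_def)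

lemma F_deriv: "(F has_real_derivative g s) (at s)"
proof -
  define c where "c = - 1 - \<bar>s\<bar>"
  have c: "c < s" "c < 0" unfolding c_def by auto
  have eq: "integral {c..x} g = F x" if x: "c \<le> x" for x
  proof (cases "x \<ge> 0")
    case True
    have "integral {c..0} g + integral {0..x} g = integral {c..x} g"
      by (intro Henstock_Kurzweil_Integration.integral_combine integrable_continuous_real continuous_on_subset[OF g_cont])
         (use c True in auto)
    moreover have "integral {c..0} g = integral {c..0} (\<lambda>_. 0)"
      by (rule Henstock_Kurzweil_Integration.integral_cong) (auto intro: g_zero)
    ultimately show ?thesis by (simp add: primitive0_def)
  next
    case False
    have "integral {c..x} g = integral {c..x} (\<lambda>_. 0)"
      by (rule Henstock_Kurzweil_Integration.integral_cong) (use False in \<open>auto intro: g_zero\<close>)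
    then show ?thesis using False F_zero[of x] by simp
  qed
  have "((\<lambda>x. integral {c..x} g) has_real_derivative g s) (at s within {c..s+1})"
    using c by (intro integral_has_real_derivative continuous_on_subset[OF g_cont]) auto
  then have "((\<lambda>x. integral {c..x} g) has_real_derivative g s) (at s)"
    using c by (simp add: at_within_Icc_at)
  then show ?thesis
    by (rule has_field_derivative_transform_within[of _ _ _ _ "s - c"])
       (use c eq in \<open>auto simp: dist_real_def abs_if split: if_splits\<close>)
qed

lemma F_cont: "continuous_on S F"
  using DERIV_isCont[OF F_deriv] by (simp add: continuous_at_imp_continuous_on)

lemma F_less: assumes "b \<le> s" "s < t" shows "F s < F t"
  by (rule DERIV_pos_imp_increasing_open[OF assms(2)])
     (use assms F_cont F_deriv g_pos in \<open>auto intro!: exI\<close>)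

lemma F_pos: "\<beta> < s \<Longrightarrow> F s > 0"
  using F_less[of \<beta> s] F_beta b_less by simp

lemma F_nonpos: "s \<le> \<beta> \<Longrightarrow> F s \<le> 0"
  using F_neg[of s] F_zero[of s] F_beta by (cases "s \<le> 0"; cases "s = \<beta>") auto

lemma energy_0: "rsol N g a u v \<Longrightarrow> energy u v 0 = F a"
  using rsol_D[of N g a u v] by (simp add: energy_def)

lemma energy_deriv:
  assumes s: "rsol N g a u v" and r: "r > 0"
  shows "(energy u v has_real_derivative (- (real N - 1) / r * (v r)\<^sup>2)) (at r)"
proof -
  have "(energy u v has_real_derivative (2 * v r * (- (real N - 1) / r * v r - g (u r)) / 2 + g (u r) * v r)) (at r)"
    unfolding energy_def[abs_def]
    by (rule derivative_eq_intros DERIV_chain2[OF F_deriv] rsol_D[OF s] r refl | simp)+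
  moreover have "2 * v r * (- (real N - 1) / r * v r - g (u r)) / 2 + g (u r) * v r = - (real N - 1) / r * (v r)\<^sup>2"
  proof -
    have "2 * V * (A * V - G) / 2 + G * V = A * V\<^sup>2" for V A G :: real
      by (simp add: power2_eq_square field_simps)
    then show ?thesis .
  qed
  ultimately show ?thesis by simp
qed

lemma energy_cont:
  assumes s: "rsol N g a u v" shows "continuous_on {0..} (energy u v)"
  unfolding energy_def[abs_def]
  by (intro continuous_intros rsol_D[OF s] continuous_on_compose2[OF F_cont[of UNIV] rsol_D(4)[OF s]]) auto

lemma energy_antimono:
  assumes s: "rsol N g a u v" and "0 \<le> x" "x \<le> y"
  shows "energy u v y \<le> energy u v x"
proof (rule DERIV_nonpos_imp_decreasing_open[OF assms(3)])
  fix r assume "x < r" "r < y"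
  then have "r > 0" using assms by simp
  moreover have "- (real N - 1) / r * (v r)\<^sup>2 \<le> 0"
    by (intro mult_nonpos_nonneg divide_nonpos_pos) (use N3 \<open>r > 0\<close> in auto)
  ultimately show "\<exists>y. (energy u v has_real_derivative y) (at r) \<and> y \<le> 0"
    using energy_deriv[OF s] by blast
qed (use assms in \<open>auto intro: continuous_on_subset[OF energy_cont[OF s]]\<close>)

lemma flux_decreasing:
  assumes s: "rsol N g a u v" and "0 \<le> x" "x < y" and "\<And>t. x < t \<Longrightarrow> t < y \<Longrightarrow> u t > b"
  shows "y ^ (N - 1) * v y < x ^ (N - 1) * v x"
proof (rule DERIV_neg_imp_decreasing_open[OF assms(3)])
  fix r assume r: "x < r" "r < y"
  then have "r > 0" using assms by simp
  moreover have "- (r ^ (N - 1) * g (u r)) < 0" using g_pos[OF assms(4)[OF r]] \<open>r > 0\<close> by simp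
  ultimately show "\<exists>y. ((\<lambda>r. r ^ (N - 1) * v r) has_real_derivative y) (at r) \<and> y < 0"
    using flux_deriv[OF s _ N2] by blast
qed (use assms in \<open>auto intro!: continuous_intros continuous_on_subset[OF rsol_D(3)[OF s]]\<close>)

lemma vel_neg_above:
  assumes s: "rsol N g a u v" and "0 < y" and "\<And>t. 0 \<le> t \<Longrightarrow> t < y \<Longrightarrow> u t > b"
  shows "v y < 0"
proof -
  have "y ^ (N - 1) * v y < 0"
    using flux_decreasing[OF s, of 0 y] assms rsol_D(2)[OF s] by simp
  then show ?thesis using assms(2) by (simp add: mult_less_0_iff)
qed

text \<open>
  The start lies above b because F a \<ge> 0, and above b the flux decreases. If v vanished at a first later
  radius c, the value there would lie strictly between 0 and b, where F < 0, so the energy F (u c) would be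
  negative.
\<close>
lemma descent:
  assumes s: "rsol N g a u v" and up: "\<And>r. 0 \<le> r \<Longrightarrow> r \<le> R \<Longrightarrow> u r > 0"
    and E: "energy u v R \<ge> 0" and r: "0 < r" "r \<le> R"
  shows "v r < 0"
proof -
  have a: "a > b"
  proof (rule ccontr)
    assume "\<not> b < a"
    moreover have "a > 0" using up[of 0] r rsol_D(1)[OF s] by simp
    moreover have "F a \<ge> 0" using energy_antimono[OF s, of 0 R] E r energy_0[OF s] by simp
    ultimately show False using F_neg[of a] b_less by simp
  qed
  show ?thesis
  proof (cases "\<exists>x\<in>{0..r}. u x \<le> b")
    case False
    show ?thesis
    proof (rule vel_neg_above[OF s r(1)])
      fix t assume "0 \<le> t" "t < r"
      then have "t \<in> {0..r}" by simp
      with False show "b < u t" by (meson not_le)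
    qed
  next
    case True
    then obtain y where y: "0 \<le> y" "y \<le> r" "u y \<le> b" by auto
    have "continuous_on {0..y} (\<lambda>x. u x - b)"
      by (intro continuous_intros continuous_on_subset[OF rsol_D(4)[OF s]]) auto
    then obtain x where x: "0 < x" "x \<le> y" "u x - b = 0" "\<And>t. 0 \<le> t \<Longrightarrow> t < x \<Longrightarrow> u t - b > 0"
      by (rule first_zero) (use y a rsol_D(1)[OF s] in auto)
    have vx: "v x < 0" using x by (intro vel_neg_above[OF s]) auto
    show ?thesis
    proof (rule ccontr)
      assume "\<not> v r < 0"
      have "continuous_on {x..r} (\<lambda>x. - v x)"
        by (intro continuous_intros continuous_on_subset[OF rsol_D(3)[OF s]]) (use x in auto)
      then obtain c where c: "x < c" "c \<le> r" "- v c = 0" "\<And>t. x \<le> t \<Longrightarrow> t < c \<Longrightarrow> - v t > 0"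
        by (rule first_zero) (use vx x y \<open>\<not> v r < 0\<close> in auto)
      have "u c < u x"
      proof (rule DERIV_neg_imp_decreasing_open[OF c(1)])
        fix t assume "x < t" "t < c"
        then show "\<exists>y. (u has_real_derivative y) (at t) \<and> y < 0"
          using rsol_D(5)[OF s, of t] c(4)[of t] x by force
      qed (use x in \<open>auto intro: continuous_on_subset[OF rsol_D(4)[OF s]]\<close>)
      moreover have "0 < u c" using up c x r by simp
      ultimately have "F (u c) < 0" using x(3) F_neg b_less by simp
      then have "energy u v c < 0" using c(3) by (simp add: energy_def)
      moreover have "energy u v c \<ge> energy u v R"
        using c x r by (intro energy_antimono[OF s]) auto
      ultimately show False using E by simp
    qed
  qed
qed

end

text \<open>
  On \<open>desc v\<close>, the initial interval of radii on which the solution strictly decreases, the level can replace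
  the radius as the independent variable: \<open>rad\<close> is the inverse function, \<open>slope\<close> the speed.
\<close>
definition desc :: "(real \<Rightarrow> real) \<Rightarrow> real set" where
  "desc v = {r. 0 < r \<and> (\<forall>t. 0 < t \<and> t \<le> r \<longrightarrow> v t < 0)}"

definition rad :: "(real \<Rightarrow> real) \<Rightarrow> (real \<Rightarrow> real) \<Rightarrow> real \<Rightarrow> real" where
  "rad u v s = (THE r. r \<in> desc v \<and> u r = s)"

definition slope :: "(real \<Rightarrow> real) \<Rightarrow> (real \<Rightarrow> real) \<Rightarrow> real \<Rightarrow> real" where
  "slope u v s = - v (rad u v s)"

locale radial_solution = nonlinearity +
  fixes a :: real and u v :: "real \<Rightarrow> real"
  assumes sol: "rsol N g a u v" and ab: "b < a"
begin

abbreviation lev where "lev \<equiv> u ` desc v"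
abbreviation r where "r \<equiv> rad u v"
abbreviation p where "p \<equiv> slope u v"

lemma u_0: "u 0 = a" and v_0: "v 0 = 0" and u_cont: "continuous_on {0..} u" and v_cont: "continuous_on {0..} v"
  and u_deriv: "t > 0 \<Longrightarrow> (u has_real_derivative v t) (at t)"
  and v_deriv: "t > 0 \<Longrightarrow> (v has_real_derivative (- (real N - 1) / t * v t - g (u t))) (at t)"
  using rsol_D[OF sol] by auto

lemma desc_down: "t \<in> desc v \<Longrightarrow> 0 < t' \<Longrightarrow> t' \<le> t \<Longrightarrow> t' \<in> desc v"
  unfolding desc_def by auto

lemma desc_pos: "t \<in> desc v \<Longrightarrow> 0 < t" and desc_neg: "t \<in> desc v \<Longrightarrow> v t < 0"
  unfolding desc_def by auto

lemma desc_open: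
  assumes t: "t \<in> desc v"
  obtains t' where "t < t'" "t' \<in> desc v"
proof -
  have "isCont v t" using v_deriv[OF desc_pos[OF t]] DERIV_isCont by blast
  then have "\<forall>\<^sub>F x in at t. v x < 0"
    using desc_neg[OF t] unfolding isCont_def by (rule order_tendstoD(2))
  then obtain d where d: "d > 0" "\<And>x. x \<noteq> t \<Longrightarrow> dist x t < d \<Longrightarrow> v x < 0"
    unfolding eventually_at by auto
  show thesis
  proof (rule that[of "t + d / 2"])
    show "t < t + d / 2" using d by simp
    show "t + d / 2 \<in> desc v"
      unfolding desc_def
    proof (intro CollectI conjI allI impI)
      fix x assume x: "0 < x \<and> x \<le> t + d / 2"
      show "v x < 0"
      proof (cases "x \<le> t")
        case True
        then show ?thesis using t x unfolding desc_def by auto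
      next
        case False
        then show ?thesis using x d(1) by (intro d(2)) (auto simp: dist_real_def)
      qed
    qed (use desc_pos[OF t] d in simp)
  qed
qed

lemma desc_nonempty: assumes e: "e > 0" obtains t where "t \<in> desc v" "t < e"
proof -
  have "(u \<longlongrightarrow> a) (at 0 within {0..})"
    using u_cont u_0 unfolding continuous_on_def by force
  then have "\<forall>\<^sub>F x in at 0 within {0..}. b < u x" using ab by (rule order_tendstoD(1))
  then obtain d where d: "d > 0" "\<And>x. x \<ge> 0 \<Longrightarrow> x \<noteq> 0 \<Longrightarrow> x < d \<Longrightarrow> b < u x"
    unfolding eventually_at by (auto simp: dist_real_def)
  have in_desc: "x \<in> desc v" if "0 < x" "x < d" for x
    unfolding desc_def
  proof (intro CollectI conjI allI impI)
    fix t assume t: "0 < t \<and> t \<le> x"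
    show "v t < 0"
    proof (rule vel_neg_above[OF sol])
      fix s assume "0 \<le> s" "s < t"
      then show "b < u s" using d(2)[of s] t that u_0 ab by (cases "s = 0") auto
    qed (use t in simp)
  qed (use that in simp)
  show thesis
  proof (rule that)
    show "min d e / 2 \<in> desc v" using d(1) e by (intro in_desc) (auto simp: min_def)
    show "min d e / 2 < e" using e d(1) by (auto simp: min_def)
  qed
qed

lemma u_decreasing:
  assumes "t \<in> desc v" "0 \<le> t'" "t' < t"
  shows "u t < u t'"
proof (rule DERIV_neg_imp_decreasing_open[OF assms(3)])
  fix x assume "t' < x" "x < t"
  then have "x \<in> desc v" using assms by (intro desc_down[OF assms(1)]) auto
  then show "\<exists>y. (u has_real_derivative y) (at x) \<and> y < 0"
    using u_deriv desc_neg desc_pos by blast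
qed (use assms in \<open>auto intro: continuous_on_subset[OF u_cont]\<close>)

lemma r_u: "t \<in> desc v \<Longrightarrow> r (u t) = t"
  unfolding rad_def
proof (rule the_equality)
  fix t' assume t: "t \<in> desc v" and "t' \<in> desc v \<and> u t' = u t"
  then show "t' = t"
    using u_decreasing[of t t'] u_decreasing[of t' t] desc_pos[of t] desc_pos[of t'] by (cases t t' rule: linorder_cases) auto
qed auto

lemma r_desc: "s \<in> lev \<Longrightarrow> r s \<in> desc v" and u_r: "s \<in> lev \<Longrightarrow> u (r s) = s"
  using r_u by auto

lemma r_pos: "s \<in> lev \<Longrightarrow> 0 < r s" and p_pos: "s \<in> lev \<Longrightarrow> 0 < p s"
  using r_desc desc_pos desc_neg by (auto simp: slope_def)

lemma lev_less: "s \<in> lev \<Longrightarrow> s < a"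
  using u_decreasing[of _ 0] desc_pos u_0 by auto

lemma lev_up:
  assumes "s \<in> lev" "s \<le> s'" "s' < a" shows "s' \<in> lev"
proof -
  obtain t where t: "t \<in> desc v" "u t = s" using assms(1) by auto
  have "\<exists>x\<ge>0. x \<le> t \<and> u x = s'"
    by (rule IVT2') (use t assms u_0 desc_pos[OF t(1)] in \<open>auto intro: continuous_on_subset[OF u_cont]\<close>)
  then obtain x where x: "0 \<le> x" "x \<le> t" "u x = s'" by blast
  then have "x \<noteq> 0" using assms(3) u_0 by auto
  then have "x \<in> desc v" using x by (intro desc_down[OF t(1)]) auto
  then show ?thesis using x(3) by blast
qed

lemma lev_below: assumes "s \<in> lev" obtains s' where "s' < s" "s' \<in> lev"
proof -
  obtain t where t: "t \<in> desc v" "u t = s" using assms by auto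
  obtain t' where t': "t < t'" "t' \<in> desc v" by (rule desc_open[OF t(1)])
  show thesis
    using u_decreasing[OF t'(2), of t] t t' desc_pos[OF t(1)] by (intro that[of "u t'"]) auto
qed

lemma r_less: "s \<in> lev \<Longrightarrow> s' \<in> lev \<Longrightarrow> s < s' \<Longrightarrow> r s' < r s"
  using u_decreasing[OF r_desc[of s'], of "r s"] u_r[of s] u_r[of s'] r_pos[of s]
  by (cases "r s" "r s'" rule: linorder_cases) auto

lemma u_less_iff: "t \<in> desc v \<Longrightarrow> s \<in> lev \<Longrightarrow> u t < s \<longleftrightarrow> r s < t"
  using r_less[of "u t" s] r_less[of s "u t"] r_u[of t] by (cases s "u t" rule: linorder_cases) auto

text \<open>
  In the level variable the equation becomes the system r' = - 1/p, p' = (N-1)/r - g/p, in which two solutions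
  can be compared at equal levels.
\<close>
lemma r_deriv: assumes s: "s \<in> lev" shows "(r has_real_derivative (- 1 / p s)) (at s)"
proof -
  obtain s' where s': "s' < s" "s' \<in> lev" by (rule lev_below[OF s])
  obtain t' where t': "r s < t'" "t' \<in> desc v" by (rule desc_open[OF r_desc[OF s]])
  have "isCont r (u (r s))"
  proof (rule isCont_inverse_function2[of "r s / 2" "r s" t'])
    fix z assume z: "r s / 2 \<le> z" "z \<le> t'"
    have "z \<in> desc v" using z r_pos[OF s] by (intro desc_down[OF t'(2)]) auto
    then show "r (u z) = z" "isCont u z" using r_u u_deriv desc_pos DERIV_isCont by blast+
  qed (use r_pos[OF s] t' in auto)
  then have "isCont r s" using u_r[OF s] by simp
  have "(r has_real_derivative inverse (v (r s))) (at s)"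
  proof (rule DERIV_inverse_function[where f = u and a = s' and b = a])
    show "(u has_real_derivative v (r s)) (at (r s))" by (rule u_deriv[OF r_pos[OF s]])
    show "isCont r s" by fact
    show "v (r s) \<noteq> 0" using desc_neg[OF r_desc[OF s]] by simp
    show "s' < s" "s < a" using s' lev_less[OF s] by auto
    fix y assume "s' < y" "y < a"
    then show "u (r y) = y" using lev_up[OF s'(2)] by (intro u_r) auto
  qed
  moreover have "inverse (v (r s)) = - 1 / p s" by (simp add: slope_def inverse_eq_divide)
  ultimately show ?thesis by simp
qed

lemma p_deriv: assumes s: "s \<in> lev" shows "(p has_real_derivative ((real N - 1) / r s - g s / p s)) (at s)"
proof -
  have "((\<lambda>s. - v (r s)) has_real_derivative (- ((- (real N - 1) / r s * v (r s) - g (u (r s))) * (- 1 / p s)))) (at s)"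
    by (rule DERIV_minus, rule DERIV_chain2[where f = v and g = r], rule v_deriv[OF r_pos[OF s]], rule r_deriv[OF s])
  moreover have "- ((- (real N - 1) / r s * v (r s) - g (u (r s))) * (- 1 / p s)) = (real N - 1) / r s - g s / p s"
    using p_pos[OF s] u_r[OF s] r_pos[OF s] by (simp add: slope_def field_simps)
  ultimately show ?thesis unfolding slope_def[abs_def] by simp
qed

lemma near_top: assumes "e > 0"
  obtains s0 where "s0 < a" "\<And>s. s0 \<le> s \<Longrightarrow> s < a \<Longrightarrow> s \<in> lev \<and> r s < e"
proof -
  obtain t where t: "t \<in> desc v" "t < e" by (rule desc_nonempty[of e]) (use assms in auto)
  show thesis
  proof (rule that[of "u t"])
    show "u t < a" by (rule lev_less[OF imageI[OF t(1)]])
    fix s assume s: "u t \<le> s" "s < a"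
    have ul: "u t \<in> lev" using t(1) by (rule imageI)
    have "s \<in> lev" by (rule lev_up[OF ul s])
    moreover have "r s \<le> t"
    proof (cases "s = u t")
      case True
      then show ?thesis using r_u[OF t(1)] by simp
    next
      case False
      then have "r s < r (u t)" using s(1) by (intro r_less[OF ul \<open>s \<in> lev\<close>]) simp
      then show ?thesis using r_u[OF t(1)] by simp
    qed
    ultimately show "s \<in> lev \<and> r s < e" using t by simp
  qed
qed

lemma r_top: "(r \<longlongrightarrow> 0) (at_left a)"
proof (rule tendstoI)
  fix e :: real assume "e > 0"
  obtain s0 where s0: "s0 < a" "\<And>s. s0 \<le> s \<Longrightarrow> s < a \<Longrightarrow> s \<in> lev \<and> r s < e"
    using near_top[OF \<open>e > 0\<close>] by blast
  show "\<forall>\<^sub>F s in at_left a. dist (r s) 0 < e"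
    unfolding eventually_at_left_field
  proof (intro exI[of _ s0] conjI allI impI)
    fix s assume "s0 < s" "s < a"
    then have "s \<in> lev" "r s < e" using s0(2)[of s] by auto
    then show "dist (r s) 0 < e" using r_pos[of s] by (simp add: dist_real_def)
  qed (use s0 in simp)
qed

lemma r_top_right: "filterlim r (at_right 0) (at_left a)"
proof -
  obtain s0 where s0: "s0 < a" "\<And>s. s0 \<le> s \<Longrightarrow> s < a \<Longrightarrow> s \<in> lev \<and> r s < 1" using near_top[OF zero_less_one] by blast
  have "\<forall>\<^sub>F s in at_left a. r s \<in> {0<..} \<and> r s \<noteq> 0"
    unfolding eventually_at_left_field
  proof (intro exI[of _ s0] conjI allI impI)
    fix s assume "s0 < s" "s < a"
    then have "r s > 0" using s0 r_pos by auto
    then show "r s \<in> {0<..}" "r s \<noteq> 0" by auto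
  qed (use s0 in auto)
  then show ?thesis unfolding filterlim_at using r_top by blast
qed

text \<open>
  At the top level both p and r vanish; their quotient has a limit by \<open>vel_over_r_tendsto\<close>.
\<close>
lemma p_over_r_top: "((\<lambda>s. p s / r s) \<longlongrightarrow> g a / real N) (at_left a)"
proof -
  have "((\<lambda>t. vel N (\<lambda>r. g (u r)) t / t) \<longlongrightarrow> - g (u 0) / real N) (at_right 0)"
    by (rule vel_over_r_tendsto[OF rsol_comp_continuous[OF sol g_cont] N2])
  then have "((\<lambda>t. vel N (\<lambda>r. g (u r)) t / t) \<longlongrightarrow> - g a / real N) (at_right 0)"
    by (simp only: u_0)
  then have "((\<lambda>t. v t / t) \<longlongrightarrow> - g a / real N) (at_right 0)"
    by (rule Lim_transform_eventually)
       (auto simp: eventually_at_right_field u_0 rsol_vel[OF sol N2 g_cont] intro!: exI[of _ 1])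
  from filterlim_compose[OF this r_top_right]
  have "((\<lambda>s. - (v (r s) / r s)) \<longlongrightarrow> - (- g a / real N)) (at_left a)" by (rule tendsto_minus)
  then show ?thesis by (simp add: slope_def)
qed

lemma p_top: "(p \<longlongrightarrow> 0) (at_left a)"
proof -
  have "((\<lambda>s. p s / r s * r s) \<longlongrightarrow> g a / real N * 0) (at_left a)"
    by (intro tendsto_mult p_over_r_top r_top)
  then have "((\<lambda>s. p s / r s * r s) \<longlongrightarrow> 0) (at_left a)" by simp
  then show ?thesis
  proof (rule Lim_transform_eventually)
    obtain s0 where s0: "s0 < a" "\<And>s. s0 \<le> s \<Longrightarrow> s < a \<Longrightarrow> s \<in> lev \<and> r s < 1" using near_top[OF zero_less_one] by blast
    show "\<forall>\<^sub>F s in at_left a. p s / r s * r s = p s"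
      unfolding eventually_at_left_field
    proof (intro exI[of _ s0] conjI allI impI)
      fix s assume "s0 < s" "s < a"
      then have "r s > 0" using s0 r_pos by auto
      then show "p s / r s * r s = p s" by simp
    qed (use s0 in simp)
  qed
qed

text \<open>
  A descent with speed at least \<kappa> above the level lo cannot end above lo, since v does not jump to 0, and
  cannot go on forever, since the solution would fall below every level.
\<close>
lemma exhaust_levels:
  assumes t0: "t0 \<in> desc v" and \<kappa>: "\<kappa> > 0" and lo: "lo < a"
    and fast: "\<And>t. t \<in> desc v \<Longrightarrow> t0 \<le> t \<Longrightarrow> lo < u t \<Longrightarrow> v t \<le> - \<kappa>"
  shows "lo \<in> lev"
proof (rule ccontr)
  assume nl: "lo \<notin> lev"
  have above: "lo < u t" if "t \<in> desc v" for t
    using lev_up[of "u t" lo] that nl lo by force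
  have all: "t \<in> desc v" if tt: "t0 \<le> t" for t
  proof (rule ccontr)
    assume "t \<notin> desc v"
    then obtain q where q: "0 < q" "q \<le> t" "\<not> v q < 0"
      using desc_pos[OF t0] tt unfolding desc_def by auto
    have tq: "t0 \<le> q" using desc_down[OF t0, of q] q desc_neg by force
    have c0: "continuous_on {t0..q} (\<lambda>x. - v x - \<kappa> / 2)"
      by (intro continuous_intros continuous_on_subset[OF v_cont]) (use desc_pos[OF t0] in auto)
    obtain c where c: "t0 < c" "c \<le> q" "- v c - \<kappa> / 2 = 0" "\<And>x. t0 \<le> x \<Longrightarrow> x < c \<Longrightarrow> - v x - \<kappa> / 2 > 0"
      by (rule first_zero[OF c0 tq]) (use fast[OF t0] above[OF t0] q \<kappa> in auto)
    have "c \<in> desc v"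
      unfolding desc_def
    proof (intro CollectI conjI allI impI)
      fix x assume x: "0 < x \<and> x \<le> c"
      consider "x \<le> t0" | "t0 \<le> x" "x < c" | "x = c" using x by linarith
      then show "v x < 0"
      proof cases
        case 1
        then show ?thesis using desc_down[OF t0, of x] x desc_neg by auto
      next
        case 2
        then show ?thesis using c(4)[of x] \<kappa> by simp
      next
        case 3
        then show ?thesis using c(3) \<kappa> by simp
      qed
    qed (use c desc_pos[OF t0] in simp)
    then have "v c \<le> - \<kappa>" using fast above c(1) by simp
    then show False using c(3) \<kappa> by simp
  qed
  \<comment> \<open>at speed \<kappa> the level lo is passed before the radius t\<close>
  define t where "t = t0 + (u t0 - lo) / \<kappa> + 1"
  have t: "t0 < t" using above[OF t0] \<kappa> unfolding t_def by (simp add: add_nonneg_pos)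
  have "u t + \<kappa> * t \<le> u t0 + \<kappa> * t0"
  proof (rule DERIV_nonpos_imp_nonincreasing[of t0 t "\<lambda>t. u t + \<kappa> * t"])
    fix x assume x: "t0 \<le> x" "x \<le> t"
    have "((\<lambda>t. u t + \<kappa> * t) has_real_derivative (v x + \<kappa>)) (at x)"
      using u_deriv[of x] x desc_pos[OF t0] by (auto intro!: derivative_eq_intros)
    moreover have "v x + \<kappa> \<le> 0" using fast[OF all[OF x(1)] x(1) above[OF all[OF x(1)]]] by simp
    ultimately show "\<exists>y. ((\<lambda>t. u t + \<kappa> * t) has_real_derivative y) (at x) \<and> y \<le> 0" by blast
  qed (use t in simp)
  moreover have "\<kappa> * (t - t0) = u t0 - lo + \<kappa>" using \<kappa> unfolding t_def by (simp add: field_simps)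
  ultimately have "u t \<le> lo" using \<kappa> by (simp add: algebra_simps)
  moreover have "lo < u t" using all[of t] above t by simp
  ultimately show False by simp
qed

text \<open>
  On [lo, a] the nonlinearity has a positive minimum, so the solution falls at least as fast as a parabola.
\<close>
lemma steep_above:
  assumes lo: "b < lo" "lo < a"
  obtains c where "c > 0" "\<And>t. t \<in> desc v \<Longrightarrow> lo \<le> u t \<Longrightarrow> v t \<le> - c * t"
proof -
  have "compact {lo..a}" "{lo..a} \<noteq> {}" using lo by auto
  then obtain s0 where s0: "s0 \<in> {lo..a}" "\<And>s. s \<in> {lo..a} \<Longrightarrow> g s0 \<le> g s"
    using continuous_attains_inf[of "{lo..a}" g] continuous_on_subset[OF g_cont] by blast
  have c: "g s0 > 0" using s0(1) lo by (intro g_pos) auto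
  have N0: "real N > 0" using N3 by simp
  show thesis
  proof (rule that[of "g s0 / real N"])
    show "g s0 / real N > 0" using c N0 by simp
    fix t assume t: "t \<in> desc v" "lo \<le> u t"
    show "v t \<le> - (g s0 / real N) * t"
    proof (rule below_parabola(1)[OF sol N2 desc_pos[OF t(1)]])
      fix x assume x: "0 < x" "x < t"
      have "x \<in> desc v" using x by (intro desc_down[OF t(1)]) auto
      then have "u x \<le> a" using lev_less by force
      moreover have "lo \<le> u x" using u_decreasing[OF t(1), of x] x t(2) by simp
      ultimately show "g s0 \<le> g (u x)" by (intro s0(2)) auto
    qed
  qed
qed

lemma high_level:
  assumes lo: "b < lo" "lo < a" shows "lo \<in> lev"
proof -
  obtain c where c: "c > 0" "\<And>t. t \<in> desc v \<Longrightarrow> lo \<le> u t \<Longrightarrow> v t \<le> - c * t"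
    using steep_above[OF lo] by blast
  obtain t0 where t0: "t0 \<in> desc v" by (rule desc_nonempty[of 1]) auto
  show ?thesis
  proof (rule exhaust_levels[OF t0 _ lo(2)])
    show "0 < c * t0" using c(1) desc_pos[OF t0] by simp
    fix t assume t: "t \<in> desc v" "t0 \<le> t" "lo < u t"
    have "v t \<le> - c * t" using t by (intro c(2)) auto
    also have "\<dots> \<le> - (c * t0)" using t c(1) by simp
    finally show "v t \<le> - (c * t0)" .
  qed
qed

lemma energy_decreasing:
  assumes "t \<in> desc v" "0 \<le> t'" "t' < t" shows "energy u v t < energy u v t'"
proof (rule DERIV_neg_imp_decreasing_open[OF assms(3)])
  fix x assume x: "t' < x" "x < t"
  then have "x > 0" using assms by simp
  then have "v x < 0" using x by (intro desc_neg desc_down[OF assms(1)]) auto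
  have "- (real N - 1) / x * (v x)\<^sup>2 < 0"
    by (intro mult_neg_pos divide_neg_pos) (use N3 \<open>v x < 0\<close> \<open>x > 0\<close> in auto)
  then show "\<exists>y. (energy u v has_real_derivative y) (at x) \<and> y < 0"
    using energy_deriv[OF sol \<open>x > 0\<close>] by blast
qed (use assms in \<open>auto intro: continuous_on_subset[OF energy_cont[OF sol]]\<close>)

end

locale free_solution = radial_solution +
  assumes free: "\<not> trapped u v"
begin

lemma energy_nonneg_if_pos:
  assumes "0 \<le> R" "\<And>t. 0 \<le> t \<Longrightarrow> t \<le> R \<Longrightarrow> u t > 0" shows "energy u v R \<ge> 0"
  using free assms unfolding trapped_def by force

text \<open>
  The energy is nonnegative as long as the solution is positive, which is still so slightly beyond t, and it
  decreases strictly on the way there.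
\<close>
lemma desc_energy_pos:
  assumes t: "t \<in> desc v" "u t > 0" shows "energy u v t > 0"
proof -
  obtain t' where t': "t < t'" "t' \<in> desc v" by (rule desc_open[OF t(1)])
  have "\<exists>x. t < x \<and> x \<le> t' \<and> u x > 0"
  proof (cases "u t' > 0")
    case False
    have c: "continuous_on {t..t'} u" by (rule continuous_on_subset[OF u_cont]) (use desc_pos[OF t(1)] in auto)
    obtain c where "t < c" "c \<le> t'" "u c = 0" "\<And>x. t \<le> x \<Longrightarrow> x < c \<Longrightarrow> u x > 0"
      by (rule first_zero[OF c]) (use t t' False in auto)
    then show ?thesis by (intro exI[of _ "(t + c) / 2"]) (auto simp: field_simps)
  qed (use t' in auto)
  then obtain x where x: "t < x" "x \<le> t'" "u x > 0" by blast
  have xd: "x \<in> desc v" using x desc_pos[OF t(1)] by (intro desc_down[OF t'(2)]) auto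
  have "energy u v x \<ge> 0"
  proof (rule energy_nonneg_if_pos)
    fix y assume "0 \<le> y" "y \<le> x"
    then show "u y > 0" using u_decreasing[OF xd, of y] x(3) by (cases "y = x") auto
  qed (use x desc_pos[OF t(1)] in simp)
  then show ?thesis using energy_decreasing[OF xd, of t] x desc_pos[OF t(1)] by simp
qed

lemma slope_energy: "s \<in> lev \<Longrightarrow> s > 0 \<Longrightarrow> (p s)\<^sup>2 + 2 * F s > 0"
  using desc_energy_pos[OF r_desc[of s]] u_r[of s] by (simp add: energy_def slope_def)

lemma a_beta: "a > \<beta>"
proof -
  obtain t where t: "t \<in> desc v" by (rule desc_nonempty[of 1]) auto
  have "F a \<ge> 0" using energy_nonneg_if_pos[of 0] u_0 energy_0[OF sol] ab b_pos by simp
  moreover have "a \<noteq> \<beta>"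
  proof
    assume "a = \<beta>"
    then have e: "energy u v 0 = 0" using F_beta energy_0[OF sol] by simp
    obtain s where s: "s < a" "\<And>x. s \<le> x \<Longrightarrow> x < a \<Longrightarrow> x \<in> lev \<and> r x < 1" using near_top[OF zero_less_one] by blast
    define x where "x = (max s 0 + a) / 2"
    have x: "s \<le> x" "x < a" "0 < x" using s(1) ab b_pos unfolding x_def by auto
    have xl: "x \<in> lev" using s x by auto
    have "energy u v (r x) > 0" by (rule desc_energy_pos) (use xl x u_r r_desc in auto)
    then show False using e energy_antimono[OF sol, of 0 "r x"] r_pos[OF xl] by simp
  qed
  ultimately show ?thesis using F_neg[of a] ab b_pos by (cases a \<beta> rule: linorder_cases) auto
qed

text \<open>
  Above a level mid in (b, \<beta>) the nonlinearity is positive and drives the descent. Below it, down to lo, F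
  is at most a negative constant, and positive energy means p^2 > - 2 F.
\<close>
lemma all_levels:
  assumes lo: "0 < lo" "lo < a" shows "lo \<in> lev"
proof -
  define mid where "mid = (b + \<beta>) / 2"
  have mid: "b < mid" "mid < \<beta>" "mid < a" unfolding mid_def using b_less a_beta by auto
  define lo' where "lo' = min lo mid"
  have lo': "0 < lo'" "lo' \<le> mid" "lo' < a" using lo mid b_pos unfolding lo'_def by auto
  obtain c where c: "c > 0" "\<And>t. t \<in> desc v \<Longrightarrow> mid \<le> u t \<Longrightarrow> v t \<le> - c * t"
    using steep_above[OF mid(1,3)] by blast
  obtain t0 where t0: "t0 \<in> desc v" by (rule desc_nonempty[of 1]) auto
  have "compact {lo'..mid}" "{lo'..mid} \<noteq> {}" using lo' by auto
  then obtain s0 where s0: "s0 \<in> {lo'..mid}" "\<And>s. s \<in> {lo'..mid} \<Longrightarrow> F s \<le> F s0"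
    using continuous_attains_sup[of "{lo'..mid}" F] F_cont by blast
  have \<eta>: "F s0 < 0" using s0(1) lo' mid by (intro F_neg) auto
  have "lo' \<in> lev"
  proof (rule exhaust_levels[OF t0 _ lo'(3)])
    show "0 < min (c * t0) (sqrt (- 2 * F s0))" using c(1) desc_pos[OF t0] \<eta> by simp
    fix t assume t: "t \<in> desc v" "t0 \<le> t" "lo' < u t"
    show "v t \<le> - min (c * t0) (sqrt (- 2 * F s0))"
    proof (cases "mid \<le> u t")
      case True
      have "v t \<le> - c * t" using t True by (intro c(2)) auto
      also have "\<dots> \<le> - (c * t0)" using t c(1) by simp
      finally show ?thesis by (simp add: min_def)
    next
      case False
      have "F (u t) \<le> F s0" using False t by (intro s0(2)) auto
      moreover have "energy u v t > 0" using t lo' by (intro desc_energy_pos) auto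
      ultimately have "- 2 * F s0 \<le> (- v t)\<^sup>2" by (simp add: energy_def)
      then have "sqrt (- 2 * F s0) \<le> - v t"
        using desc_neg[OF t(1)] by (intro real_le_lsqrt) auto
      then show ?thesis by (simp add: min_def)
    qed
  qed
  then show ?thesis by (rule lev_up) (use lo in \<open>auto simp: lo'_def\<close>)
qed

end

section \<open>Intersection of two solutions\<close>

lemma last_zero:
  fixes f :: "real \<Rightarrow> real"
  assumes f: "continuous_on {p..q} f" and "p \<le> q" "f p \<le> 0" "f q > 0"
  obtains c where "p \<le> c" "c < q" "f c = 0" "\<And>x. c < x \<Longrightarrow> x \<le> q \<Longrightarrow> f x > 0"
proof -
  have "continuous_on {-q..-p} (\<lambda>x. f (- x))"
    by (rule continuous_on_compose2[OF f]) (auto intro!: continuous_intros)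
  then obtain c where c: "- q < c" "c \<le> - p" "f (- c) = 0" "\<And>x. - q \<le> x \<Longrightarrow> x < c \<Longrightarrow> f (- x) > 0"
    by (rule first_zero[of "- q" "- p" "\<lambda>x. f (- x)"]) (use assms in auto)
  show thesis
  proof (rule that[of "- c"])
    fix x assume "- c < x" "x \<le> q"
    then show "f x > 0" using c(4)[of "- x"] by simp
  qed (use c in auto)
qed

lemma decreasing_ge_limit:
  fixes f :: "real \<Rightarrow> real"
  assumes "s < a" and c: "\<And>x. s \<le> x \<Longrightarrow> x < a \<Longrightarrow> isCont f x"
    and d: "\<And>x. s < x \<Longrightarrow> x < a \<Longrightarrow> \<exists>y. (f has_real_derivative y) (at x) \<and> y \<le> 0"
    and lim: "(f \<longlongrightarrow> l) (at_left a)"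
  shows "f s \<ge> l"
proof (rule tendsto_upperbound[OF lim])
  have "f x \<le> f s" if "s < x" "x < a" for x
    by (rule DERIV_nonpos_imp_decreasing_open[of s x f])
       (use that d c in \<open>auto intro!: continuous_at_imp_continuous_on\<close>)
  then show "\<forall>\<^sub>F x in at_left a. f x \<le> f s"
    unfolding eventually_at_left_field using assms(1) by blast
qed simp

context radial_solution
begin

text \<open>
  The product of \<open>flux\<close> and \<open>T\<close> is r^N (p^2 + 2 F) - 2 N r^(N-1) p F/g, the Pohozaev functional with the
  factor F/g in place of a constant multiple of u; \<open>W\<close> is the radius times the square root of twice the
  energy.
\<close>
definition flux :: "real \<Rightarrow> real" where "flux s = r s ^ (N - 1) * p s"
definition T :: "real \<Rightarrow> real" where "T s = r s * p s + 2 * r s * F s / p s - 2 * real N * (F s / g s)"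
definition W :: "real \<Rightarrow> real" where "W s = r s * sqrt ((p s)\<^sup>2 + 2 * F s)"

lemma flux_pos: "s \<in> lev \<Longrightarrow> flux s > 0"
  unfolding flux_def using r_pos p_pos by simp

lemma r_isCont: "s \<in> lev \<Longrightarrow> isCont r s" and p_isCont: "s \<in> lev \<Longrightarrow> isCont p s"
  using r_deriv p_deriv DERIV_isCont by blast+

lemma F_isCont: "isCont F s" and g_isCont: "isCont g s"
  using F_deriv DERIV_isCont g_cont continuous_on_eq_continuous_at[of UNIV g] by auto

lemma T_isCont: "s \<in> lev \<Longrightarrow> b < s \<Longrightarrow> isCont T s"
  unfolding T_def[abs_def]
  by (intro continuous_intros r_isCont p_isCont F_isCont g_isCont) (use p_pos[of s] g_pos[of s] in auto)

lemma W_isCont: "s \<in> lev \<Longrightarrow> isCont W s"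
  unfolding W_def[abs_def] by (intro continuous_intros r_isCont p_isCont F_isCont)

lemma flux_isCont: "s \<in> lev \<Longrightarrow> isCont flux s"
  unfolding flux_def[abs_def] by (intro continuous_intros r_isCont p_isCont)

lemma flux_level_deriv:
  assumes s: "s \<in> lev" shows "(flux has_real_derivative (- (g s * flux s / (p s)\<^sup>2))) (at s)"
proof -
  have "((\<lambda>s. - (r s ^ (N - 1) * v (r s))) has_real_derivative (- (- (r s ^ (N - 1) * g (u (r s))) * (- 1 / p s)))) (at s)"
    by (rule DERIV_minus, rule DERIV_chain2[where f = "\<lambda>t. t ^ (N - 1) * v t" and g = r],
        rule flux_deriv[OF sol r_pos[OF s] N2], rule r_deriv[OF s])
  moreover have "- (- (r s ^ (N - 1) * g (u (r s))) * (- 1 / p s)) = - (g s * flux s / (p s)\<^sup>2)"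
    using p_pos[OF s] u_r[OF s] by (simp add: flux_def power2_eq_square)
  ultimately show ?thesis by (simp add: flux_def[abs_def] slope_def)
qed

lemma T_deriv:
  assumes s: "s \<in> lev" and q: "((\<lambda>t. F t / g t) has_real_derivative d) (at s)" and gs: "g s \<noteq> 0"
  shows "(T has_real_derivative (- (2 * real N * d - (real N - 2)) + g s / (p s)\<^sup>2 * T s)) (at s)"
proof -
  have pp: "p s \<noteq> 0" and rr: "r s \<noteq> 0" using p_pos[OF s] r_pos[OF s] by auto
  have "((\<lambda>s. r s * p s + 2 * (r s * F s / p s) - 2 * real N * (F s / g s)) has_real_derivative
     ((- 1 / p s) * p s + ((real N - 1) / r s - g s / p s) * r s
      + 2 * ((((- 1 / p s) * F s + g s * r s) * p s - r s * F s * ((real N - 1) / r s - g s / p s)) / (p s * p s))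
      - 2 * real N * d)) (at s)"
    by (intro DERIV_diff DERIV_add DERIV_mult DERIV_cmult DERIV_divide r_deriv[OF s] p_deriv[OF s] F_deriv q pp)
  moreover have alg: "(- 1 / P) * P + ((n - 1) / R - G / P) * R
      + 2 * ((((- 1 / P) * FF + G * R) * P - R * FF * ((n - 1) / R - G / P)) / (P * P)) - 2 * n * d
      = - (2 * n * d - (n - 2)) + G / P\<^sup>2 * (R * P + 2 * R * FF / P - 2 * n * (FF / G))"
    if "P \<noteq> 0" "R \<noteq> 0" "G \<noteq> 0" for P R G FF n :: real
    using that by (simp add: field_simps power2_eq_square)
  moreover have "T = (\<lambda>s. r s * p s + 2 * (r s * F s / p s) - 2 * real N * (F s / g s))"
    by (rule ext) (simp add: T_def)
  ultimately show ?thesis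
    using alg[OF pp rr gs, of "real N" "F s"] unfolding T_def[of s] by (simp only:)
qed

lemma T_top: "(T \<longlongrightarrow> 0) (at_left a)"
proof -
  have ga: "g a > 0" using g_pos ab by simp
  have N0: "real N > 0" using N3 by simp
  have Fa: "(F \<longlongrightarrow> F a) (at_left a)" and gaa: "(g \<longlongrightarrow> g a) (at_left a)"
    using F_isCont[of a] g_isCont[of a] unfolding isCont_def by (auto intro: filterlim_at_split[THEN iffD1, THEN conjunct1])
  have "((\<lambda>s. r s * p s + 2 * (F s / (p s / r s)) - 2 * real N * (F s / g s)) \<longlongrightarrow>
      0 * 0 + 2 * (F a / (g a / real N)) - 2 * real N * (F a / g a)) (at_left a)"
    by (intro tendsto_intros r_top p_top p_over_r_top Fa gaa) (use ga N0 in auto)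
  moreover have "0 * 0 + 2 * (F a / (g a / real N)) - 2 * real N * (F a / g a) = 0" by simp
  ultimately have "((\<lambda>s. r s * p s + 2 * (F s / (p s / r s)) - 2 * real N * (F s / g s)) \<longlongrightarrow> 0) (at_left a)" by simp
  moreover have "(\<lambda>s. r s * p s + 2 * (F s / (p s / r s)) - 2 * real N * (F s / g s)) = T"
    by (rule ext) (simp add: T_def)
  ultimately show ?thesis by simp
qed

lemma flux_top: "(flux \<longlongrightarrow> 0) (at_left a)"
proof -
  have "((\<lambda>s. r s ^ (N - 1) * p s) \<longlongrightarrow> 0 ^ (N - 1) * 0) (at_left a)"
    by (intro tendsto_intros r_top p_top)
  then show ?thesis by (simp add: flux_def[abs_def])
qed

text \<open>
  The derivative of \<open>flux * T\<close> is - (2 N (F/g)' - (N - 2)) \<open>flux\<close>. This is negative by the subcriticality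
  assumption, and \<open>flux * T\<close> vanishes at the top level.
\<close>
lemma T_pos:
  assumes q: "\<And>s. \<beta> < s \<Longrightarrow> s < a \<Longrightarrow> ((\<lambda>t. F t / g t) has_real_derivative D s) (at s)"
      "\<And>s. \<beta> < s \<Longrightarrow> s < a \<Longrightarrow> D s > (real N - 2) / (2 * real N)"
    and s: "\<beta> < s" "s < a"
  shows "T s > 0"
proof -
  define s1 where "s1 = (s + a) / 2"
  have s1: "s < s1" "s1 < a" using s unfolding s1_def by auto
  have N0: "real N > 0" using N3 by simp
  have der: "\<exists>y. ((\<lambda>s. flux s * T s) has_real_derivative y) (at x) \<and> y < 0" if x: "\<beta> < x" "x < a" for x
  proof -
    have xl: "x \<in> lev" using x b_less by (intro high_level) auto
    have gx: "g x > 0" using x b_less by (intro g_pos) auto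
    have "((\<lambda>s. flux s * T s) has_real_derivative
       (- (g x * flux x / (p x)\<^sup>2)) * T x + (- (2 * real N * D x - (real N - 2)) + g x / (p x)\<^sup>2 * T x) * flux x) (at x)"
      by (intro DERIV_mult flux_level_deriv[OF xl] T_deriv[OF xl q(1)]) (use x gx in auto)
    moreover have "(- (g x * flux x / (p x)\<^sup>2)) * T x + (- (2 * real N * D x - (real N - 2)) + g x / (p x)\<^sup>2 * T x) * flux x
        = - (2 * real N * D x - (real N - 2)) * flux x" by (simp add: algebra_simps)
    moreover have "2 * real N * D x - (real N - 2) > 0" using q(2)[OF x] N0 by (simp add: field_simps)
    ultimately show ?thesis
      using mult_pos_pos[OF _ flux_pos[OF xl], of "2 * real N * D x - (real N - 2)"]
      by (intro exI[of _ "- (2 * real N * D x - (real N - 2)) * flux x"] conjI) (simp only:, linarith)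
  qed
  have cont: "isCont (\<lambda>s. flux s * T s) x" if x: "\<beta> < x" "x < a" for x
    using der[OF x] DERIV_isCont by blast
  have "flux s1 * T s1 \<ge> 0 * 0"
  proof (rule decreasing_ge_limit[OF s1(2)])
    show "((\<lambda>s. flux s * T s) \<longlongrightarrow> 0 * 0) (at_left a)" by (intro tendsto_mult flux_top T_top)
    show "\<exists>y. ((\<lambda>s. flux s * T s) has_real_derivative y) (at x) \<and> y \<le> 0" if "s1 < x" "x < a" for x
      using der[of x] that s s1 by (meson less_imp_le less_trans)
    show "isCont (\<lambda>s. flux s * T s) x" if "s1 \<le> x" "x < a" for x
      using that s s1 by (intro cont) auto
  qed
  moreover have "flux s1 * T s1 < flux s * T s"
    by (rule DERIV_neg_imp_decreasing_open[OF s1(1)])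
       (use der cont s s1 in \<open>auto intro!: continuous_at_imp_continuous_on\<close>)
  ultimately have "0 < flux s * T s" by linarith
  moreover have "flux s > 0" using s b_less by (intro flux_pos high_level) auto
  ultimately show ?thesis by (rule zero_less_mult_pos)
qed

text \<open>
  The nonlinearity cancels: besides N, the derivative depends on s only through p and F, and not on r. Two
  solutions can thus be compared without any information on g.
\<close>
lemma W_deriv:
  assumes s: "s \<in> lev" and e: "(p s)\<^sup>2 + 2 * F s > 0"
  shows "(W has_real_derivative ((real N - 1) * p s / sqrt ((p s)\<^sup>2 + 2 * F s) - sqrt ((p s)\<^sup>2 + 2 * F s) / p s)) (at s)"
proof -
  let ?e = "(p s)\<^sup>2 + 2 * F s"
  have pp: "p s \<noteq> 0" and rr: "r s \<noteq> 0" and ee: "sqrt ?e \<noteq> 0" using p_pos[OF s] r_pos[OF s] e by auto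
  have d1: "((\<lambda>s. (p s)\<^sup>2 + 2 * F s) has_real_derivative (2 * p s * ((real N - 1) / r s - g s / p s) + 2 * g s)) (at s)"
    by (rule derivative_eq_intros p_deriv[OF s] F_deriv refl | simp)+
  have "((\<lambda>s. sqrt ((p s)\<^sup>2 + 2 * F s)) has_real_derivative
      (inverse (sqrt ?e) / 2 * (2 * p s * ((real N - 1) / r s - g s / p s) + 2 * g s))) (at s)"
    by (rule DERIV_chain2[where f = sqrt, OF DERIV_real_sqrt[OF e] d1])
  then have "(W has_real_derivative
      ((- 1 / p s) * sqrt ?e + inverse (sqrt ?e) / 2 * (2 * p s * ((real N - 1) / r s - g s / p s) + 2 * g s) * r s)) (at s)"
    unfolding W_def[abs_def] by (rule DERIV_mult[OF r_deriv[OF s]])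
  moreover have "(- 1 / P) * E + inverse E / 2 * (2 * P * ((n - 1) / R - G / P) + 2 * G) * R = (n - 1) * P / E - E / P"
    if "P \<noteq> 0" "R \<noteq> 0" "E \<noteq> 0" for P R E G n :: real
    using that by (simp add: field_simps)
  from this[OF pp rr ee, of "real N" "g s"] calculation show ?thesis by (simp only:)
qed

end

text \<open>
  With x = sqrt (p^2 + 2 f)/p the expression is n/x - x, which decreases in x, and x increases with p because
  f \<le> 0.
\<close>
lemma radial_slope_mono:
  fixes p1 p2 f n :: real
  assumes "0 < p1" "p1 < p2" "f \<le> 0" "p1\<^sup>2 + 2 * f > 0" "n \<ge> 0"
  shows "n * p2 / sqrt (p2\<^sup>2 + 2 * f) - sqrt (p2\<^sup>2 + 2 * f) / p2
       \<le> n * p1 / sqrt (p1\<^sup>2 + 2 * f) - sqrt (p1\<^sup>2 + 2 * f) / p1"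
proof -
  define x1 where "x1 = sqrt (p1\<^sup>2 + 2 * f) / p1"
  define x2 where "x2 = sqrt (p2\<^sup>2 + 2 * f) / p2"
  have sq: "p1\<^sup>2 < p2\<^sup>2" using assms by (intro power_strict_mono) auto
  have x1: "x1 > 0" unfolding x1_def using assms by simp
  have e1: "x1 = sqrt (1 + 2 * f / p1\<^sup>2)" and e2: "x2 = sqrt (1 + 2 * f / p2\<^sup>2)"
  proof -
    have "sqrt (q\<^sup>2 + 2 * f) / q = sqrt (1 + 2 * f / q\<^sup>2)" if "q > 0" for q
    proof -
      have "sqrt (q\<^sup>2 + 2 * f) / q = sqrt (q\<^sup>2 + 2 * f) / sqrt (q\<^sup>2)" using that by simp
      also have "\<dots> = sqrt ((q\<^sup>2 + 2 * f) / q\<^sup>2)" by (rule real_sqrt_divide[symmetric])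
      also have "(q\<^sup>2 + 2 * f) / q\<^sup>2 = 1 + 2 * f / q\<^sup>2" using that by (simp add: field_simps)
      finally show ?thesis .
    qed
    then show "x1 = sqrt (1 + 2 * f / p1\<^sup>2)" "x2 = sqrt (1 + 2 * f / p2\<^sup>2)"
      unfolding x1_def x2_def using assms by auto
  qed
  have "2 * f / p1\<^sup>2 \<le> 2 * f / p2\<^sup>2"
    by (rule divide_left_mono_neg) (use sq assms in auto)
  then have x12: "x1 \<le> x2" unfolding e1 e2 by simp
  have "n / x2 \<le> n / x1" using x1 x12 assms(5) by (intro divide_left_mono) auto
  then have "n / x2 - x2 \<le> n / x1 - x1" using x12 by simp
  then show ?thesis unfolding x1_def x2_def by simp
qed

text \<open>
  Differentiability of F/g, the subcriticality bound and the growth condition are assumed only up to the larger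
  initial value, as the nonlinearity is changed above it.
\<close>
locale ordered_pair =
  S1: free_solution N g b \<beta> M a1 u1 v1 + S2: radial_solution N g b \<beta> M a2 u2 v2
  for N g b \<beta> M a1 u1 v1 a2 u2 v2 +
  fixes D :: "real \<Rightarrow> real"
  assumes a12: "a1 < a2"
    and quot_deriv: "\<And>s. \<beta> < s \<Longrightarrow> s < a2 \<Longrightarrow> ((\<lambda>t. primitive0 g t / g t) has_real_derivative D s) (at s)"
    and quot_bound: "\<And>s. \<beta> < s \<Longrightarrow> s < a2 \<Longrightarrow> D s > (real N - 2) / (2 * real N)"
    and superlinear: "\<And>s t. b < s \<Longrightarrow> s \<le> t \<Longrightarrow> t \<le> a2 \<Longrightarrow> g s / (s - b) \<le> g t / (t - b)"
begin

abbreviation r1 where "r1 \<equiv> rad u1 v1"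
abbreviation r2 where "r2 \<equiv> rad u2 v2"
abbreviation p1 where "p1 \<equiv> slope u1 v1"
abbreviation p2 where "p2 \<equiv> slope u2 v2"
abbreviation L1 where "L1 \<equiv> u1 ` desc v1"
abbreviation L2 where "L2 \<equiv> u2 ` desc v2"

lemma a1_L2: "a1 \<in> L2"
  using S1.ab a12 by (rule S2.high_level)

text \<open>
  If the larger solution stayed larger up to the radius where the smaller one equals b, consider
  H = r^(N-1) (v2 (u1 - b) - v1 (u2 - b)). Its derivative r^(N-1) (g u1 (u2 - b) - g u2 (u1 - b)) is
  at most 0 by the growth condition, so H \<le> 0; but at that radius H = - r^(N-1) v1 (u2 - b) > 0.
\<close>
lemma crossing_time:
  obtains t where "0 < t" "t \<le> r1 b" "u2 t = u1 t" "\<And>x. 0 \<le> x \<Longrightarrow> x < t \<Longrightarrow> u1 x < u2 x"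
proof -
  have bL: "b \<in> L1" using S1.b_pos S1.ab by (rule S1.all_levels)
  let ?R = "r1 b"
  have R: "?R \<in> desc v1" "u1 ?R = b" "?R > 0" using S1.r_desc[OF bL] S1.u_r[OF bL] S1.r_pos[OF bL] by auto
  have u1b: "u1 x > b" if "0 \<le> x" "x < ?R" for x using S1.u_decreasing[OF R(1) that] R(2) by simp
  have "\<exists>x. 0 \<le> x \<and> x \<le> ?R \<and> u2 x \<le> u1 x"
  proof (rule ccontr)
    assume "\<not> ?thesis"
    then have gt: "u1 x < u2 x" if "0 \<le> x" "x \<le> ?R" for x using that by force
    have u2a: "u2 x \<le> a2" if x: "0 < x" "x \<le> ?R" for x
    proof -
      have "x \<in> desc v2"
        unfolding desc_def
      proof (intro CollectI conjI allI impI x)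
        fix t assume t: "0 < t \<and> t \<le> x"
        show "v2 t < 0"
        proof (rule S1.vel_neg_above[OF S2.sol])
          fix y assume "0 \<le> y" "y < t"
          then show "b < u2 y" using u1b[of y] gt[of y] t x by auto
        qed (use t in simp)
      qed
      then show ?thesis using S2.lev_less[of "u2 x"] by auto
    qed
    let ?H = "\<lambda>x. x ^ (N - 1) * v2 x * (u1 x - b) - x ^ (N - 1) * v1 x * (u2 x - b)"
    have "?H ?R \<le> ?H 0"
    proof (rule DERIV_nonpos_imp_decreasing_open[of 0 ?R ?H])
      fix x assume x: "0 < x" "x < ?R"
      have "(?H has_real_derivative
         ((- (x ^ (N - 1) * g (u2 x))) * (u1 x - b) + (v1 x - 0) * (x ^ (N - 1) * v2 x)
        - ((- (x ^ (N - 1) * g (u1 x))) * (u2 x - b) + (v2 x - 0) * (x ^ (N - 1) * v1 x)))) (at x)"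
        by (intro DERIV_diff DERIV_mult flux_deriv[OF S2.sol x(1) S1.N2] flux_deriv[OF S1.sol x(1) S1.N2]
            S1.u_deriv[OF x(1)] S2.u_deriv[OF x(1)] DERIV_const)
      moreover have "(- (x ^ (N - 1) * g (u2 x))) * (u1 x - b) + (v1 x - 0) * (x ^ (N - 1) * v2 x)
        - ((- (x ^ (N - 1) * g (u1 x))) * (u2 x - b) + (v2 x - 0) * (x ^ (N - 1) * v1 x))
        = x ^ (N - 1) * (g (u1 x) * (u2 x - b) - g (u2 x) * (u1 x - b))"
        by (simp add: algebra_simps)
      moreover have "x ^ (N - 1) * (g (u1 x) * (u2 x - b) - g (u2 x) * (u1 x - b)) \<le> 0"
      proof -
        have l: "b < u1 x" "u1 x < u2 x" using u1b[of x] gt[of x] x by auto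
        have "g (u1 x) / (u1 x - b) \<le> g (u2 x) / (u2 x - b)"
          using l u2a[of x] x by (intro superlinear) auto
        then have "g (u1 x) * (u2 x - b) - g (u2 x) * (u1 x - b) \<le> 0"
          using l by (simp add: divide_le_eq pos_le_divide_eq field_simps)
        then show ?thesis using x by (intro mult_nonneg_nonpos) auto
      qed
      ultimately show "\<exists>y. (?H has_real_derivative y) (at x) \<and> y \<le> 0"
        by (intro exI[of _ "x ^ (N - 1) * (g (u1 x) * (u2 x - b) - g (u2 x) * (u1 x - b))"]) simp
    next
      show "continuous_on {0..?R} ?H"
        by (intro continuous_intros continuous_on_subset[OF S1.v_cont] continuous_on_subset[OF S2.v_cont]
            continuous_on_subset[OF S1.u_cont] continuous_on_subset[OF S2.u_cont]) auto
    qed (use R in simp)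
    then have "- (?R ^ (N - 1) * v1 ?R * (u2 ?R - b)) \<le> 0"
      using R(2) S1.v_0 S2.v_0 by simp
    moreover have "?R ^ (N - 1) * v1 ?R * (u2 ?R - b) < 0"
      using S1.desc_neg[OF R(1)] R(3) gt[of ?R] R(2) by (intro mult_neg_pos mult_pos_neg) auto
    ultimately show False by simp
  qed
  then obtain x where x: "0 \<le> x" "x \<le> ?R" "u2 x \<le> u1 x" by blast
  have cx: "continuous_on {0..x} (\<lambda>x. u2 x - u1 x)"
    by (intro continuous_intros continuous_on_subset[OF S1.u_cont] continuous_on_subset[OF S2.u_cont]) auto
  obtain t where t: "0 < t" "t \<le> x" "u2 t - u1 t = 0" "\<And>y. 0 \<le> y \<Longrightarrow> y < t \<Longrightarrow> u2 y - u1 y > 0"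
    by (rule first_zero[OF cx x(1)]) (use a12 x(3) S1.u_0 S2.u_0 in auto)
  show thesis
  proof (rule that[of t])
    show "u1 y < u2 y" if "0 \<le> y" "y < t" for y using t(4)[OF that] by simp
  qed (use t x in auto)
qed

lemma crossing_level:
  obtains sI where "b \<le> sI" "sI < a1" "sI \<in> L2" "r1 sI = r2 sI" "\<And>s. sI < s \<Longrightarrow> s < a1 \<Longrightarrow> r1 s < r2 s"
proof -
  obtain t where t: "0 < t" "t \<le> r1 b" "u2 t = u1 t" "\<And>x. 0 \<le> x \<Longrightarrow> x < t \<Longrightarrow> u1 x < u2 x"
    using crossing_time by blast
  have bL: "b \<in> L1" using S1.b_pos S1.ab by (rule S1.all_levels)
  have R: "r1 b \<in> desc v1" "u1 (r1 b) = b" using S1.r_desc[OF bL] S1.u_r[OF bL] by auto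
  have t1: "t \<in> desc v1" by (rule S1.desc_down[OF R(1) t(1,2)])
  have t2: "t \<in> desc v2"
    unfolding desc_def
  proof (intro CollectI conjI allI impI t(1))
    fix x assume x: "0 < x \<and> x \<le> t"
    show "v2 x < 0"
    proof (rule S1.vel_neg_above[OF S2.sol])
      fix y assume y: "0 \<le> y" "y < x"
      then have "b < u1 y" using S1.u_decreasing[OF R(1), of y] R(2) x t(2) by simp
      also have "u1 y < u2 y" using t(4) x y by simp
      finally show "b < u2 y" .
    qed (use x in simp)
  qed
  show thesis
  proof (rule that[of "u1 t"])
    show "b \<le> u1 t" using S1.u_decreasing[OF R(1), of t] R(2) t by (cases "t = r1 b") auto
    show "u1 t < a1" using S1.lev_less t1 by blast
    show "u1 t \<in> L2" using t2 t(3) by (metis imageI)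
    show "r1 (u1 t) = r2 (u1 t)" using S1.r_u[OF t1] S2.r_u[OF t2] t(3) by simp
    fix s assume s: "u1 t < s" "s < a1"
    have s1: "s \<in> L1" by (rule S1.lev_up[of "u1 t"]) (use t1 s in auto)
    have s2: "s \<in> L2" by (rule S2.lev_up[OF imageI[OF t2]]) (use t(3) s a12 in auto)
    have rt: "r1 s < t" using S1.u_less_iff[OF t1 s1] s by simp
    have rp: "0 < r1 s" by (rule S1.r_pos[OF s1])
    have d2: "r1 s \<in> desc v2" using rt rp by (intro S2.desc_down[OF t2]) auto
    have "s < u2 (r1 s)" using t(4)[of "r1 s"] rt rp S1.u_r[OF s1] by simp
    then have "r2 (u2 (r1 s)) < r2 s" by (intro S2.r_less s2 imageI d2)
    then show "r1 s < r2 s" using S2.r_u[OF d2] by simp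
  qed
qed

lemma L1I: "0 < s \<Longrightarrow> s < a1 \<Longrightarrow> s \<in> L1"
  by (rule S1.all_levels)

text \<open>
  At the top level a1 of the smaller solution p1 vanishes and p2 does not. Going down from there, consider the
  first level c at which p1 = p2. Above c the larger solution has the larger radius, hence the smaller term
  (N-1)/r, and p2 - p1 satisfies a linear differential inequality (p2 - p1)' \<le> K (p2 - p1). With Gronwall's
  argument p2 - p1, being 0 at c, would not become positive above c.
\<close>
lemma steeper_above:
  assumes sI: "b \<le> sI" "sI < a1" "sI \<in> L2" "\<And>s. sI < s \<Longrightarrow> s < a1 \<Longrightarrow> r1 s < r2 s"
    and s: "sI \<le> s" "s < a1"
  shows "p1 s < p2 s"
proof (rule ccontr)
  assume np: "\<not> p1 s < p2 s"
  have in2: "x \<in> L2" if "sI \<le> x" "x \<le> a1" for x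
    using S2.lev_up[OF sI(3) that(1)] that(2) a12 by simp
  have in1: "x \<in> L1" if "sI \<le> x" "x < a1" for x
    using that sI(1) S1.b_pos by (intro L1I) auto
  have "((\<lambda>s. p2 s - p1 s) \<longlongrightarrow> p2 a1 - 0) (at_left a1)"
  proof (intro tendsto_diff S1.p_top)
    show "(p2 \<longlongrightarrow> p2 a1) (at_left a1)"
      using S2.p_isCont[OF a1_L2] unfolding isCont_def
      by (auto intro: filterlim_at_split[THEN iffD1, THEN conjunct1])
  qed
  then have "\<forall>\<^sub>F s in at_left a1. 0 < p2 s - p1 s"
    by (rule order_tendstoD(1)) (use S2.p_pos[OF a1_L2] in simp)
  then obtain s0' where s0': "s0' < a1" "\<And>x. s0' < x \<Longrightarrow> x < a1 \<Longrightarrow> 0 < p2 x - p1 x"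
    unfolding eventually_at_left_field by blast
  define s0 where "s0 = (max s s0' + a1) / 2"
  have s0: "s < s0" "s0 < a1" "s0' < s0" using s0' s unfolding s0_def by auto
  have cf: "continuous_on {s..s0} (\<lambda>x. p2 x - p1 x)"
    using s s0 in1 in2 S1.p_isCont S2.p_isCont
    by (intro continuous_at_imp_continuous_on ballI continuous_intros) auto
  obtain c where c: "s \<le> c" "c < s0" "p2 c - p1 c = 0" "\<And>x. c < x \<Longrightarrow> x \<le> s0 \<Longrightarrow> p2 x - p1 x > 0"
    by (rule last_zero[OF cf]) (use np s0 s0'(2)[of s0] in auto)
  have "compact {c..s0}" "{c..s0} \<noteq> {}" using c by auto
  moreover have "continuous_on {c..s0} p1"
    using c s s0 in1 S1.p_isCont by (intro continuous_at_imp_continuous_on ballI) auto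
  ultimately obtain m where m: "m \<in> {c..s0}" "\<And>x. x \<in> {c..s0} \<Longrightarrow> p1 m \<le> p1 x"
    using continuous_attains_inf[of "{c..s0}" p1] by blast
  have pm: "p1 m > 0" using m(1) c s s0 by (intro S1.p_pos in1) auto
  \<comment> \<open>a bound for g/(p1 p2), the coefficient in g/p1 - g/p2 = g/(p1 p2) * (p2 - p1)\<close>
  define K where "K = \<bar>M\<bar> / (p1 m * p1 m)"
  have "exp (- K * s0) * (p2 s0 - p1 s0) \<le> exp (- K * c) * (p2 c - p1 c)"
  proof (rule DERIV_nonpos_imp_decreasing_open[of c s0 "\<lambda>x. exp (- K * x) * (p2 x - p1 x)"])
    fix x assume x: "c < x" "x < s0"
    have xs: "sI \<le> x" "x < a1" "sI < x" using x c s s0 by auto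
    have x1: "x \<in> L1" and x2: "x \<in> L2" using in1[OF xs(1,2)] in2[OF xs(1)] xs by auto
    let ?d = "((real N - 1) / r2 x - g x / p2 x) - ((real N - 1) / r1 x - g x / p1 x)"
    have "((\<lambda>x. exp (- K * x) * (p2 x - p1 x)) has_real_derivative
        (exp (- K * x) * (- K * 1)) * (p2 x - p1 x) + ?d * exp (- K * x)) (at x)"
      by (intro DERIV_mult DERIV_diff S1.p_deriv[OF x1] S2.p_deriv[OF x2] DERIV_chain2[where f = exp and g = "\<lambda>x. - K * x"]
          DERIV_exp DERIV_cmult DERIV_ident)
    moreover have "?d \<le> K * (p2 x - p1 x)"
    proof -
      have "(real N - 1) / r2 x \<le> (real N - 1) / r1 x"
        using sI(4)[OF xs(3,2)] S1.r_pos[OF x1] S1.N3 by (intro divide_left_mono) auto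
      moreover have "g x / p1 x - g x / p2 x \<le> K * (p2 x - p1 x)"
      proof -
        have pos: "p1 x > 0" "p2 x > 0" "p2 x - p1 x > 0" using S1.p_pos[OF x1] S2.p_pos[OF x2] c(4)[of x] x by auto
        have "g x / p1 x - g x / p2 x = g x * (p2 x - p1 x) / (p1 x * p2 x)"
          using pos by (simp add: field_simps)
        also have "\<dots> \<le> \<bar>M\<bar> * (p2 x - p1 x) / (p1 m * p1 m)"
        proof (rule frac_le)
          have "g x \<le> \<bar>M\<bar>" using S1.g_bound[of x] by linarith
          then show "g x * (p2 x - p1 x) \<le> \<bar>M\<bar> * (p2 x - p1 x)" using pos by (intro mult_right_mono) auto
          show "p1 m * p1 m \<le> p1 x * p2 x"
            using m(2)[of x] x pos pm by (intro mult_mono) auto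
        qed (use pos pm in auto)
        finally show ?thesis unfolding K_def by simp
      qed
      ultimately show ?thesis by simp
    qed
    then have "exp (- K * x) * (?d - K * (p2 x - p1 x)) \<le> 0" by (intro mult_nonneg_nonpos) auto
    then have "(exp (- K * x) * (- K * 1)) * (p2 x - p1 x) + ?d * exp (- K * x) \<le> 0" by (simp add: algebra_simps)
    ultimately show "\<exists>y. ((\<lambda>x. exp (- K * x) * (p2 x - p1 x)) has_real_derivative y) (at x) \<and> y \<le> 0" by blast
  next
    show "continuous_on {c..s0} (\<lambda>x. exp (- K * x) * (p2 x - p1 x))"
      by (intro continuous_intros continuous_on_subset[OF cf, unfolded continuous_on_def]
           continuous_on_subset[OF cf]) (use c in auto)
  qed (use c in simp)
  then have "p2 s0 - p1 s0 \<le> 0" using c(3) by (simp add: mult_le_0_iff)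
  then show False using c(4)[of s0] c(2) by simp
qed

section \<open>Comparison of two solutions below their intersection\<close>

text \<open>
  While r1 p1 < r2 p2, the quotient r2/r1 increases with the level, so r2 < r1 below the intersection. Let c be
  the first level, going down, at which r1 p1 = r2 p2. Above c one has p1 < p2, and the derivative
  g * flux2 * T1 * (1/p2^2 - 1/p1^2) of flux2 * (T2 - T1) is at most 0; as this quantity is positive at a1,
  T2 > T1 at c. But equality of r p at c together with r2 \<le> r1 and p1 \<le> p2 gives T2 \<le> T1.
\<close>
lemma below_crossing:
  assumes sI: "b \<le> sI" "sI < a1" "sI \<in> L2" "r1 sI = r2 sI" "\<And>s. sI < s \<Longrightarrow> s < a1 \<Longrightarrow> r1 s < r2 s"
    and s: "\<beta> \<le> s" "s < sI"
  shows "r2 s < r1 s" "r1 s * p1 s < r2 s * p2 s"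
proof -
  have in2: "x \<in> L2" if "\<beta> \<le> x" "x \<le> a1" for x
    using that S1.b_less a12 by (intro S2.high_level) auto
  have in1: "x \<in> L1" if "\<beta> \<le> x" "x < a1" for x
    using that S1.b_less S1.b_pos by (intro L1I) auto
  have steep: "p1 x < p2 x" if "sI \<le> x" "x < a1" for x
    by (rule steeper_above[OF sI(1,2,3,5) that])
  have ratio: "r2 x < r1 x"
    if c: "\<beta> \<le> c" "c \<le> x" "x < sI" and f: "\<And>y. c < y \<Longrightarrow> y \<le> sI \<Longrightarrow> r1 y * p1 y < r2 y * p2 y" for c x
  proof -
    have "r2 x / r1 x < r2 sI / r1 sI"
    proof (rule DERIV_pos_imp_increasing_open[OF c(3)])
      fix y assume y: "x < y" "y < sI"
      have y1: "y \<in> L1" and y2: "y \<in> L2" using y c sI by (auto intro!: in1 in2)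
      have pos: "r1 y > 0" "r2 y > 0" "p1 y > 0" "p2 y > 0"
        using S1.r_pos S2.r_pos S1.p_pos S2.p_pos y1 y2 by auto
      have "((\<lambda>s. r2 s / r1 s) has_real_derivative ((- 1 / p2 y) * r1 y - r2 y * (- 1 / p1 y)) / (r1 y * r1 y)) (at y)"
        by (intro DERIV_divide S1.r_deriv[OF y1] S2.r_deriv[OF y2]) (use pos in simp)
      moreover have "((- 1 / p2 y) * r1 y - r2 y * (- 1 / p1 y)) / (r1 y * r1 y)
          = (r2 y * p2 y - r1 y * p1 y) / (p1 y * p2 y * (r1 y * r1 y))"
        using pos by (simp add: field_simps)
      moreover have "(r2 y * p2 y - r1 y * p1 y) / (p1 y * p2 y * (r1 y * r1 y)) > 0"
        using f[of y] y c pos by (intro divide_pos_pos mult_pos_pos) auto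
      ultimately show "\<exists>z. ((\<lambda>s. r2 s / r1 s) has_real_derivative z) (at y) \<and> 0 < z" by auto
    next
      have "isCont (\<lambda>s. r2 s / r1 s) y" if "y \<in> {x..sI}" for y
      proof -
        have y1: "y \<in> L1" and y2: "y \<in> L2" using that c sI by (auto intro!: in1 in2)
        then show ?thesis
          using S1.r_pos[OF y1] by (intro continuous_intros S1.r_isCont S2.r_isCont) auto
      qed
      then show "continuous_on {x..sI} (\<lambda>s. r2 s / r1 s)" by (intro continuous_at_imp_continuous_on) blast
    qed
    moreover have "r1 sI > 0" using S2.r_pos[OF sI(3)] sI(4) by simp
    moreover have "r1 x > 0" by (rule S1.r_pos, rule in1) (use c sI in linarith)+
    ultimately show ?thesis using sI(4) by (simp add: divide_less_eq)
  qed
  have key: "r1 x * p1 x < r2 x * p2 x" if x: "\<beta> \<le> x" "x \<le> sI" for x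
  proof (rule ccontr)
    assume nx: "\<not> r1 x * p1 x < r2 x * p2 x"
    have cf: "continuous_on {x..sI} (\<lambda>y. r2 y * p2 y - r1 y * p1 y)"
      using x sI in1 in2 S1.p_isCont S2.p_isCont S1.r_isCont S2.r_isCont
      by (intro continuous_at_imp_continuous_on ballI continuous_intros) auto
    have "r2 sI * p2 sI - r1 sI * p1 sI > 0"
      using steep[of sI] sI S2.r_pos[OF sI(3)] by simp
    then obtain c where c: "x \<le> c" "c < sI" "r2 c * p2 c - r1 c * p1 c = 0"
        "\<And>y. c < y \<Longrightarrow> y \<le> sI \<Longrightarrow> r2 y * p2 y - r1 y * p1 y > 0"
      using last_zero[OF cf x(2)] nx by auto
    have f: "r1 y * p1 y < r2 y * p2 y" if "c < y" "y \<le> sI" for y using c(4)[OF that] by simp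
    have rlt: "r2 y < r1 y" if "c \<le> y" "y < sI" for y
      by (rule ratio[OF _ that f]) (use x c in auto)
    have plt: "p1 y < p2 y" if y: "c < y" "y < a1" for y
    proof (cases "y < sI")
      case True
      have "y \<in> L1" "y \<in> L2" using y x c by (auto intro!: in1 in2)
      then have pos: "r1 y > 0" "r2 y > 0" "p1 y > 0" "p2 y > 0" using S1.r_pos S2.r_pos S1.p_pos S2.p_pos by auto
      show ?thesis
      proof (rule ccontr)
        assume "\<not> p1 y < p2 y"
        then have "r2 y * p2 y \<le> r1 y * p1 y" using rlt[of y] True y pos by (intro mult_mono) auto
        then show False using f[of y] True y by simp
      qed
    next
      case False
      then show ?thesis using y by (intro steep) auto
    qed
    have ca: "c < a1" using c sI by simp
    have c1: "c \<in> L1" and c2: "c \<in> L2" using x c ca by (auto intro!: in1 in2)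
    have T1pos: "S1.T y > 0" if "\<beta> < y" "y < a1" for y
      by (rule S1.T_pos[of D]) (use that quot_deriv quot_bound a12 in auto)
    have T2pos: "S2.T a1 > 0"
      by (rule S2.T_pos[of D]) (use quot_deriv quot_bound a12 S1.a_beta in auto)
    let ?Y = "\<lambda>y. S2.flux y * (S2.T y - S1.T y)"
    have "?Y c \<ge> S2.flux a1 * (S2.T a1 - 0)"
    proof (rule decreasing_ge_limit[OF ca])
      show "isCont ?Y y" if "c \<le> y" "y < a1" for y
        using that x c S1.b_less
        by (intro continuous_intros S2.flux_isCont S2.T_isCont S1.T_isCont in1 in2) auto
      have "(S2.flux \<longlongrightarrow> S2.flux a1) (at_left a1)" "(S2.T \<longlongrightarrow> S2.T a1) (at_left a1)"
        using S2.flux_isCont[OF a1_L2] S2.T_isCont[OF a1_L2 S1.ab] unfolding isCont_def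
        by (auto intro: filterlim_at_split[THEN iffD1, THEN conjunct1])
      then show "(?Y \<longlongrightarrow> S2.flux a1 * (S2.T a1 - 0)) (at_left a1)"
        by (intro tendsto_intros S1.T_top)
    next
      fix y assume y: "c < y" "y < a1"
      have yb: "\<beta> < y" "y < a2" using y x c a12 by auto
      have y1: "y \<in> L1" and y2: "y \<in> L2" using yb y by (auto intro!: in1 in2)
      have gy: "g y > 0" using yb S1.b_less by (intro S1.g_pos) auto
      have pos: "p1 y > 0" "p2 y > 0" using S1.p_pos[OF y1] S2.p_pos[OF y2] by auto
      let ?\<theta> = "2 * real N * D y - (real N - 2)"
      have "(?Y has_real_derivative (- (g y * S2.flux y / (p2 y)\<^sup>2)) * (S2.T y - S1.T y)
          + ((- ?\<theta> + g y / (p2 y)\<^sup>2 * S2.T y) - (- ?\<theta> + g y / (p1 y)\<^sup>2 * S1.T y)) * S2.flux y) (at y)"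
        by (intro DERIV_mult DERIV_diff S2.flux_level_deriv[OF y2] S2.T_deriv[OF y2] S1.T_deriv[OF y1] quot_deriv)
           (use gy yb in auto)
      moreover have "(- (g y * S2.flux y / (p2 y)\<^sup>2)) * (S2.T y - S1.T y)
          + ((- ?\<theta> + g y / (p2 y)\<^sup>2 * S2.T y) - (- ?\<theta> + g y / (p1 y)\<^sup>2 * S1.T y)) * S2.flux y
        = g y * S2.flux y * S1.T y * (1 / (p2 y)\<^sup>2 - 1 / (p1 y)\<^sup>2)"
        by (simp add: divide_inverse algebra_simps)
      moreover have "g y * S2.flux y * S1.T y * (1 / (p2 y)\<^sup>2 - 1 / (p1 y)\<^sup>2) \<le> 0"
      proof (rule mult_nonneg_nonpos)
        show "0 \<le> g y * S2.flux y * S1.T y"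
          using gy S2.flux_pos[OF y2] T1pos[OF yb(1) y(2)] by simp
        have "(p1 y)\<^sup>2 \<le> (p2 y)\<^sup>2" using plt[OF y] pos by (intro power_mono) auto
        then show "1 / (p2 y)\<^sup>2 - 1 / (p1 y)\<^sup>2 \<le> 0" using pos by (simp add: frac_le)
      qed
      ultimately show "\<exists>z. (?Y has_real_derivative z) (at y) \<and> z \<le> 0"
        by (intro exI[of _ "g y * S2.flux y * S1.T y * (1 / (p2 y)\<^sup>2 - 1 / (p1 y)\<^sup>2)"]) simp
    qed
    moreover have "S2.flux a1 * (S2.T a1 - 0) > 0" using T2pos S2.flux_pos[OF a1_L2] by simp
    ultimately have "?Y c > 0" by linarith
    then have "S2.T c - S1.T c > 0" using S2.flux_pos[OF c2] by (simp add: zero_less_mult_iff)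
    moreover have "S2.T c - S1.T c \<le> 0"
    proof -
      have pos: "r1 c > 0" "r2 c > 0" "p1 c > 0" "p2 c > 0"
        using S1.r_pos[OF c1] S2.r_pos[OF c2] S1.p_pos[OF c1] S2.p_pos[OF c2] by auto
      have "p1 c \<le> p2 c"
      proof (rule ccontr)
        assume "\<not> p1 c \<le> p2 c"
        then have "r2 c * p2 c < r1 c * p1 c" using rlt[of c] c(2) pos by (intro mult_strict_mono) auto
        then show False using c(3) by simp
      qed
      then have "r2 c / p2 c \<le> r1 c / p1 c" using rlt[of c] c(2) pos by (intro frac_le) auto
      moreover have "F0 \<ge> 0 \<Longrightarrow> F0 * (r2 c / p2 c) \<le> F0 * (r1 c / p1 c)" for F0
        using calculation by (rule mult_left_mono)
      moreover have "2 * S1.F c \<ge> 0" using S1.F_pos[of c] S1.F_beta x c by (cases "c = \<beta>") auto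
      ultimately have "2 * S1.F c * (r2 c / p2 c) \<le> 2 * S1.F c * (r1 c / p1 c)" by blast
      then show ?thesis using c(3) unfolding S1.T_def S2.T_def by (simp add: mult.commute mult.left_commute)
    qed
    ultimately show False by simp
  qed
  show "r1 s * p1 s < r2 s * p2 s" using key s by simp
  show "r2 s < r1 s"
    by (rule ratio[OF s(1) order_refl s(2)]) (use key s in auto)
qed

text \<open>
  If the intersection lies at or below \<beta>, take its level; otherwise carry the comparison of r p down to \<beta>,
  where F = 0 and hence W = r p.
\<close>
lemma ahead_at_low_level:
  obtains s0 where "b \<le> s0" "s0 \<le> \<beta>" "s0 \<in> L2" "r2 s0 \<le> r1 s0" "p1 s0 < p2 s0" "S1.W s0 < S2.W s0"
proof -
  obtain sI where sI: "b \<le> sI" "sI < a1" "sI \<in> L2" "r1 sI = r2 sI" "\<And>s. sI < s \<Longrightarrow> s < a1 \<Longrightarrow> r1 s < r2 s"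
    using crossing_level by blast
  show thesis
  proof (cases "sI \<le> \<beta>")
    case True
    have pl: "p1 sI < p2 sI" by (rule steeper_above[OF sI(1,2,3,5) order_refl sI(2)])
    have "sI \<in> L1" using sI S1.b_pos by (intro L1I) auto
    then have "p1 sI > 0" by (rule S1.p_pos)
    then have "(p1 sI)\<^sup>2 < (p2 sI)\<^sup>2" using pl by (intro power_strict_mono) auto
    then have "S1.W sI < S2.W sI"
      unfolding S1.W_def S2.W_def sI(4) using S2.r_pos[OF sI(3)] by simp
    then show thesis using sI pl True by (intro that[of sI]) auto
  next
    case False
    then have lt: "\<beta> < sI" by simp
    note B = below_crossing[OF sI order_refl lt]
    have bL: "\<beta> \<in> L1" "\<beta> \<in> L2"
      using S1.b_pos S1.b_less S1.a_beta a12 by (auto intro!: L1I S2.high_level)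
    have pos: "r1 \<beta> > 0" "r2 \<beta> > 0" "p1 \<beta> > 0" "p2 \<beta> > 0"
      using S1.r_pos[OF bL(1)] S2.r_pos[OF bL(2)] S1.p_pos[OF bL(1)] S2.p_pos[OF bL(2)] by auto
    have pl: "p1 \<beta> < p2 \<beta>"
    proof (rule ccontr)
      assume "\<not> ?thesis"
      then have "r2 \<beta> * p2 \<beta> \<le> r1 \<beta> * p1 \<beta>" using B(1) pos by (intro mult_mono) auto
      with B(2) show False by simp
    qed
    have "S1.W \<beta> < S2.W \<beta>" unfolding S1.W_def S2.W_def using pos B(2) by (simp add: S1.F_beta)
    then show thesis using pl B(1) bL S1.b_less by (intro that[of \<beta>]) auto
  qed
qed

text \<open>
  Below \<beta> the primitive F is nonpositive, so as long as the second solution is steeper, going down only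
  increases the difference of the functions W, and also that of the radii.
\<close>
lemma W_gap:
  assumes c: "0 < c" "c \<le> s0" "s0 \<le> \<beta>" and cL: "c \<in> L2" and s0: "s0 \<in> L2"
    and lt: "\<And>y. c < y \<Longrightarrow> y < s0 \<Longrightarrow> p1 y < p2 y"
  shows "S2.W s0 - S1.W s0 \<le> S2.W c - S1.W c" "r1 s0 - r2 s0 \<le> r1 c - r2 c"
proof -
  have s0a: "s0 < a1" using c S1.a_beta by simp
  have in2: "y \<in> L2" if "c \<le> y" "y \<le> s0" for y
    using S2.lev_up[OF cL that(1)] that s0a a12 by simp
  have in1: "y \<in> L1" if "c \<le> y" "y \<le> s0" for y
    using that c s0a by (intro L1I) auto
  show "S2.W s0 - S1.W s0 \<le> S2.W c - S1.W c"
  proof (rule DERIV_nonpos_imp_decreasing_open[of c s0 "\<lambda>s. S2.W s - S1.W s"])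
    fix y assume y: "c < y" "y < s0"
    have y1: "y \<in> L1" and y2: "y \<in> L2" using y by (auto intro!: in1 in2)
    have e1: "(p1 y)\<^sup>2 + 2 * S1.F y > 0" using y c by (intro S1.slope_energy[OF y1]) auto
    have pp: "0 < p1 y" "p1 y < p2 y" using S1.p_pos[OF y1] lt[OF y] by auto
    have "(p1 y)\<^sup>2 < (p2 y)\<^sup>2" using pp by (intro power_strict_mono) auto
    then have e2: "(p2 y)\<^sup>2 + 2 * S1.F y > 0" using e1 by simp
    have fn: "S1.F y \<le> 0" using y c by (intro S1.F_nonpos) auto
    have "((real N - 1) * p2 y / sqrt ((p2 y)\<^sup>2 + 2 * S1.F y) - sqrt ((p2 y)\<^sup>2 + 2 * S1.F y) / p2 y)
        \<le> ((real N - 1) * p1 y / sqrt ((p1 y)\<^sup>2 + 2 * S1.F y) - sqrt ((p1 y)\<^sup>2 + 2 * S1.F y) / p1 y)"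
      by (rule radial_slope_mono[OF pp fn e1]) (use S1.N3 in simp)
    then show "\<exists>z. ((\<lambda>s. S2.W s - S1.W s) has_real_derivative z) (at y) \<and> z \<le> 0"
      using DERIV_diff[OF S2.W_deriv[OF y2 e2] S1.W_deriv[OF y1 e1]] by (meson diff_le_0_iff_le)
  next
    show "continuous_on {c..s0} (\<lambda>s. S2.W s - S1.W s)"
      using in1 in2 by (intro continuous_at_imp_continuous_on ballI continuous_intros S1.W_isCont S2.W_isCont) auto
  qed (use c in simp)
  show "r1 s0 - r2 s0 \<le> r1 c - r2 c"
  proof (rule DERIV_nonpos_imp_decreasing_open[of c s0 "\<lambda>s. r1 s - r2 s"])
    fix y assume y: "c < y" "y < s0"
    have y1: "y \<in> L1" and y2: "y \<in> L2" using y by (auto intro!: in1 in2)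
    have "1 / p2 y \<le> 1 / p1 y" using S1.p_pos[OF y1] lt[OF y] by (intro divide_left_mono) auto
    then have "(- 1 / p1 y) - (- 1 / p2 y) \<le> 0" by simp
    then show "\<exists>z. ((\<lambda>s. r1 s - r2 s) has_real_derivative z) (at y) \<and> z \<le> 0"
      using DERIV_diff[OF S1.r_deriv[OF y1] S2.r_deriv[OF y2]] by blast
  next
    show "continuous_on {c..s0} (\<lambda>s. r1 s - r2 s)"
      using in1 in2 by (intro continuous_at_imp_continuous_on ballI continuous_intros S1.r_isCont S2.r_isCont) auto
  qed (use c in simp)
qed

text \<open>
  Starting from the level of \<open>ahead_at_low_level\<close>, the larger solution stays steeper on its whole way down: at
  a first level with p1 = p2 one would get W2 \<le> W1 from r2 \<le> r1. Hence W2 exceeds W1 by a fixed \<delta>, so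
  r2 p2 \<ge> \<delta>. Below b the flux does not exceed its value at b, and flux = r2^(N-2) (r2 p2) then bounds the
  radius r2 by some B, since N > 2. So p2 \<ge> \<delta>/B, and the level 0 is reached, with negative derivative.
\<close>
theorem larger_solution_crosses: "\<exists>t>0. u2 t < 0"
proof -
  obtain s0 where s0: "b \<le> s0" "s0 \<le> \<beta>" "s0 \<in> L2" "r2 s0 \<le> r1 s0" "p1 s0 < p2 s0" "S1.W s0 < S2.W s0"
    by (rule ahead_at_low_level)
  have s0a: "s0 < a1" using s0 S1.a_beta by simp
  have steeper: "p1 s < p2 s" if s: "0 < s" "s \<le> s0" "s \<in> L2" for s
  proof (rule ccontr)
    assume np: "\<not> p1 s < p2 s"
    have in2: "y \<in> L2" if "s \<le> y" "y \<le> s0" for y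
      using S2.lev_up[OF s(3) that(1)] that s0a a12 by simp
    have in1: "y \<in> L1" if "s \<le> y" "y \<le> s0" for y
      using that s s0a by (intro L1I) auto
    have cf: "continuous_on {s..s0} (\<lambda>x. p2 x - p1 x)"
      using in1 in2 by (intro continuous_at_imp_continuous_on ballI continuous_intros S1.p_isCont S2.p_isCont) auto
    obtain c where c: "s \<le> c" "c < s0" "p2 c - p1 c = 0" "\<And>x. c < x \<Longrightarrow> x \<le> s0 \<Longrightarrow> p2 x - p1 x > 0"
      using last_zero[OF cf s(2)] np s0(5) by auto
    have c1: "c \<in> L1" and c2: "c \<in> L2" using c by (auto intro!: in1 in2)
    have "S2.W s0 - S1.W s0 \<le> S2.W c - S1.W c" "r1 s0 - r2 s0 \<le> r1 c - r2 c"
      by (rule W_gap; use c s s0 c2 in \<open>auto dest: c(4)\<close>)+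
    then have "S1.W c < S2.W c" "r2 c \<le> r1 c" using s0 by auto
    moreover have "S2.W c \<le> S1.W c"
    proof -
      have "p2 c = p1 c" using c(3) by simp
      moreover have "sqrt ((p1 c)\<^sup>2 + 2 * S1.F c) \<ge> 0"
        using S1.slope_energy[OF c1] c(1) s by simp
      ultimately show ?thesis
        unfolding S1.W_def S2.W_def using \<open>r2 c \<le> r1 c\<close> by (simp add: mult_right_mono)
    qed
    ultimately show False by simp
  qed
  define \<delta> where "\<delta> = S2.W s0 - S1.W s0"
  have \<delta>: "\<delta> > 0" using s0(6) unfolding \<delta>_def by simp
  have gap: "\<delta> \<le> r2 s * p2 s" if s: "0 < s" "s \<le> s0" "s \<in> L2" for s
  proof -
    have s1: "s \<in> L1" using s s0a by (intro L1I) auto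
    have in2: "y \<in> L2" if "s \<le> y" "y \<le> s0" for y
      using S2.lev_up[OF s(3) that(1)] that s0a a12 by simp
    have "\<delta> \<le> S2.W s - S1.W s"
      unfolding \<delta>_def by (rule W_gap(1)) (use s s0 in2 in \<open>auto intro!: steeper\<close>)
    moreover have "S1.W s \<ge> 0"
      unfolding S1.W_def using S1.r_pos[OF s1] S1.slope_energy[OF s1] s by simp
    moreover have "S2.W s \<le> r2 s * p2 s"
    proof -
      have "sqrt ((p2 s)\<^sup>2 + 2 * S1.F s) \<le> sqrt ((p2 s)\<^sup>2)"
        by (rule real_sqrt_le_mono) (use S1.F_nonpos[of s] s s0 in linarith)
      also have "\<dots> = p2 s" using S2.p_pos[OF s(3)] by simp
      finally show ?thesis unfolding S2.W_def using S2.r_pos[OF s(3)] by (intro mult_left_mono) auto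
    qed
    ultimately show ?thesis by linarith
  qed
  have bL: "b \<in> L2"
  proof -
    have in1: "y \<in> L1" if "b \<le> y" "y \<le> s0" for y
      using that S1.b_pos s0a by (intro L1I) auto
    have "compact {b..s0}" "{b..s0} \<noteq> {}" using s0 by auto
    moreover have "continuous_on {b..s0} p1"
      using in1 S1.p_isCont by (intro continuous_at_imp_continuous_on ballI) auto
    ultimately obtain m where m: "m \<in> {b..s0}" "\<And>x. x \<in> {b..s0} \<Longrightarrow> p1 m \<le> p1 x"
      using continuous_attains_inf[of "{b..s0}" p1] by blast
    show ?thesis
    proof (rule S2.exhaust_levels[OF S2.r_desc[OF s0(3)]])
      show "p1 m > 0" using m(1) by (intro S1.p_pos in1) auto
      show "b < a2" by (rule S2.ab)
      fix t assume t: "t \<in> desc v2" "r2 s0 \<le> t" "b < u2 t"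
      have us: "u2 t \<le> s0" using S2.u_less_iff[OF t(1) s0(3)] S2.u_r[OF s0(3)] t(2) by (cases "r2 s0 = t") auto
      have "p1 m \<le> p1 (u2 t)" using us t by (intro m(2)) auto
      also have "\<dots> < p2 (u2 t)" using us t S1.b_pos by (intro steeper) auto
      finally show "v2 t \<le> - p1 m" using S2.r_u[OF t(1)] by (simp add: slope_def)
    qed
  qed
  have b0: "0 < b" "b \<le> s0" using S1.b_pos s0 by auto
  have flux_le: "S2.flux s \<le> S2.flux b" if s: "0 < s" "s \<le> b" "s \<in> L2" for s
  proof (rule DERIV_nonneg_imp_increasing_open[OF s(2)])
    have in2: "y \<in> L2" if "s \<le> y" "y \<le> b" for y
      using S2.lev_up[OF s(3) that(1)] that s0a a12 b0 by simp
    show "continuous_on {s..b} S2.flux"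
      using in2 by (intro continuous_at_imp_continuous_on ballI S2.flux_isCont) auto
    fix y assume y: "s < y" "y < b"
    then have y2: "y \<in> L2" by (intro in2) auto
    have "g y * S2.flux y / (p2 y)\<^sup>2 \<le> 0"
      using S1.g_nonpos[of y] y s S2.flux_pos[OF y2]
      by (intro divide_nonpos_nonneg mult_nonpos_nonneg) auto
    then show "\<exists>z. (S2.flux has_real_derivative z) (at y) \<and> 0 \<le> z"
      using S2.flux_level_deriv[OF y2] by (meson neg_0_le_iff_le)
  qed
  define B where "B = max 1 (S2.flux b / \<delta>)"
  have r_bound: "r2 s \<le> B" if s: "0 < s" "s \<le> b" "s \<in> L2" for s
  proof (cases "r2 s \<le> 1")
    case False
    have N: "N - 1 = Suc (N - 2)" "N - 2 \<ge> 1" using S1.N3 by auto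
    have "r2 s ^ (N - 2) * \<delta> \<le> r2 s ^ (N - 2) * (r2 s * p2 s)"
      using gap[of s] s b0 False by (intro mult_left_mono) auto
    also have "\<dots> = S2.flux s" unfolding S2.flux_def N(1) by simp
    also have "\<dots> \<le> S2.flux b" by (rule flux_le[OF s])
    finally have "r2 s ^ (N - 2) \<le> S2.flux b / \<delta>" using \<delta> by (simp add: pos_le_divide_eq)
    moreover have "r2 s ^ 1 \<le> r2 s ^ (N - 2)" using False N by (intro power_increasing) auto
    ultimately show ?thesis unfolding B_def by simp
  qed (simp add: B_def)
  have B: "B > 0" unfolding B_def by simp
  have "0 \<in> L2"
  proof (rule S2.exhaust_levels[OF S2.r_desc[OF bL]])
    show "\<delta> / B > 0" using \<delta> B by simp
    show "0 < a2" using S1.b_pos S2.ab by simp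
    fix t assume t: "t \<in> desc v2" "r2 b \<le> t" "0 < u2 t"
    have ub: "u2 t \<le> b" using S2.u_less_iff[OF t(1) bL] S2.u_r[OF bL] t(2) by (cases "r2 b = t") auto
    have L: "u2 t \<in> L2" using t(1) by simp
    have rt: "r2 (u2 t) = t" by (rule S2.r_u[OF t(1)])
    have "\<delta> \<le> t * p2 (u2 t)" using gap[OF t(3) _ L] ub b0 rt by simp
    also have "\<dots> \<le> B * p2 (u2 t)"
      using r_bound[OF t(3) ub L] rt S2.p_pos[OF L] by (intro mult_right_mono) auto
    finally have "\<delta> / B \<le> p2 (u2 t)" using B by (simp add: pos_divide_le_eq mult.commute)
    then show "v2 t \<le> - (\<delta> / B)" by (simp add: slope_def rt)
  qed
  then obtain s where s: "s < 0" "s \<in> L2" by (rule S2.lev_below)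
  then show ?thesis using S2.u_r[OF s(2)] S2.r_pos[OF s(2)] by (intro exI[of _ "r2 s"]) auto
qed

end

section \<open>Shooting without uniqueness\<close>

lemma choice2: "\<forall>n. \<exists>x y. P n x y \<Longrightarrow> \<exists>f h. \<forall>n. P n (f n) (h n)"
  by metis
lemma rsol_converges_along:
  assumes s: "\<And>n. rsol N g (a n) (u n) (v n)" and N: "2 \<le> N"
    and g: "continuous_on UNIV g" "\<And>s. \<bar>g s\<bar> \<le> M"
    and lim: "\<And>r. r \<ge> 0 \<Longrightarrow> (\<lambda>n. u n r) \<longlonglongrightarrow> U r"
    and X: "X \<longlonglongrightarrow> x" "\<And>n. X n \<ge> 0"
  shows "(\<lambda>n. u n (X n)) \<longlonglongrightarrow> U x"
proof -
  have eq: "pos N (a n) (\<lambda>r. g (u n r)) r = u n r" if "r \<ge> 0" for n r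
    using rsol_pos[OF s N g(1) that] by simp
  have "(\<lambda>n. pos N (a n) (\<lambda>r. g (u n r)) (X n)) \<longlonglongrightarrow> U x"
    by (rule pos_converges_along[where G = "\<lambda>n r. g (u n r)" and M = M])
       (use rsol_comp_continuous[OF s g(1)] g(2) N lim X eq in auto)
  then show ?thesis using eq X(2) by simp
qed

context nonlinearity
begin

lemma start_above_b:
  assumes s: "rsol N g a u v" and a: "a > 0" and R: "R \<ge> 0" and E: "energy u v R \<ge> 0"
  shows "b < a"
proof (rule ccontr)
  assume "\<not> b < a"
  moreover have "F a \<ge> 0" using energy_antimono[OF s, of 0 R] R E energy_0[OF s] by simp
  ultimately show False using F_neg[of a] b_less a by simp
qed

lemma free_solutionI:
  assumes s: "rsol N g a u v" and a: "a > 0" and free: "\<not> trapped u v"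
  shows "free_solution N g b \<beta> M a u v"
proof -
  have "energy u v 0 \<ge> 0"
    using free rsol_D(1)[OF s] a unfolding trapped_def by (force simp: not_less)
  then have "b < a" by (intro start_above_b[OF s a order_refl])
  then show ?thesis
    using s free by unfold_locales
qed

text \<open>
  Compare the two solutions at levels s in (0, b], with G = sqrt (- 2 F). The untrapped positive solution has p1 \<ge> G.
  For the one that vanishes at \<rho> together with its derivative, integrating p2' \<le> C - g/G = C + G' from the
  level 0 gives p2 \<le> G + C s.
  
  If G s \<ge> s for all small s, then p2 \<le> (1 + C) p1, so the radius r1, an integral of 1/p1, stays
  bounded as s tends to 0, by comparison with r2 < \<rho>; but the first solution is positive at all radii. Otherwise there are
  arbitrarily small s with G < s on (0, s], where p2 \<le> (1 + C) s, and the second solution needs at least the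
  radius 1/(2 (1 + C)) to fall from s to s/2; but at small levels it is already within that distance of \<rho>.
\<close>
lemma no_dead_core:
  assumes s1: "rsol N g a1 u1 v1" and pos1: "\<And>t. 0 \<le> t \<Longrightarrow> u1 t > 0" and free1: "\<not> trapped u1 v1"
    and s2: "rsol N g a2 u2 v2" and \<rho>: "\<rho> > 0" and pos2: "\<And>t. 0 \<le> t \<Longrightarrow> t < \<rho> \<Longrightarrow> u2 t > 0"
    and zero: "u2 \<rho> = 0" "v2 \<rho> = 0"
  shows False
proof -
  have a1: "a1 > 0" using pos1[of 0] rsol_D(1)[OF s1] by simp
  have a2: "a2 > 0" using pos2[of 0] \<rho> rsol_D(1)[OF s2] by simp
  interpret S1: free_solution N g b \<beta> M a1 u1 v1 by (rule free_solutionI[OF s1 a1 free1])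
  have E\<rho>: "energy u2 v2 \<rho> = 0" using zero F_zero[of 0] by (simp add: energy_def)
  have E2: "energy u2 v2 t \<ge> 0" if "0 \<le> t" "t \<le> \<rho>" for t
    using energy_antimono[OF s2 that] E\<rho> by simp
  have ab2: "b < a2" by (rule start_above_b[OF s2 a2, of \<rho>]) (use E\<rho> \<rho> in auto)
  interpret S2: radial_solution N g b \<beta> M a2 u2 v2 by unfold_locales (fact s2 ab2)+
  have neg2: "v2 t < 0" if t: "0 < t" "t < \<rho>" for t
    by (rule descent[OF s2, of t]) (use t pos2 E2 in auto)
  have d2: "t \<in> desc v2" if "0 < t" "t < \<rho>" for t
    using that neg2 unfolding desc_def by auto
  have d2_less: "t < \<rho>" if "t \<in> desc v2" for t
    using that \<rho> zero(2) unfolding desc_def by force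
  have neg1: "v1 t < 0" if t: "0 < t" for t
    by (rule descent[OF s1, of t]) (use t pos1 S1.energy_nonneg_if_pos in auto)
  have d1: "t \<in> desc v1" if "0 < t" for t
    using that neg1 unfolding desc_def by auto
  let ?L1 = "u1 ` desc v1" and ?L2 = "u2 ` desc v2"
  let ?r1 = "rad u1 v1" and ?r2 = "rad u2 v2" and ?p1 = "slope u1 v1" and ?p2 = "slope u2 v2"
  have L1: "s \<in> ?L1" if "0 < s" "s \<le> b" for s using that S1.ab by (intro S1.all_levels) auto
  have L2: "s \<in> ?L2" if s: "0 < s" "s \<le> b" for s
  proof -
    have "\<exists>t\<ge>0. t \<le> \<rho> \<and> u2 t = s"
      by (rule IVT2') (use s ab2 zero \<rho> S2.u_0 in \<open>auto intro: continuous_on_subset[OF S2.u_cont]\<close>)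
    then obtain t where t: "0 \<le> t" "t \<le> \<rho>" "u2 t = s" by blast
    then have "t \<noteq> 0" "t \<noteq> \<rho>" using zero s ab2 S2.u_0 by auto
    then show ?thesis using t d2[of t] by force
  qed
  have r2_less: "?r2 s < \<rho>" if "s \<in> ?L2" for s using S2.r_desc[OF that] by (rule d2_less)
  define G where "G s = sqrt (- 2 * F s)" for s
  have Fn: "F s < 0" if "0 < s" "s \<le> b" for s using that b_less by (intro F_neg) auto
  have Gp: "G s > 0" if "0 < s" "s \<le> b" for s using Fn[OF that] unfolding G_def by simp
  have Gd: "(G has_real_derivative (- g s / G s)) (at s)" if s: "0 < s" "s \<le> b" for s
  proof -
    have "(G has_real_derivative (inverse (sqrt (- 2 * F s)) / 2 * (- 2 * g s))) (at s)"
      unfolding G_def[abs_def]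
      by (rule DERIV_chain2[where f = sqrt, OF DERIV_real_sqrt DERIV_cmult[OF F_deriv]]) (use Fn[OF s] in simp)
    then show ?thesis by (simp add: G_def inverse_eq_divide)
  qed
  have Gmono: "G s \<le> G t" if "0 < s" "s \<le> t" "t \<le> b" for s t
  proof (rule DERIV_nonneg_imp_nondecreasing[OF that(2)])
    fix x assume x: "s \<le> x" "x \<le> t"
    then have "0 < x" "x \<le> b" using that by auto
    then show "\<exists>y. (G has_real_derivative y) (at x) \<and> 0 \<le> y"
      using Gd[of x] Gp[of x] g_nonpos[of x] by (intro exI[of _ "- g x / G x"]) (auto intro: divide_nonpos_pos)
  qed
  have p1G: "G s \<le> ?p1 s" if s: "0 < s" "s \<le> b" for s
    unfolding G_def using S1.slope_energy[OF L1[OF s] s(1)] S1.p_pos[OF L1[OF s]]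
    by (intro real_le_lsqrt) auto
  have p2G: "G s \<le> ?p2 s" if s: "0 < s" "s \<le> b" for s
  proof -
    have "energy u2 v2 (?r2 s) \<ge> 0"
      using S2.r_pos[OF L2[OF s]] r2_less[OF L2[OF s]] by (intro E2) auto
    then show ?thesis
      unfolding G_def using S2.u_r[OF L2[OF s]] S2.p_pos[OF L2[OF s]]
      by (intro real_le_lsqrt) (auto simp: energy_def slope_def)
  qed
  define C where "C = (real N - 1) / ?r2 b"
  have bL: "b \<in> ?L2" using b_pos by (intro L2) auto
  have C: "C \<ge> 0" unfolding C_def using S2.r_pos[OF bL] N3 by simp
  have near_end: "\<exists>s'. 0 < s' \<and> s' < s \<and> ?p2 s' < e \<and> s' \<le> b" if e: "e > 0" and s: "s > 0" for e s
  proof -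
    have "isCont u2 \<rho>" "isCont v2 \<rho>"
      using S2.u_deriv[OF \<rho>] S2.v_deriv[OF \<rho>] DERIV_isCont by blast+
    then have tu: "(u2 \<longlongrightarrow> 0) (at \<rho>)" and tv: "(v2 \<longlongrightarrow> 0) (at \<rho>)"
      unfolding isCont_def zero by blast+
    have "\<forall>\<^sub>F t in at \<rho>. u2 t < min s b"
      by (rule order_tendstoD(2)[OF tu]) (use s b_pos in simp)
    moreover have "\<forall>\<^sub>F t in at \<rho>. v2 t > - e"
      by (rule order_tendstoD(1)[OF tv]) (use e in simp)
    ultimately have "\<forall>\<^sub>F t in at \<rho>. u2 t < min s b \<and> v2 t > - e" by (rule eventually_conj)
    then obtain d where d: "d > 0" "\<And>t. t \<noteq> \<rho> \<Longrightarrow> dist t \<rho> < d \<Longrightarrow> u2 t < min s b \<and> v2 t > - e"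
      unfolding eventually_at by auto
    define t where "t = max (\<rho> / 2) (\<rho> - d / 2)"
    have t: "0 < t" "t < \<rho>" "dist t \<rho> < d" using d(1) \<rho> unfolding t_def dist_real_def by auto
    have rt: "?r2 (u2 t) = t" by (rule S2.r_u[OF d2[OF t(1,2)]])
    show ?thesis
      using d(2)[of t] t pos2[of t] rt by (intro exI[of _ "u2 t"]) (auto simp: slope_def)
  qed
  have p2_le: "?p2 s \<le> G s + C * s" if s: "0 < s" "s \<le> b" for s
  proof (rule field_le_epsilon)
    fix e :: real assume e: "e > 0"
    obtain s' where s': "0 < s'" "s' < s" "?p2 s' < e" using near_end[OF e s(1)] by blast
    have "?p2 s - G s - C * s \<le> ?p2 s' - G s' - C * s'"
    proof (rule DERIV_nonpos_imp_nonincreasing[of s' s "\<lambda>s. ?p2 s - G s - C * s"])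
      fix x assume x: "s' \<le> x" "x \<le> s"
      then have xb: "0 < x" "x \<le> b" using s s' by auto
      have x2: "x \<in> ?L2" by (rule L2[OF xb])
      have "((\<lambda>s. ?p2 s - G s - C * s) has_real_derivative
          (((real N - 1) / ?r2 x - g x / ?p2 x) - (- g x / G x) - C * 1)) (at x)"
        by (intro DERIV_diff S2.p_deriv[OF x2] Gd[OF xb] DERIV_cmult DERIV_ident)
      moreover have "(real N - 1) / ?r2 x \<le> C"
      proof -
        have "?r2 b \<le> ?r2 x" using S2.r_less[OF x2 bL] xb by (cases "x = b") auto
        then show ?thesis unfolding C_def using S2.r_pos[OF bL] N3 by (intro divide_left_mono) auto
      qed
      moreover have "- g x / ?p2 x \<le> - g x / G x"
        using p2G[OF xb] Gp[OF xb] g_nonpos[of x] xb by (intro divide_left_mono) auto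
      ultimately show "\<exists>y. ((\<lambda>s. ?p2 s - G s - C * s) has_real_derivative y) (at x) \<and> y \<le> 0"
        by (intro exI[of _ "((real N - 1) / ?r2 x - g x / ?p2 x) - (- g x / G x) - C * 1"] conjI) simp_all
    qed (use s' in simp)
    then have "?p2 s - G s - C * s \<le> e"
      using s' Gp[of s'] s mult_nonneg_nonneg[OF C, of s'] by linarith
    then show "?p2 s \<le> G s + C * s + e" by simp
  qed
  show False
  proof (cases "\<exists>s1. 0 < s1 \<and> s1 \<le> b \<and> (\<forall>s. 0 < s \<and> s \<le> s1 \<longrightarrow> s \<le> G s)")
    case True
    then obtain s1 where s1: "0 < s1" "s1 \<le> b" "\<And>s. 0 < s \<Longrightarrow> s \<le> s1 \<Longrightarrow> s \<le> G s" by blast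
    have bound: "?r1 s \<le> (1 + C) * \<rho> + ?r1 s1" if s: "0 < s" "s \<le> s1" for s
    proof -
      have "(1 + C) * ?r2 s1 - ?r1 s1 \<le> (1 + C) * ?r2 s - ?r1 s"
      proof (rule DERIV_nonpos_imp_nonincreasing[OF s(2), of "\<lambda>s. (1 + C) * ?r2 s - ?r1 s"])
        fix x assume x: "s \<le> x" "x \<le> s1"
        then have xb: "0 < x" "x \<le> b" using s s1 by auto
        have "((\<lambda>s. (1 + C) * ?r2 s - ?r1 s) has_real_derivative ((1 + C) * (- 1 / ?p2 x) - (- 1 / ?p1 x))) (at x)"
          by (intro DERIV_diff DERIV_cmult S1.r_deriv[OF L1[OF xb]] S2.r_deriv[OF L2[OF xb]])
        moreover have "(1 + C) * (- 1 / ?p2 x) - (- 1 / ?p1 x) \<le> 0"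
        proof -
          have pos: "?p1 x > 0" "?p2 x > 0" using S1.p_pos[OF L1[OF xb]] S2.p_pos[OF L2[OF xb]] by auto
          have "C * x \<le> C * G x" using s1(3)[of x] x s C by (intro mult_left_mono) auto
          then have "?p2 x \<le> (1 + C) * G x" using p2_le[OF xb] by (simp add: algebra_simps)
          also have "\<dots> \<le> (1 + C) * ?p1 x" using p1G[OF xb] C by (intro mult_left_mono) auto
          finally show ?thesis using pos by (simp add: field_simps)
        qed
        ultimately show "\<exists>y. ((\<lambda>s. (1 + C) * ?r2 s - ?r1 s) has_real_derivative y) (at x) \<and> y \<le> 0" by blast
      qed
      moreover have "(1 + C) * ?r2 s \<le> (1 + C) * \<rho>"
        using r2_less[OF L2[of s]] s s1 C by (intro mult_left_mono) auto
      moreover have "(1 + C) * ?r2 s1 \<ge> 0"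
        using S2.r_pos[OF L2[OF s1(1,2)]] C by simp
      ultimately show ?thesis by linarith
    qed
    define B where "B = max (?r1 s1) ((1 + C) * \<rho> + ?r1 s1) + 1"
    have rs: "?r1 s1 > 0" by (rule S1.r_pos[OF L1[OF s1(1,2)]])
    have B: "B > 0" "B > ?r1 s1" "B > (1 + C) * \<rho> + ?r1 s1" using rs unfolding B_def by auto
    have "u1 B < s1" using S1.u_less_iff[OF d1[OF B(1)] L1[OF s1(1,2)]] B by simp
    then have "?r1 (u1 B) \<le> (1 + C) * \<rho> + ?r1 s1" using pos1[of B] B by (intro bound) auto
    then show False using S1.r_u[OF d1[OF B(1)]] B by simp
  next
    case False
    \<comment> \<open>a lower bound for the radius spent between the levels s and s/2; t is closer than \<kappa> to \<rho>\<close>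
    define \<kappa> where "\<kappa> = 1 / (1 + C) / 2"
    have \<kappa>: "\<kappa> > 0" using C unfolding \<kappa>_def by simp
    define t where "t = max (\<rho> / 2) (\<rho> - \<kappa> / 2)"
    have t: "0 < t" "t < \<rho>" "\<rho> - t < \<kappa>" using \<kappa> \<rho> unfolding t_def by auto
    define s1 where "s1 = min b (u2 t)"
    have "0 < s1" "s1 \<le> b" using b_pos pos2[of t] t unfolding s1_def by auto
    then obtain s where s: "0 < s" "s \<le> s1" "G s < s" using False by force
    have sb: "s \<le> b" "s \<le> u2 t" using s unfolding s1_def by auto
    have sL: "s \<in> ?L2" by (rule L2[OF s(1) sb(1)])
    have tr: "t \<le> ?r2 s" using S2.u_less_iff[OF d2[OF t(1,2)] sL] sb(2) by force
    have "?r2 s + s / ((1 + C) * s) \<le> ?r2 (s / 2) + (s / 2) / ((1 + C) * s)"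
    proof (rule DERIV_nonpos_imp_nonincreasing[of "s / 2" s "\<lambda>x. ?r2 x + x / ((1 + C) * s)"])
      fix x assume x: "s / 2 \<le> x" "x \<le> s"
      then have xb: "0 < x" "x \<le> b" using s sb by auto
      have "((\<lambda>x. ?r2 x + x / ((1 + C) * s)) has_real_derivative (- 1 / ?p2 x + 1 / ((1 + C) * s))) (at x)"
        by (intro DERIV_add S2.r_deriv[OF L2[OF xb]] DERIV_cdivide DERIV_ident)
      moreover have "?p2 x \<le> (1 + C) * s"
      proof -
        have "?p2 x \<le> G x + C * x" by (rule p2_le[OF xb])
        also have "\<dots> \<le> s + C * s" using Gmono[of x s] xb x s sb C by (intro add_mono mult_left_mono) auto
        finally show ?thesis by (simp add: algebra_simps)
      qed
      then have "1 / ((1 + C) * s) \<le> 1 / ?p2 x"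
        using S2.p_pos[OF L2[OF xb]] by (intro divide_left_mono) (use s C in auto)
      then have "- 1 / ?p2 x + 1 / ((1 + C) * s) \<le> 0" by simp
      ultimately show "\<exists>y. ((\<lambda>x. ?r2 x + x / ((1 + C) * s)) has_real_derivative y) (at x) \<and> y \<le> 0" by blast
    qed (use s in simp)
    moreover have "s / ((1 + C) * s) = 2 * \<kappa>" "(s / 2) / ((1 + C) * s) = \<kappa>"
    proof -
      have q: "s / ((1 + C) * s) = 1 / (1 + C)" using s by simp
      have h: "2 * (x / 2) = x" for x :: real by simp
      show "s / ((1 + C) * s) = 2 * \<kappa>" unfolding \<kappa>_def h by (rule q)
      have "(s / 2) / ((1 + C) * s) = s / ((1 + C) * s) / 2"
        by (simp only: divide_divide_eq_left mult.commute)
      then show "(s / 2) / ((1 + C) * s) = \<kappa>" unfolding q \<kappa>_def .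
    qed
    ultimately have "?r2 s + \<kappa> \<le> ?r2 (s / 2)" by linarith
    moreover have "?r2 (s / 2) < \<rho>" using s sb by (intro r2_less L2) auto
    ultimately show False using tr t(3) by linarith
  qed
qed

text \<open>
  If the limit were trapped at the radius R, the energies of the approximants would be below a fixed negative bound
  from R on, which excludes small values there. Their small values would then occur in [0, R] and accumulate at
  a radius in [0, R] where the limit is at most 0.
\<close>
lemma untrapped_limit:
  assumes s: "\<And>n. rsol N g (a n) (u n) (v n)" and S: "rsol N g l U V"
    and lim: "\<And>r. r \<ge> 0 \<Longrightarrow> (\<lambda>n. u n r) \<longlonglongrightarrow> U r" "\<And>r. r \<ge> 0 \<Longrightarrow> (\<lambda>n. v n r) \<longlonglongrightarrow> V r"
    and x: "\<And>n. x n \<ge> 0" "\<And>n. u n (x n) \<le> e n" and e: "e \<longlonglongrightarrow> 0"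
  shows "\<not> trapped U V"
proof
  assume "trapped U V"
  then obtain R where R: "R \<ge> 0" "\<And>r. 0 \<le> r \<Longrightarrow> r \<le> R \<Longrightarrow> U r > 0" "energy U V R < 0"
    unfolding trapped_def by auto
  \<comment> \<open>half of the energy deficit, so that the approximants inherit a deficit of at least \<eta>\<close>
  define \<eta> where "\<eta> = - energy U V R / 2"
  have \<eta>: "\<eta> > 0" using R(3) unfolding \<eta>_def by simp
  have "(\<lambda>n. F (u n R)) \<longlonglongrightarrow> F (U R)"
    by (rule continuous_on_tendsto_compose[OF F_cont[of UNIV] lim(1)[OF R(1)]]) auto
  then have "(\<lambda>n. energy (u n) (v n) R) \<longlonglongrightarrow> energy U V R"
    unfolding energy_def by (intro tendsto_intros lim(2) R(1)) auto
  then have ev1: "\<forall>\<^sub>F n in sequentially. energy (u n) (v n) R < - \<eta>"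
    by (rule order_tendstoD(2)) (use R(3) in \<open>simp add: \<eta>_def\<close>)
  have "isCont F 0" using F_deriv DERIV_isCont by blast
  then have "\<forall>\<^sub>F s in at 0. F s > - \<eta>"
    unfolding isCont_def using F_zero[of 0] \<eta> by (intro order_tendstoD(1)) auto
  then obtain c where c: "c > 0" "\<And>s. s \<noteq> 0 \<Longrightarrow> \<bar>s\<bar> < c \<Longrightarrow> F s > - \<eta>"
    unfolding eventually_at by (auto simp: dist_real_def)
  have Fc: "F s > - \<eta>" if "s < c" for s
    using c(2)[of s] F_zero[of s] that \<eta> by (cases "s \<le> 0") auto
  have ev2: "\<forall>\<^sub>F n in sequentially. e n < c" using order_tendstoD(2)[OF e c(1)] .
  from eventually_conj[OF ev1 ev2] obtain n0 where
    n0: "\<And>n. n \<ge> n0 \<Longrightarrow> energy (u n) (v n) R < - \<eta>" "\<And>n. n \<ge> n0 \<Longrightarrow> e n < c"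
    unfolding eventually_sequentially by auto
  have xR: "x n \<in> {0..R}" if n: "n \<ge> n0" for n
  proof (rule ccontr)
    assume "x n \<notin> {0..R}"
    then have "R \<le> x n" using x(1)[of n] by auto
    then have "energy (u n) (v n) (x n) < - \<eta>"
      using energy_antimono[OF s[of n] R(1), of "x n"] n0(1)[OF n] by linarith
    then have "F (u n (x n)) < - \<eta>"
      using zero_le_power2[of "v n (x n)"] unfolding energy_def by linarith
    moreover have "F (u n (x n)) > - \<eta>" using x(2)[of n] n0(2)[OF n] by (intro Fc) linarith
    ultimately show False by simp
  qed
  have "seq_compact {0..R}" by (intro compact_imp_seq_compact compact_Icc)
  then obtain y k where k: "y \<in> {0..R}" "strict_mono k" "((\<lambda>n. x (n + n0)) \<circ> k) \<longlonglongrightarrow> y"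
    by (rule seq_compactE[of _ "\<lambda>n. x (n + n0)"]) (use xR in auto)
  have kk: "strict_mono (\<lambda>n. k n + n0)" using k(2) by (simp add: strict_mono_def)
  have "(\<lambda>n. u (k n + n0) (x (k n + n0))) \<longlonglongrightarrow> U y"
  proof (rule rsol_converges_along[of N g "\<lambda>n. a (k n + n0)" "\<lambda>n. u (k n + n0)" "\<lambda>n. v (k n + n0)" M U])
    show "(\<lambda>n. u (k n + n0) r) \<longlonglongrightarrow> U r" if "r \<ge> 0" for r
      using LIMSEQ_subseq_LIMSEQ[OF lim(1)[OF that] kk] by (simp add: o_def)
    show "(\<lambda>n. x (k n + n0)) \<longlonglongrightarrow> y" using k(3) by (simp add: o_def)
  qed (rule s N2 g_cont g_bound x(1))+
  moreover have "(\<lambda>n. e (k n + n0)) \<longlonglongrightarrow> 0"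
    using LIMSEQ_subseq_LIMSEQ[OF e kk] by (simp add: o_def)
  ultimately have "U y \<le> 0"
    by (rule LIMSEQ_le) (use x(2) in blast)
  then show False using R(2)[of y] k(1) by simp
qed

text \<open>
  A zero of a nonnegative solution is a minimum, hence also a zero of the derivative.
\<close>
lemma ground_state_positive:
  assumes s1: "rsol N g a1 u1 v1" "\<And>t. 0 \<le> t \<Longrightarrow> u1 t > 0" "\<not> trapped u1 v1"
    and s: "rsol N g a u v" and a: "a > 0" and nn: "\<And>t. 0 \<le> t \<Longrightarrow> u t \<ge> 0"
  shows "0 \<le> t \<Longrightarrow> u t > 0"
proof (rule ccontr)
  assume t: "0 \<le> t" "\<not> u t > 0"
  have c0: "continuous_on {0..t} u" by (rule continuous_on_subset[OF rsol_D(4)[OF s]]) auto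
  obtain c where c: "0 < c" "c \<le> t" "u c = 0" "\<And>x. 0 \<le> x \<Longrightarrow> x < c \<Longrightarrow> u x > 0"
    by (rule first_zero[OF c0 t(1)]) (use t a rsol_D(1)[OF s] in auto)
  have "v c = 0"
    by (rule DERIV_local_min[OF rsol_D(5)[OF s c(1)] c(1)]) (use c(3) nn in \<open>auto simp: abs_if split: if_splits\<close>)
  then show False using no_dead_core[OF s1 s c(1) c(4) c(3)] by blast
qed

text \<open>
  Apply \<open>rsol_touching\<close> with T \<rightarrow> \<infinity> and e \<rightarrow> 0. Failure of its hypotheses for infinitely many n would give,
  in the limit, a nonnegative solution at the end a or an untrapped one at the end d. Otherwise the
  limit of the touching solutions is nonnegative because of e > 0 and untrapped by \<open>untrapped_limit\<close>.
\<close>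
theorem shooting:
  assumes s1: "rsol N g a1 u1 v1" "\<And>t. 0 \<le> t \<Longrightarrow> u1 t > 0" "\<not> trapped u1 v1"
    and ad: "0 < a" "a < d"
    and cross: "\<And>u v. rsol N g a u v \<Longrightarrow> \<exists>t\<ge>0. u t < 0"
    and trap: "\<And>u v. rsol N g d u v \<Longrightarrow> trapped u v"
  shows "\<exists>\<alpha>\<in>{a..d}. \<exists>u v. rsol N g \<alpha> u v \<and> (\<forall>t\<ge>0. u t > 0) \<and> \<not> trapped u v"
proof -
  let ?e = "\<lambda>n. 1 / real (Suc n)" and ?T = "\<lambda>n. real (Suc n)"
  let ?P = "\<lambda>n \<alpha> u v. rsol N g \<alpha> u v \<and> (\<forall>x\<in>{0..?T n}. u x \<ge> ?e n)"
  let ?Q = "\<lambda>n \<alpha> u v. rsol N g \<alpha> u v \<and> (\<exists>x\<in>{0..?T n}. u x \<le> ?e n)"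
  let ?A1 = "\<lambda>n. \<exists>\<alpha>\<in>{a..d}. \<exists>u v. ?P n \<alpha> u v \<and> ?Q n \<alpha> u v"
  let ?A2 = "\<lambda>n. \<exists>u v. ?P n a u v" and ?A3 = "\<lambda>n. \<exists>u v. ?Q n d u v"
  have alt: "?A1 n \<or> ?A2 n \<or> ?A3 n" for n
  proof (rule ccontr)
    assume no: "\<not> ?thesis"
    have "\<exists>\<alpha>\<in>{a..d}. \<exists>u v. rsol N g \<alpha> u v \<and> (\<forall>x\<in>{0..?T n}. u x \<ge> ?e n) \<and> (\<exists>x\<in>{0..?T n}. u x \<le> ?e n)"
    proof (rule rsol_touching[OF g_cont g_bound N2])
      show "\<exists>x\<in>{0..?T n}. u x < ?e n" if s: "rsol N g a u v" for u v
      proof (rule ccontr)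
        assume "\<not> ?thesis"
        then have "\<forall>x\<in>{0..?T n}. u x \<ge> ?e n" unfolding bex_simps not_less by blast
        with s no show False by blast
      qed
      show "\<forall>x\<in>{0..?T n}. u x > ?e n" if s: "rsol N g d u v" for u v
      proof (rule ccontr)
        assume "\<not> ?thesis"
        then have "\<exists>x\<in>{0..?T n}. u x \<le> ?e n" unfolding ball_simps not_less by blast
        with s no show False by blast
      qed
    qed (use ad in auto)
    then show False using no by blast
  qed
  have key: "\<exists>l U V. rsol N g l U V \<and> l \<in> {a..d} \<and> ((\<forall>n. \<alpha> n = \<alpha> 0) \<longrightarrow> l = \<alpha> 0) \<and>
      ((\<forall>n. ?P (m n) (\<alpha> n) (u n) (v n)) \<longrightarrow> (\<forall>t\<ge>0. U t \<ge> 0)) \<and>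
      ((\<forall>n. ?Q (m n) (\<alpha> n) (u n) (v n)) \<longrightarrow> \<not> trapped U V)"
    if m: "strict_mono m" and \<alpha>: "\<And>n. \<alpha> n \<in> {a..d}" and s: "\<And>n. rsol N g (\<alpha> n) (u n) (v n)"
    for m :: "nat \<Rightarrow> nat" and \<alpha> u v
  proof -
    have A: "\<bar>\<alpha> n\<bar> \<le> d" for n using \<alpha>[of n] ad by auto
    obtain k l U V where k: "strict_mono k" "(\<lambda>n. \<alpha> (k n)) \<longlonglongrightarrow> l" "rsol N g l U V"
      "\<And>x X. X \<longlonglongrightarrow> x \<Longrightarrow> (\<And>n. X n \<ge> 0) \<Longrightarrow> (\<lambda>n. u (k n) (X n)) \<longlonglongrightarrow> U x"
      "\<And>r. r \<ge> 0 \<Longrightarrow> (\<lambda>n. v (k n) r) \<longlonglongrightarrow> V r"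
      by (rule rsol_compactness[where a = \<alpha> and u = u and v = v, OF s N2 g_cont g_bound A]) blast
    have lim: "(\<lambda>n. u (k n) r) \<longlonglongrightarrow> U r" if "r \<ge> 0" for r using k(4)[of "\<lambda>_. r" r] that by simp
    have mk: "strict_mono (m \<circ> k)" using m k(1) by (rule strict_mono_o)
    have e0: "(\<lambda>n. ?e (m (k n))) \<longlonglongrightarrow> 0"
      using LIMSEQ_subseq_LIMSEQ[OF LIMSEQ_Suc[OF lim_1_over_n] mk] by (simp add: o_def)
    have "l \<in> {a..d}" by (rule closed_sequentially[OF closed_atLeastAtMost _ k(2)]) (use \<alpha> in blast)
    moreover have "l = \<alpha> 0" if "\<forall>n. \<alpha> n = \<alpha> 0"
    proof -
      have eq0: "(\<lambda>n. \<alpha> (k n)) = (\<lambda>n. \<alpha> 0)" using that by blast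
      have "(\<lambda>n. \<alpha> 0) \<longlonglongrightarrow> l" using k(2) unfolding eq0 .
      then show ?thesis by (rule LIMSEQ_unique[OF _ tendsto_const])
    qed
    moreover have "U t \<ge> 0" if P: "\<forall>n. ?P (m n) (\<alpha> n) (u n) (v n)" and t: "t \<ge> 0" for t
    proof (rule LIMSEQ_le_const[OF lim[OF t]])
      obtain n0 :: nat where n0: "t \<le> real n0" using real_arch_simple by blast
      show "\<exists>n0. \<forall>n\<ge>n0. 0 \<le> u (k n) t"
      proof (intro exI[of _ n0] allI impI)
        fix n assume n: "n \<ge> n0"
        have "n \<le> m (k n)" using seq_suble[OF mk, of n] by simp
        then have "t \<in> {0..?T (m (k n))}" using n n0 t by simp
        then have "?e (m (k n)) \<le> u (k n) t" using P by blast
        moreover have "?e (m (k n)) > 0" by simp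
        ultimately show "0 \<le> u (k n) t" by linarith
      qed
    qed
    moreover have "\<not> trapped U V" if Q: "\<forall>n. ?Q (m n) (\<alpha> n) (u n) (v n)"
    proof -
      have "\<forall>n. \<exists>x. x \<ge> 0 \<and> u (k n) x \<le> ?e (m (k n))" using Q by force
      from choice[OF this] obtain x where x: "\<And>n. x n \<ge> 0" "\<And>n. u (k n) (x n) \<le> ?e (m (k n))" by blast
      show ?thesis
        by (rule untrapped_limit[where u = "\<lambda>n. u (k n)" and v = "\<lambda>n. v (k n)", OF s k(3) lim k(5) x e0])
    qed
    ultimately show ?thesis using k(3) by blast
  qed
  have eq: "{n. ?A1 n} \<union> {n. ?A2 n} \<union> {n. ?A3 n} = UNIV" using alt by blast
  have "infinite ({n. ?A1 n} \<union> {n. ?A2 n} \<union> {n. ?A3 n})" unfolding eq by simp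
  then consider "infinite {n. ?A1 n}" | "infinite {n. ?A2 n}" | "infinite {n. ?A3 n}"
    unfolding finite_Un by blast
  then show ?thesis
  proof cases
    case 1
    obtain m :: "nat \<Rightarrow> nat" where m: "strict_mono m" "\<And>n. ?A1 (m n)" using infinite_enumerate[OF 1] by blast
    have "\<forall>n. \<exists>\<alpha> u v. \<alpha> \<in> {a..d} \<and> ?P (m n) \<alpha> u v \<and> ?Q (m n) \<alpha> u v"
    proof
      fix n
      from m(2)[of n] obtain \<alpha> u v where "\<alpha> \<in> {a..d}" "?P (m n) \<alpha> u v \<and> ?Q (m n) \<alpha> u v" by blast
      then show "\<exists>\<alpha> u v. \<alpha> \<in> {a..d} \<and> ?P (m n) \<alpha> u v \<and> ?Q (m n) \<alpha> u v"
        by (intro exI[of _ \<alpha>] exI[of _ u] exI[of _ v] conjI[of "\<alpha> \<in> {a..d}"])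
    qed
    from choice2[OF this] obtain \<alpha> u where
      "\<forall>n. \<exists>v. \<alpha> n \<in> {a..d} \<and> ?P (m n) (\<alpha> n) (u n) v \<and> ?Q (m n) (\<alpha> n) (u n) v" by (elim exE)
    from choice[OF this] obtain v where q: "\<And>n. \<alpha> n \<in> {a..d}" "\<And>n. ?P (m n) (\<alpha> n) (u n) (v n)"
      "\<And>n. ?Q (m n) (\<alpha> n) (u n) (v n)" by blast
    have qs: "rsol N g (\<alpha> n) (u n) (v n)" for n using q(2)[of n] by blast
    obtain l U V where L0: "rsol N g l U V" "l \<in> {a..d}"
      and i: "(\<forall>n. ?P (m n) (\<alpha> n) (u n) (v n)) \<longrightarrow> (\<forall>t\<ge>0. U t \<ge> 0)"
      and j: "(\<forall>n. ?Q (m n) (\<alpha> n) (u n) (v n)) \<longrightarrow> \<not> trapped U V"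
      using key[where \<alpha> = \<alpha> and u = u and v = v,
        OF m(1) q(1) qs] by (elim exE conjE)
    have L: "rsol N g l U V" "l \<in> {a..d}" "\<forall>t\<ge>0. U t \<ge> 0" "\<not> trapped U V"
      using L0 mp[OF i allI[OF q(2)]] mp[OF j allI[OF q(3)]] by blast+
    have l0: "l > 0" using L(2) ad by simp
    have "U t > 0" if "t \<ge> 0" for t
      using ground_state_positive[OF s1 L(1) l0 _ that] L(3) by blast
    then show ?thesis using L by blast
  next
    case 2
    obtain m :: "nat \<Rightarrow> nat" where m: "strict_mono m" "\<And>n. ?A2 (m n)" using infinite_enumerate[OF 2] by blast
    have "\<forall>n. \<exists>u v. ?P (m n) a u v" using m(2) by simp
    from choice2[OF this] obtain u v where q: "\<And>n. ?P (m n) a (u n) (v n)" by blast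
    have qs: "rsol N g a (u n) (v n)" for n using q[of n] by blast
    have a: "a \<in> {a..d}" using ad by simp
    obtain l U V where L0: "rsol N g l U V" and l: "(\<forall>n::nat. a = a) \<longrightarrow> l = a"
      and i: "(\<forall>n. ?P (m n) a (u n) (v n)) \<longrightarrow> (\<forall>t\<ge>0. U t \<ge> 0)"
      using key[where \<alpha> = "\<lambda>n. a" and u = u and v = v, OF m(1) a qs]
      by (elim exE conjE)
    have L: "rsol N g a U V" "\<forall>t\<ge>0. U t \<ge> 0"
      using L0 l mp[OF i allI[OF q]] by simp_all
    then show ?thesis using cross[OF L(1)] by force
  next
    case 3
    obtain m :: "nat \<Rightarrow> nat" where m: "strict_mono m" "\<And>n. ?A3 (m n)" using infinite_enumerate[OF 3] by blast
    have "\<forall>n. \<exists>u v. ?Q (m n) d u v" using m(2) by simp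
    from choice2[OF this] obtain u v where q: "\<And>n. ?Q (m n) d (u n) (v n)" by blast
    have qs: "rsol N g d (u n) (v n)" for n using q[of n] by blast
    have d: "d \<in> {a..d}" using ad by simp
    obtain l U V where L0: "rsol N g l U V" and l: "(\<forall>n::nat. d = d) \<longrightarrow> l = d"
      and j: "(\<forall>n. ?Q (m n) d (u n) (v n)) \<longrightarrow> \<not> trapped U V"
      using key[where \<alpha> = "\<lambda>n. d" and u = u and v = v, OF m(1) d qs]
      by (elim exE conjE)
    have "rsol N g d U V" "\<not> trapped U V"
      using L0 l mp[OF j allI[OF q]] by simp_all
    then show ?thesis using trap by blast
  qed
qed

end

section \<open>Passage through a region of large nonlinearity\<close>

context nonlinearity
begin

lemma trapped_at_positive_time:
  assumes s: "rsol N g a u v" and "trapped u v"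
  obtains R where "R > 0" "\<And>r. 0 \<le> r \<Longrightarrow> r \<le> R \<Longrightarrow> u r > 0" "energy u v R < 0"
proof -
  obtain R0 where R0: "R0 \<ge> 0" "\<And>r. r \<in> {0..R0} \<Longrightarrow> u r > 0" "energy u v R0 < 0"
    using assms(2) unfolding trapped_def by blast
  show thesis
  proof (cases "R0 = 0")
    case False
    then show thesis using R0 by (intro that[of R0]) auto
  next
    case True
    have "(u \<longlongrightarrow> u 0) (at 0 within {0..})"
      using rsol_D(4)[OF s] unfolding continuous_on_def by force
    then have "\<forall>\<^sub>F x in at 0 within {0..}. 0 < u x" using R0(2)[of 0] R0(1) by (intro order_tendstoD(1)) auto
    then obtain d where d: "d > 0" "\<And>x. x \<ge> 0 \<Longrightarrow> x \<noteq> 0 \<Longrightarrow> x < d \<Longrightarrow> 0 < u x"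
      unfolding eventually_at by (auto simp: dist_real_def)
    show thesis
    proof (rule that[of "d / 2"])
      show "u r > 0" if "0 \<le> r" "r \<le> d / 2" for r
        using d(2)[of r] that d(1) R0(2)[of 0] R0(1) by (cases "r = 0") auto
      show "energy u v (d / 2) < 0"
        using energy_antimono[OF s, of 0 "d / 2"] d(1) R0(3) True by simp
    qed (use d in simp)
  qed
qed

end

context free_solution
begin

text \<open>
  After passing the level \<alpha>, a return above it would require a minimum x in between. If u x > 0, the
  derivative could not vanish there by \<open>descent\<close>; if u x \<le> 0, the energy at x is 0, less than what values
  above \<beta> require.
\<close>
lemma stays_below:
  assumes \<alpha>: "\<beta> < \<alpha>" "\<alpha> < a" and t: "r \<alpha> \<le> t"
  shows "u t \<le> \<alpha>"
proof (rule ccontr)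
  assume nt: "\<not> u t \<le> \<alpha>"
  have \<alpha>0: "0 < \<alpha>" using \<alpha> b_pos b_less by simp
  have L: "\<alpha> \<in> lev" by (rule all_levels[OF \<alpha>0 \<alpha>(2)])
  let ?\<rho> = "r \<alpha>"
  have \<rho>: "?\<rho> > 0" "u ?\<rho> = \<alpha>" "v ?\<rho> < 0" using r_pos[OF L] u_r[OF L] desc_neg[OF r_desc[OF L]] by auto
  have "compact {?\<rho>..t}" "{?\<rho>..t} \<noteq> {}" using t by auto
  then obtain x where x: "x \<in> {?\<rho>..t}" "\<And>y. y \<in> {?\<rho>..t} \<Longrightarrow> u x \<le> u y"
    using continuous_attains_inf[of "{?\<rho>..t}" u] continuous_on_subset[OF u_cont] \<rho> by force
  have xt: "x \<noteq> t" using x(2)[of ?\<rho>] nt \<rho> t by auto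
  have x\<rho>: "x \<noteq> ?\<rho>"
  proof
    assume eq: "x = ?\<rho>"
    obtain t' where t': "?\<rho> < t'" "t' \<in> desc v" by (rule desc_open[OF r_desc[OF L]])
    have "u (min t t') < u ?\<rho>"
      using t' t xt eq \<rho> by (intro u_decreasing desc_down[OF t'(2)]) (auto simp: min_def)
    moreover have "u x \<le> u (min t t')" using t' t by (intro x(2)) auto
    ultimately show False using eq by simp
  qed
  have xi: "?\<rho> < x" "x < t" using x(1) xt x\<rho> by auto
  have x0: "0 < x" using xi \<rho> by simp
  define e where "e = min (x - ?\<rho>) (t - x)"
  have e: "e > 0" using xi unfolding e_def by simp
  have vx: "v x = 0"
    by (rule DERIV_local_min[OF u_deriv[OF x0] e]) (auto simp: e_def intro!: x(2))
  show False
  proof (cases "u x > 0")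
    case True
    have up: "u y > 0" if "0 \<le> y" "y \<le> x" for y
    proof (cases "y < ?\<rho>")
      case True
      then show ?thesis using u_decreasing[OF r_desc[OF L] that(1) True] \<rho> \<alpha>0 by simp
    next
      case False
      then show ?thesis using x(2)[of y] that xi \<open>u x > 0\<close> by auto
    qed
    have "v x < 0"
      by (rule descent[OF sol, of x]) (use up energy_nonneg_if_pos[of x] x0 in auto)
    then show False using vx by simp
  next
    case False
    then have "energy u v x = 0" using vx F_zero by (simp add: energy_def)
    then have "energy u v t \<le> 0" using energy_antimono[OF sol, of x t] xi x0 by simp
    moreover have "F (u t) > 0" using nt \<alpha> by (intro F_pos) simp
    ultimately show False using zero_le_power2[of "v t"] unfolding energy_def by linarith
  qed
qed

text \<open>
  Let \<sigma> be the radius at the level s = \<alpha> + 2 \<epsilon>. Above s the nonlinearity lies between m K and Mb K, so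
  the solution lies between two parabolas: \<sigma>^2 is of the order \<delta>/K, and A = \<sigma> (- v \<sigma>) is of the order
  \<delta>. From s to \<alpha> it is only known that the flux increases in absolute value, so the solution falls at least as fast as
  the harmonic function with the flux \<Phi> = \<sigma>^(N-2) A. As the drop 2 \<epsilon> is small compared with A, the
  radius \<rho> at the level \<alpha> is at most 2 \<sigma>, and the estimates at \<sigma> carry over to \<rho>.
\<close>
lemma steep_passage:
  fixes \<alpha> \<delta> \<epsilon> m Mb K :: real
  assumes a: "a = \<alpha> + \<delta>" and \<alpha>: "\<beta> < \<alpha>" and \<delta>: "\<delta> > 0" and \<epsilon>: "\<epsilon> > 0" "2 * \<epsilon> \<le> \<delta> / 2"
      "2 * \<epsilon> * (real N - 2) \<le> \<delta> * m / (2 * Mb)"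
    and m: "0 < m" "m \<le> Mb" and K: "K > 0"
    and low: "\<And>s. \<alpha> + 2 * \<epsilon> \<le> s \<Longrightarrow> m * K \<le> g s" and up: "\<And>s. \<alpha> \<le> s \<Longrightarrow> g s \<le> Mb * K"
  shows "\<alpha> \<in> lev" "(r \<alpha>)\<^sup>2 \<le> 8 * real N * \<delta> / (m * K)"
    "m * \<delta> / (2 * Mb) \<le> r \<alpha> * p \<alpha>" "r \<alpha> * p \<alpha> \<le> 8 * Mb * \<delta> / m"
proof -
  have N0: "real N > 0" "real N - 2 > 0" using N3 by auto
  have Mb: "Mb > 0" using m by simp
  define s where "s = \<alpha> + 2 * \<epsilon>"
  have s: "\<alpha> < s" "s < a" using a \<epsilon> \<delta> unfolding s_def by auto
  have L: "\<alpha> \<in> lev" and Ls: "s \<in> lev"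
    using \<alpha> s b_pos b_less by (auto intro!: all_levels)
  then show "\<alpha> \<in> lev" by simp
  define \<sigma> where "\<sigma> = r s"
  define \<rho> where "\<rho> = r \<alpha>"
  have \<sigma>: "\<sigma> > 0" "u \<sigma> = s" "\<sigma> \<in> desc v" unfolding \<sigma>_def using r_pos[OF Ls] u_r[OF Ls] r_desc[OF Ls] by auto
  have \<rho>: "\<rho> > 0" "u \<rho> = \<alpha>" "\<rho> \<in> desc v" unfolding \<rho>_def using r_pos[OF L] u_r[OF L] r_desc[OF L] by auto
  have \<sigma>\<rho>: "\<sigma> < \<rho>" unfolding \<sigma>_def \<rho>_def by (rule r_less[OF L Ls s(1)])
  have us: "s \<le> u x" if "0 < x" "x < \<sigma>" for x using u_decreasing[OF \<sigma>(3), of x] that \<sigma>(2) by simp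
  have ua: "\<alpha> \<le> u x" if "0 < x" "x < \<rho>" for x using u_decreasing[OF \<rho>(3), of x] that \<rho>(2) by simp
  have lo: "v \<sigma> \<le> - (m * K / real N) * \<sigma>" "s \<le> a - m * K / (2 * real N) * \<sigma>\<^sup>2"
    using below_parabola[OF sol N2 \<sigma>(1), of "m * K"] low us \<sigma>(2) unfolding s_def by auto
  have hi: "v \<rho> \<ge> - (Mb * K / real N) * \<rho>" using above_parabola(1)[OF sol N2 \<rho>(1), of "Mb * K"] up ua by auto
  have hi': "s \<ge> a - Mb * K / (2 * real N) * \<sigma>\<^sup>2"
    using above_parabola(2)[OF sol N2 \<sigma>(1), of "Mb * K"] up us s \<sigma>(2) by force
  have as: "\<delta> / 2 \<le> a - s" "a - s \<le> \<delta>" using a \<epsilon> unfolding s_def by auto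
  have \<sigma>2: "m * K * \<sigma>\<^sup>2 \<le> 2 * real N * \<delta>"
  proof -
    have "m * K / (2 * real N) * \<sigma>\<^sup>2 \<le> \<delta>" using lo(2) as by simp
    then show ?thesis using N0 by (simp add: field_simps)
  qed
  have \<sigma>2': "real N * \<delta> \<le> Mb * K * \<sigma>\<^sup>2"
  proof -
    have "\<delta> / 2 \<le> Mb * K / (2 * real N) * \<sigma>\<^sup>2" using hi' as by simp
    then show ?thesis using N0 by (simp add: field_simps)
  qed
  define A where "A = \<sigma> * (- v \<sigma>)"
  have A: "m * \<delta> / Mb \<le> A"
  proof -
    have "\<sigma> * (m * K / real N * \<sigma>) \<le> \<sigma> * (- v \<sigma>)"
      using lo(1) \<sigma>(1) by (intro mult_left_mono) auto
    then have "m * K / real N * \<sigma> * \<sigma> \<le> A" unfolding A_def by (simp only: mult.commute)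
    moreover have "m * \<delta> / Mb \<le> m * K / real N * \<sigma> * \<sigma>"
    proof -
      have "m * (real N * \<delta>) \<le> m * (Mb * K * \<sigma>\<^sup>2)" using \<sigma>2' m by (intro mult_left_mono) auto
      then show ?thesis using N0 Mb by (simp add: field_simps power2_eq_square)
    qed
    ultimately show ?thesis by linarith
  qed
  have "m * \<delta> / Mb > 0" using m \<delta> Mb by simp
  then have A0: "A > 0" using A by linarith
  have NN: "N - 1 = Suc (N - 2)" "N - 2 \<ge> 1" "real (N - 2) = real N - 2" using N3 by auto
  define \<Phi> where "\<Phi> = \<sigma> ^ (N - 2) * A"
  have \<Phi>: "\<Phi> = - (\<sigma> ^ (N - 1) * v \<sigma>)" unfolding \<Phi>_def A_def NN(1) by simp
  have flux_le: "t ^ (N - 1) * v t \<le> - \<Phi>" if t: "\<sigma> \<le> t" "t \<le> \<rho>" for t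
  proof (cases "t = \<sigma>")
    case False
    have "t ^ (N - 1) * v t < \<sigma> ^ (N - 1) * v \<sigma>"
    proof (rule flux_decreasing[OF sol])
      fix x assume "\<sigma> < x" "x < t"
      then show "b < u x" using ua[of x] t \<sigma> \<alpha> b_less by simp
    qed (use t False \<sigma> in auto)
    then show ?thesis using \<Phi> by simp
  qed (simp add: \<Phi>)
  have "\<alpha> - \<Phi> / (real N - 2) * inverse (\<rho> ^ (N - 2)) \<le> s - \<Phi> / (real N - 2) * inverse (\<sigma> ^ (N - 2))"
  proof -
    have "u \<rho> - \<Phi> / (real N - 2) * inverse (\<rho> ^ (N - 2)) \<le> u \<sigma> - \<Phi> / (real N - 2) * inverse (\<sigma> ^ (N - 2))"
    proof (rule DERIV_nonpos_imp_nonincreasing[of \<sigma> \<rho> "\<lambda>t. u t - \<Phi> / (real N - 2) * inverse (t ^ (N - 2))"])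
      fix t assume t: "\<sigma> \<le> t" "t \<le> \<rho>"
      have tp: "t > 0" using t \<sigma> by simp
      have "((\<lambda>t. u t - \<Phi> / (real N - 2) * inverse (t ^ (N - 2))) has_real_derivative
          (v t - \<Phi> / (real N - 2) * (- (real N - 2) / t ^ (N - 1)))) (at t)"
        by (intro DERIV_diff u_deriv[OF tp] DERIV_cmult inverse_power_deriv[OF tp N3])
      moreover have "v t - \<Phi> / (real N - 2) * (- (real N - 2) / t ^ (N - 1)) = (t ^ (N - 1) * v t + \<Phi>) / t ^ (N - 1)"
        using tp N0 by (simp add: field_simps)
      moreover have "(t ^ (N - 1) * v t + \<Phi>) / t ^ (N - 1) \<le> 0"
        using flux_le[OF t] tp by (intro divide_nonpos_pos) auto
      ultimately show "\<exists>y. ((\<lambda>t. u t - \<Phi> / (real N - 2) * inverse (t ^ (N - 2))) has_real_derivative y) (at t) \<and> y \<le> 0"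
        by (intro exI[of _ "(t ^ (N - 1) * v t + \<Phi>) / t ^ (N - 1)"]) simp
    qed (use \<sigma>\<rho> in simp)
    then show ?thesis using \<sigma> \<rho> by simp
  qed
  then have "\<Phi> / (real N - 2) * (inverse (\<sigma> ^ (N - 2)) - inverse (\<rho> ^ (N - 2))) \<le> 2 * \<epsilon>"
    unfolding s_def by (simp add: algebra_simps)
  then have "\<Phi> * (inverse (\<sigma> ^ (N - 2)) - inverse (\<rho> ^ (N - 2))) \<le> 2 * \<epsilon> * (real N - 2)"
    using N0 by (simp add: pos_divide_le_eq)
  also have "\<dots> \<le> \<delta> * m / (2 * Mb)" by (rule \<epsilon>(3))
  also have "\<dots> \<le> A / 2" using A by (simp add: field_simps)
  finally have half: "\<Phi> * (inverse (\<sigma> ^ (N - 2)) - inverse (\<rho> ^ (N - 2))) \<le> A / 2" .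
  define q where "q = \<sigma> ^ (N - 2) / \<rho> ^ (N - 2)"
  have "\<Phi> * (inverse (\<sigma> ^ (N - 2)) - inverse (\<rho> ^ (N - 2))) = A * (1 - q)"
    unfolding \<Phi>_def q_def using \<sigma>(1) by (simp add: field_simps)
  then have "A * (1 - q) \<le> A * (1 / 2)" using half by simp
  then have q: "1 / 2 \<le> q" using A0 by simp
  have \<rho>\<sigma>: "\<rho> \<le> 2 * \<sigma>"
  proof -
    have "(\<rho> / \<sigma>) ^ 1 \<le> (\<rho> / \<sigma>) ^ (N - 2)" using \<sigma>\<rho> \<sigma> NN by (intro power_increasing) auto
    also have "\<dots> = 1 / q" unfolding q_def by (simp add: power_divide)
    also have "\<dots> \<le> 2" using q by (simp add: divide_le_eq)
    finally show ?thesis using \<sigma> by (simp add: divide_le_eq)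
  qed
  have \<rho>2: "\<rho>\<^sup>2 \<le> 4 * \<sigma>\<^sup>2"
  proof -
    have "\<rho>\<^sup>2 \<le> (2 * \<sigma>)\<^sup>2" using \<rho>\<sigma> \<rho> by (intro power_mono) auto
    then show ?thesis by (simp add: power_mult_distrib)
  qed
  have mK: "m * K > 0" using m K by simp
  have \<rho>3: "m * K * \<rho>\<^sup>2 \<le> 8 * real N * \<delta>"
  proof -
    have "m * K * \<rho>\<^sup>2 \<le> m * K * (4 * \<sigma>\<^sup>2)" using \<rho>2 mK by (intro mult_left_mono) auto
    then show ?thesis using \<sigma>2 by simp
  qed
  then show "(r \<alpha>)\<^sup>2 \<le> 8 * real N * \<delta> / (m * K)"
    using mK unfolding \<rho>_def by (simp add: pos_le_divide_eq mult.commute)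
  have P: "p \<alpha> = - v \<rho>" by (simp add: slope_def \<rho>_def)
  have "\<sigma> ^ (N - 2) * A \<le> \<rho> ^ (N - 2) * (\<rho> * p \<alpha>)"
    using flux_le[of \<rho>] \<sigma>\<rho> unfolding P \<Phi>_def NN(1) by (simp add: algebra_simps)
  then have "q * A \<le> \<rho> * p \<alpha>" unfolding q_def using \<rho>(1) by (simp add: divide_le_eq mult.commute)
  moreover have "1 / 2 * A \<le> q * A" using q A0 by (intro mult_right_mono) auto
  ultimately have "A / 2 \<le> \<rho> * p \<alpha>" by simp
  then show "m * \<delta> / (2 * Mb) \<le> r \<alpha> * p \<alpha>" using A unfolding \<rho>_def by (simp add: field_simps)
  have "\<rho> * p \<alpha> \<le> \<rho> * (Mb * K / real N * \<rho>)" using hi \<rho>(1) unfolding P by (intro mult_left_mono) auto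
  also have "\<dots> = Mb / (m * real N) * (m * K * \<rho>\<^sup>2)" using m by (simp add: power2_eq_square field_simps)
  also have "\<dots> \<le> Mb / (m * real N) * (8 * real N * \<delta>)" using \<rho>3 Mb m N0 by (intro mult_left_mono) auto
  also have "\<dots> = 8 * Mb * \<delta> / m" using N0 by simp
  finally show "r \<alpha> * p \<alpha> \<le> 8 * Mb * \<delta> / m" unfolding \<rho>_def .
qed

end

section \<open>Reduction to a smaller initial value\<close>

text \<open>
  Nonpositive values for infinitely many n would accumulate, by convergence along convergent radii, at a
  nonpositive value of the limit.
\<close>
lemma eventually_positive_on:
  assumes G: "\<And>n. continuous_on {0..} (G n)" "\<And>n \<tau>. \<tau> \<ge> 0 \<Longrightarrow> \<bar>G n \<tau>\<bar> \<le> M" and N: "2 \<le> N"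
    and u: "\<And>r. r \<ge> 0 \<Longrightarrow> (\<lambda>n. pos N (a n) (G n) r) \<longlonglongrightarrow> u r"
    and up: "\<And>r. 0 \<le> r \<Longrightarrow> r \<le> R \<Longrightarrow> u r > 0"
  shows "\<forall>\<^sub>F n in sequentially. \<forall>t\<in>{0..R}. pos N (a n) (G n) t > 0"
proof (rule ccontr)
  assume "\<not> ?thesis"
  then have inf: "infinite {n. \<not> (\<forall>t\<in>{0..R}. pos N (a n) (G n) t > 0)}"
    unfolding cofinite_eq_sequentially[symmetric] eventually_cofinite .
  from infinite_enumerate[OF inf]
  obtain m :: "nat \<Rightarrow> nat" where m: "strict_mono m" "\<forall>n. m n \<in> {n. \<not> (\<forall>t\<in>{0..R}. pos N (a n) (G n) t > 0)}"
    by (elim exE conjE)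
  have "\<forall>n. \<exists>t. t \<in> {0..R} \<and> pos N (a (m n)) (G (m n)) t \<le> 0"
  proof
    fix n
    have "\<not> (\<forall>t\<in>{0..R}. pos N (a (m n)) (G (m n)) t > 0)" using m(2) by simp
    then obtain t where "t \<in> {0..R}" "\<not> pos N (a (m n)) (G (m n)) t > 0" unfolding Ball_def not_all not_imp by (elim exE conjE)
    then show "\<exists>t. t \<in> {0..R} \<and> pos N (a (m n)) (G (m n)) t \<le> 0" by (intro exI[of _ t]) simp
  qed
  from choice[OF this] obtain t where t: "\<And>n. t n \<in> {0..R}" "\<And>n. pos N (a (m n)) (G (m n)) (t n) \<le> 0" by blast
  have "seq_compact {0..R}" by (intro compact_imp_seq_compact compact_Icc)
  then obtain y k where k: "y \<in> {0..R}" "strict_mono k" "(t \<circ> k) \<longlonglongrightarrow> y"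
    by (rule seq_compactE[of _ t]) (use t in auto)
  have mk: "strict_mono (\<lambda>n. m (k n))" using m(1) k(2) by (simp add: strict_mono_def)
  have "(\<lambda>n. pos N (a (m (k n))) (G (m (k n))) (t (k n))) \<longlonglongrightarrow> u y"
  proof (rule pos_converges_along[where G = "\<lambda>n. G (m (k n))" and M = M and u = u and x = y])
    show "(\<lambda>n. pos N (a (m (k n))) (G (m (k n))) r) \<longlonglongrightarrow> u r" if "r \<ge> 0" for r
      using LIMSEQ_subseq_LIMSEQ[OF u[OF that] mk] by (simp add: o_def)
    show "(\<lambda>n. t (k n)) \<longlonglongrightarrow> y" using k(3) by (simp add: o_def)
    show "t (k n) \<ge> 0" for n using t(1)[of "k n"] by simp
  qed (use G N in auto)
  then have "u y \<le> 0" by (rule LIMSEQ_le_const2) (use t(2) in blast)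
  then show False using up[of y] k(1) by simp
qed

text \<open>
  From the radius of the level \<alpha> on, u solves the equation with g0. The radial function built from the
  right-hand side g0 (u t) and regular at the origin solves the same linear equation there, so the difference is a constant plus a
  multiple of t^(2-N). Matching value and derivative at the level \<alpha> determines the constant, absorbed into
  z0, and the multiple \<Psi>. The contribution of the interval up to the level \<alpha> is of the order of the
  square of its length.
\<close>
lemma (in free_solution) harmonic_remainder:
  assumes g0: "continuous_on UNIV g0" "\<And>s. \<bar>g0 s\<bar> \<le> M0" and agree: "\<And>s. s \<le> \<alpha> \<Longrightarrow> g s = g0 s"
    and \<alpha>: "\<beta> < \<alpha>" "\<alpha> < a"
  defines "G \<equiv> \<lambda>t. g0 (u t)"
  shows "\<exists>z0 \<Psi>. (\<forall>t\<ge>r \<alpha>. u t = pos N z0 G t + \<Psi> / (real N - 2) * inverse (t ^ (N - 2)) \<and>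
                      v t = vel N G t - \<Psi> / t ^ (N - 1)) \<and>
      \<bar>z0 - (\<alpha> - r \<alpha> * p \<alpha> / (real N - 2))\<bar> \<le> 2 * M0 * (r \<alpha>)\<^sup>2 \<and>
      \<bar>\<Psi> - r \<alpha> ^ (N - 2) * (r \<alpha> * p \<alpha>)\<bar> \<le> r \<alpha> ^ (N - 2) * (M0 * (r \<alpha>)\<^sup>2)"
proof -
  have L: "\<alpha> \<in> lev" using \<alpha> b_pos b_less by (intro all_levels) auto
  define \<rho> where "\<rho> = r \<alpha>"
  have \<rho>: "\<rho> > 0" "u \<rho> = \<alpha>" "v \<rho> = - p \<alpha>" unfolding \<rho>_def slope_def using r_pos[OF L] u_r[OF L] by auto
  have c: "real N - 2 \<ge> 1" using N3 by simp
  have NN: "N - 1 = Suc (N - 2)" using N3 by simp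
  have G: "continuous_on {0..} G" unfolding G_def by (rule continuous_on_compose2[OF g0(1) u_cont]) auto
  have GM: "\<bar>G t\<bar> \<le> M0" for t unfolding G_def by (rule g0(2))
  let ?q = "vel N G \<rho>"
  have q: "\<bar>?q\<bar> \<le> M0 * \<rho>" by (rule abs_vel_le[OF G GM]) (use \<rho> in simp)
  have J: "\<bar>pos N 0 G \<rho>\<bar> \<le> M0 * \<rho>\<^sup>2"
    using pos_lipschitz[OF G GM N2, of \<rho> \<rho> 0 0] \<rho> by (simp add: power2_eq_square)
  define \<Psi> where "\<Psi> = \<rho> ^ (N - 1) * (p \<alpha> + ?q)"
  define z0 where "z0 = \<alpha> - \<rho> * (p \<alpha> + ?q) / (real N - 2) - pos N 0 G \<rho>"
  have vt: "v t = vel N G t - \<Psi> / t ^ (N - 1)" if t: "\<rho> \<le> t" for t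
  proof -
    have "t ^ (N - 1) * v t - t ^ (N - 1) * vel N G t = \<rho> ^ (N - 1) * v \<rho> - \<rho> ^ (N - 1) * vel N G \<rho>"
    proof (cases "t = \<rho>")
      case False
      then have lt: "\<rho> < t" using t by simp
      show ?thesis
      proof (rule DERIV_isconst2[where f = "\<lambda>t. t ^ (N - 1) * v t - t ^ (N - 1) * vel N G t", OF lt])
        show "continuous_on {\<rho>..t} (\<lambda>t. t ^ (N - 1) * v t - t ^ (N - 1) * vel N G t)"
          by (intro continuous_intros continuous_on_subset[OF v_cont] continuous_on_subset[OF vel_continuous[OF G N2]])
             (use \<rho> in auto)
        fix x assume x: "\<rho> < x" "x < t"
        have xp: "x > 0" using x \<rho> by simp
        have "((\<lambda>t. t ^ (N - 1) * v t - t ^ (N - 1) * vel N G t) has_real_derivative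
            (- (x ^ (N - 1) * g (u x)) - (- (x ^ (N - 1) * G x)))) (at x)"
          by (intro DERIV_diff flux_deriv[OF sol xp N2] flux_deriv_general[OF vel_deriv[OF G xp N2] xp N2])
        moreover have "g (u x) = G x"
          unfolding G_def by (rule agree, rule stays_below[OF \<alpha>]) (use x in \<open>simp add: \<rho>_def\<close>)
        ultimately show "((\<lambda>t. t ^ (N - 1) * v t - t ^ (N - 1) * vel N G t) has_real_derivative 0) (at x)" by simp
      qed (use t in auto)
    qed simp
    also have "\<dots> = - \<Psi>" unfolding \<Psi>_def \<rho>(3) by (simp add: algebra_simps)
    finally have eq: "t ^ (N - 1) * (v t - vel N G t) = - \<Psi>" by (simp add: right_diff_distrib)
    have gen: "d = T * d / T" if "T > 0" for T d :: real using that by simp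
    have "v t - vel N G t = (- \<Psi>) / t ^ (N - 1)"
      unfolding eq[symmetric] by (rule gen) (use t \<rho> in simp)
    then show ?thesis by simp
  qed
  have ut: "u t = pos N z0 G t + \<Psi> / (real N - 2) * inverse (t ^ (N - 2))" if t: "\<rho> \<le> t" for t
  proof -
    let ?f = "\<lambda>t. u t - pos N z0 G t - \<Psi> / (real N - 2) * inverse (t ^ (N - 2))"
    have der: "(?f has_real_derivative 0) (at x)" if x: "\<rho> \<le> x" for x
    proof -
      have xp: "x > 0" using x \<rho> by simp
      have "(?f has_real_derivative (v x - vel N G x - \<Psi> / (real N - 2) * (- (real N - 2) / x ^ (N - 1)))) (at x)"
        by (intro DERIV_diff u_deriv[OF xp] DERIV_cmult inverse_power_deriv[OF xp N3])
           (use pos_deriv[OF G N2, of x] xp in \<open>simp add: at_within_nonneg\<close>)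
      moreover have "v x - vel N G x - \<Psi> / (real N - 2) * (- (real N - 2) / x ^ (N - 1)) = 0"
      proof -
        have e: "\<Psi> / c' * (- c' / X) = - (\<Psi> / X)" if "c' \<noteq> 0" for c' X :: real using that by simp
        have "real N - 2 \<noteq> 0" using c by simp
        from e[OF this] show ?thesis unfolding vt[OF x] by simp
      qed
      ultimately show ?thesis by simp
    qed
    have "?f t = ?f \<rho>"
    proof (cases "t = \<rho>")
      case False
      then have lt: "\<rho> < t" using t by simp
      have "isCont ?f x" if "x \<in> {\<rho>..t}" for x using der[of x] that DERIV_isCont by auto
      then have cont: "continuous_on {\<rho>..t} ?f" by (intro continuous_at_imp_continuous_on) blast
      show ?thesis
        by (rule DERIV_isconst2[where f = ?f, OF lt cont]) (use der t in auto)
    qed simp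
    also have "?f \<rho> = 0"
    proof -
      have "\<Psi> * inverse (\<rho> ^ (N - 2)) = \<rho> * (p \<alpha> + ?q)" unfolding \<Psi>_def NN using \<rho>(1) by simp
      then have "\<Psi> / (real N - 2) * inverse (\<rho> ^ (N - 2)) = \<rho> * (p \<alpha> + ?q) / (real N - 2)" by simp
      moreover have "pos N z0 G \<rho> = z0 + pos N 0 G \<rho>" by (simp add: pos_def)
      ultimately show ?thesis using z0_def \<rho>(2) by linarith
    qed
    finally show ?thesis by simp
  qed
  have "\<bar>z0 - (\<alpha> - \<rho> * p \<alpha> / (real N - 2))\<bar> \<le> 2 * M0 * \<rho>\<^sup>2"
  proof -
    have "z0 - (\<alpha> - \<rho> * p \<alpha> / (real N - 2)) = - (\<rho> * ?q / (real N - 2)) - pos N 0 G \<rho>"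
      unfolding z0_def by (simp add: distrib_left add_divide_distrib)
    moreover have "\<bar>\<rho> * ?q / (real N - 2)\<bar> \<le> M0 * \<rho>\<^sup>2"
    proof -
      have "\<bar>\<rho> * ?q / (real N - 2)\<bar> = \<rho> * \<bar>?q\<bar> / (real N - 2)" using \<rho> c by (simp add: abs_mult abs_divide)
      also have "\<dots> \<le> \<rho> * \<bar>?q\<bar> / 1" using \<rho> c by (intro divide_left_mono) auto
      also have "\<dots> \<le> \<rho> * (M0 * \<rho>)" using q \<rho> by (simp add: mult_left_mono)
      finally show ?thesis by (simp add: power2_eq_square mult.left_commute)
    qed
    ultimately show ?thesis using J by linarith
  qed
  moreover have "\<bar>\<Psi> - \<rho> ^ (N - 2) * (\<rho> * p \<alpha>)\<bar> \<le> \<rho> ^ (N - 2) * (M0 * \<rho>\<^sup>2)"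
  proof -
    have "\<Psi> - \<rho> ^ (N - 2) * (\<rho> * p \<alpha>) = \<rho> ^ (N - 2) * (\<rho> * ?q)" unfolding \<Psi>_def NN by (simp add: algebra_simps)
    then have "\<bar>\<Psi> - \<rho> ^ (N - 2) * (\<rho> * p \<alpha>)\<bar> = \<rho> ^ (N - 2) * (\<rho> * \<bar>?q\<bar>)" using \<rho> by (simp add: abs_mult)
    also have "\<dots> \<le> \<rho> ^ (N - 2) * (\<rho> * (M0 * \<rho>))" using q \<rho> by (intro mult_left_mono) auto
    finally show ?thesis by (simp add: power2_eq_square mult.left_commute)
  qed
  ultimately show ?thesis using ut vt unfolding \<rho>_def by blast
qed

text \<open>
  By \<open>steep_passage\<close> the radii \<rho> n of the level \<alpha> tend to 0, while \<rho> n P n, the radius times the slope,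
  stays between positive constants c1 and c2. So in \<open>harmonic_remainder\<close> the multiples \<Psi> n tend to 0, and the
  initial values z0 n of the regular parts have limit points in the interval [\<alpha> - c2/(N-2), \<alpha> - c1/(N-2)],
  which lies in (0, \<alpha>). A limit of the regular parts is a solution z that starts in this interval, hence is
  trapped at some radius R. For large n the solution us n is then positive up to R, as \<Psi> n \<ge> 0, and has negative
  energy there, although it is untrapped.
\<close>
lemma (in nonlinearity) steep_sequence_absurd:
  fixes \<alpha> \<delta> m Mb :: real and gs :: "nat \<Rightarrow> real \<Rightarrow> real"
  assumes \<alpha>: "\<beta> < \<alpha>" and trap0: "\<And>l u v. 0 < l \<Longrightarrow> l < \<alpha> \<Longrightarrow> rsol N g l u v \<Longrightarrow> trapped u v"
    and \<delta>: "0 < \<delta>" and m: "0 < m" "m \<le> Mb" and small: "8 * Mb * \<delta> / m / (real N - 2) < \<alpha>"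
    and FS: "\<And>n. free_solution N (gs n) b \<beta> (Ms n) (\<alpha> + \<delta>) (us n) (vs n)"
    and agree: "\<And>n s. s \<le> \<alpha> \<Longrightarrow> gs n s = g s"
    and \<epsilon>: "\<And>n. \<epsilon> n > 0" "\<And>n. 2 * \<epsilon> n \<le> \<delta> / 2" "\<And>n. 2 * \<epsilon> n * (real N - 2) \<le> \<delta> * m / (2 * Mb)"
    and K: "\<And>n. K n \<ge> real (Suc n)"
    and low: "\<And>n s. \<alpha> + 2 * \<epsilon> n \<le> s \<Longrightarrow> m * K n \<le> gs n s" and up: "\<And>n s. \<alpha> \<le> s \<Longrightarrow> gs n s \<le> Mb * K n"
  shows False
proof -
  define c where "c = real N - 2"
  have c: "c \<ge> 1" using N3 unfolding c_def by simp
  have Mb: "Mb > 0" using m by simp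
  have M: "M \<ge> 0" using g_bound[of 0] by simp
  define \<rho> where "\<rho> n = rad (us n) (vs n) \<alpha>" for n
  define P where "P n = slope (us n) (vs n) \<alpha>" for n
  define G where "G n t = g (us n t)" for n t
  define c1 where "c1 = m * \<delta> / (2 * Mb)"
  define c2 where "c2 = 8 * Mb * \<delta> / m"
  define C where "C = 8 * real N * \<delta> / m"
  have c1: "c1 > 0" and c2: "c2 > 0" and C: "C > 0" unfolding c1_def c2_def C_def using m Mb \<delta> N3 by auto
  have K0: "K n > 0" for n using K[of n] by (simp add: order_less_le_trans)
  have ad: "\<alpha> < \<alpha> + \<delta>" using \<delta> by simp
  note SP = free_solution.steep_passage[OF FS refl \<alpha> \<delta> \<epsilon> m K0 low up]
  have RS: "radial_solution N (gs n) b \<beta> (Ms n) (\<alpha> + \<delta>) (us n) (vs n)" for n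
    using FS[of n] by (simp add: free_solution_def)
  have \<rho>0: "\<rho> n > 0" for n unfolding \<rho>_def by (rule radial_solution.r_pos[OF RS SP(1)])
  have \<rho>sq: "(\<rho> n)\<^sup>2 \<le> C / real (Suc n)" for n
  proof -
    have "(\<rho> n)\<^sup>2 \<le> 8 * real N * \<delta> / (m * K n)" unfolding \<rho>_def by (rule SP(2))
    also have "\<dots> = C / K n" unfolding C_def by simp
    also have "\<dots> \<le> C / real (Suc n)" using K[of n] C by (intro divide_left_mono) auto
    finally show ?thesis .
  qed
  have X1: "c1 \<le> \<rho> n * P n" for n unfolding c1_def \<rho>_def P_def by (rule SP(3))
  have X2: "\<rho> n * P n \<le> c2" for n unfolding c2_def \<rho>_def P_def by (rule SP(4))
  note X = X1 X2
  have \<rho>2: "(\<lambda>n. (\<rho> n)\<^sup>2) \<longlonglongrightarrow> 0"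
  proof (rule Lim_null_comparison)
    show "\<forall>\<^sub>F n in sequentially. norm ((\<rho> n)\<^sup>2) \<le> C / real (Suc n)" using \<rho>sq by simp
    show "(\<lambda>n. C / real (Suc n)) \<longlonglongrightarrow> 0"
      using tendsto_mult_right_zero[OF LIMSEQ_Suc[OF lim_1_over_n], of C] by simp
  qed
  have \<rho>l: "\<rho> \<longlonglongrightarrow> 0"
  proof -
    have "(\<lambda>n. sqrt ((\<rho> n)\<^sup>2)) \<longlonglongrightarrow> sqrt 0" by (intro tendsto_real_sqrt \<rho>2)
    moreover have "(\<lambda>n. sqrt ((\<rho> n)\<^sup>2)) = \<rho>" using \<rho>0 by (intro ext) (simp add: less_imp_le)
    ultimately show ?thesis by simp
  qed
  let ?H = "\<lambda>n z \<psi>. (\<forall>t\<ge>\<rho> n. us n t = pos N z (G n) t + \<psi> / (real N - 2) * inverse (t ^ (N - 2)) \<and>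
                      vs n t = vel N (G n) t - \<psi> / t ^ (N - 1)) \<and>
      \<bar>z - (\<alpha> - \<rho> n * P n / (real N - 2))\<bar> \<le> 2 * M * (\<rho> n)\<^sup>2 \<and>
      \<bar>\<psi> - \<rho> n ^ (N - 2) * (\<rho> n * P n)\<bar> \<le> \<rho> n ^ (N - 2) * (M * (\<rho> n)\<^sup>2)"
  have "\<forall>n. \<exists>z \<psi>. ?H n z \<psi>"
    unfolding \<rho>_def P_def G_def[abs_def]
    by (rule allI, rule free_solution.harmonic_remainder[OF FS g_cont g_bound agree \<alpha> ad])
  from choice2[OF this] obtain z0 \<Psi> where q: "\<forall>n. ?H n (z0 n) (\<Psi> n)" by (elim exE)
  have us: "us n t = pos N (z0 n) (G n) t + \<Psi> n / c * inverse (t ^ (N - 2))"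
    and vs: "vs n t = vel N (G n) t - \<Psi> n / t ^ (N - 1)" if "\<rho> n \<le> t" for n t
    using spec[OF q, of n] that unfolding c_def by blast+
  have z0: "\<bar>z0 n - (\<alpha> - \<rho> n * P n / c)\<bar> \<le> 2 * M * (\<rho> n)\<^sup>2" for n
    using spec[OF q, of n] unfolding c_def by blast
  have \<Psi>: "\<bar>\<Psi> n - \<rho> n ^ (N - 2) * (\<rho> n * P n)\<bar> \<le> \<rho> n ^ (N - 2) * (M * (\<rho> n)\<^sup>2)" for n
    using spec[OF q, of n] by blast
  have \<rho>N: "(\<lambda>n. \<rho> n ^ (N - 2)) \<longlonglongrightarrow> 0"
  proof -
    have "(\<lambda>n. \<rho> n ^ (N - 2)) \<longlonglongrightarrow> 0 ^ (N - 2)" by (intro tendsto_power \<rho>l)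
    moreover have "(0::real) ^ (N - 2) = 0" using N3 by (simp add: zero_power)
    ultimately show ?thesis by simp
  qed
  have \<Psi>l: "\<Psi> \<longlonglongrightarrow> 0"
  proof (rule Lim_null_comparison)
    have "\<bar>\<Psi> n\<bar> \<le> \<rho> n ^ (N - 2) * (c2 + M * (\<rho> n)\<^sup>2)" for n
    proof -
      have "\<rho> n ^ (N - 2) * (\<rho> n * P n) \<le> \<rho> n ^ (N - 2) * c2" using X(2)[of n] \<rho>0[of n] by (intro mult_left_mono) auto
      moreover have "0 \<le> \<rho> n * P n" using X(1)[of n] c1 by linarith
      then have "0 \<le> \<rho> n ^ (N - 2) * (\<rho> n * P n)" using \<rho>0[of n] by (intro mult_nonneg_nonneg[OF zero_le_power]) auto
      ultimately show ?thesis using \<Psi>[of n] by (simp add: distrib_left)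
    qed
    then show "\<forall>\<^sub>F n in sequentially. norm (\<Psi> n) \<le> \<rho> n ^ (N - 2) * (c2 + M * (\<rho> n)\<^sup>2)" by simp
    have "(\<lambda>n. \<rho> n ^ (N - 2) * (c2 + M * (\<rho> n)\<^sup>2)) \<longlonglongrightarrow> 0 * (c2 + M * 0)"
      by (intro tendsto_intros \<rho>N \<rho>2)
    then show "(\<lambda>n. \<rho> n ^ (N - 2) * (c2 + M * (\<rho> n)\<^sup>2)) \<longlonglongrightarrow> 0" by simp
  qed
  have z0le: "z0 n \<le> \<alpha> - c1 / c + 2 * M * (\<rho> n)\<^sup>2" and z0ge: "\<alpha> - c2 / c - 2 * M * (\<rho> n)\<^sup>2 \<le> z0 n" for n
  proof -
    have "c1 / c \<le> \<rho> n * P n / c" "\<rho> n * P n / c \<le> c2 / c" using X[of n] c by (auto intro!: divide_right_mono)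
    then show "z0 n \<le> \<alpha> - c1 / c + 2 * M * (\<rho> n)\<^sup>2" "\<alpha> - c2 / c - 2 * M * (\<rho> n)\<^sup>2 \<le> z0 n"
      using z0[of n] by linarith+
  qed
  have z0b: "\<bar>z0 n\<bar> \<le> \<bar>\<alpha>\<bar> + \<bar>c1 / c\<bar> + \<bar>c2 / c\<bar> + 2 * M * C" for n
  proof -
    have "C / real (Suc n) \<le> C / 1" using C by (intro divide_left_mono) auto
    then have "(\<rho> n)\<^sup>2 \<le> C" using \<rho>sq[of n] by simp
    then have "2 * M * (\<rho> n)\<^sup>2 \<le> 2 * M * C" using M by (intro mult_left_mono) auto
    then show ?thesis using z0le[of n] z0ge[of n] by linarith
  qed
  have Gc: "continuous_on {0..} (G n)" for n
    unfolding G_def[abs_def]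
    by (rule continuous_on_compose2[OF g_cont rsol_D(4)[OF radial_solution.sol[OF RS]]]) auto
  have GM: "\<bar>G n t\<bar> \<le> M" for n t unfolding G_def by (rule g_bound)
  obtain k :: "nat \<Rightarrow> nat" and z where k: "strict_mono k"
    "\<And>r. r \<ge> 0 \<Longrightarrow> (\<lambda>n. pos N (z0 (k n)) (G (k n)) r) \<longlonglongrightarrow> z r"
    by (rule pos_compactness[of G M N z0 "\<bar>\<alpha>\<bar> + \<bar>c1 / c\<bar> + \<bar>c2 / c\<bar> + 2 * M * C"]; (rule Gc GM N2 z0b | blast))
  have sub: "(\<lambda>n. X (k n)) \<longlonglongrightarrow> L" if "X \<longlonglongrightarrow> L" for X :: "nat \<Rightarrow> real" and L
    using LIMSEQ_subseq_LIMSEQ[OF that k(1)] by (simp add: o_def)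
  have ev\<rho>: "\<forall>\<^sub>F n in sequentially. \<rho> (k n) < t" if "t > 0" for t
    by (rule order_tendstoD(2)[OF sub[OF \<rho>l] that])
  have ul: "(\<lambda>n. us (k n) t) \<longlonglongrightarrow> z t" if t: "t > 0" for t
  proof -
    have "(\<lambda>n. pos N (z0 (k n)) (G (k n)) t + \<Psi> (k n) / c * inverse (t ^ (N - 2))) \<longlonglongrightarrow> z t + 0 / c * inverse (t ^ (N - 2))"
      by (intro tendsto_intros k(2) sub[OF \<Psi>l]) (use t c in auto)
    then have "(\<lambda>n. pos N (z0 (k n)) (G (k n)) t + \<Psi> (k n) / c * inverse (t ^ (N - 2))) \<longlonglongrightarrow> z t" by simp
    then show ?thesis
      by (rule Lim_transform_eventually) (use ev\<rho>[OF t] us in \<open>auto elim!: eventually_mono\<close>)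
  qed
  have lim: "(\<lambda>n. G (k n) t) \<longlonglongrightarrow> g (z t)" if "t > 0" for t
    unfolding G_def by (rule continuous_on_tendsto_compose[OF g_cont ul[OF that]]) auto
  define V where "V = vel N (\<lambda>r. g (z r))"
  have S: "rsol N g (z 0) z V" and vl: "\<And>t. t \<ge> 0 \<Longrightarrow> (\<lambda>n. vel N (G (k n)) t) \<longlonglongrightarrow> V t"
    unfolding V_def
    by (rule pos_limit_rsol[where G = "\<lambda>n. G (k n)" and a = "\<lambda>n. z0 (k n)" and M = M];
        (rule Gc GM N2 g_cont | erule k(2) lim | assumption))+
  have zl: "(\<lambda>n. z0 (k n)) \<longlonglongrightarrow> z 0" using k(2)[of 0] by simp
  have "z 0 \<le> \<alpha> - c1 / c + 2 * M * 0"
  proof (rule LIMSEQ_le[OF zl])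
    show "(\<lambda>n. \<alpha> - c1 / c + 2 * M * (\<rho> (k n))\<^sup>2) \<longlonglongrightarrow> \<alpha> - c1 / c + 2 * M * 0"
      by (intro tendsto_intros sub[OF \<rho>2])
  qed (use z0le in blast)
  then have z1: "z 0 < \<alpha>" using divide_pos_pos[OF c1, of c] c by simp
  have "\<alpha> - c2 / c - 2 * M * 0 \<le> z 0"
  proof (rule LIMSEQ_le[OF _ zl])
    show "(\<lambda>n. \<alpha> - c2 / c - 2 * M * (\<rho> (k n))\<^sup>2) \<longlonglongrightarrow> \<alpha> - c2 / c - 2 * M * 0"
      by (intro tendsto_intros sub[OF \<rho>2])
  qed (use z0ge in blast)
  then have z2: "0 < z 0" using small unfolding c2_def c_def by simp
  obtain R where R: "R > 0" "\<And>r. 0 \<le> r \<Longrightarrow> r \<le> R \<Longrightarrow> z r > 0" "energy z V R < 0"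
    using trapped_at_positive_time[OF S trap0[OF z2 z1 S]] by blast
  have "\<forall>\<^sub>F n in sequentially. \<forall>t\<in>{0..R}. pos N (z0 (k n)) (G (k n)) t > 0"
    by (rule eventually_positive_on[where G = "\<lambda>n. G (k n)" and M = M]; (rule Gc GM N2 | erule k(2) R(2) | assumption))
  moreover have "\<forall>\<^sub>F n in sequentially. energy (us (k n)) (vs (k n)) R < 0"
  proof -
    have "(\<lambda>n. F (us (k n) R)) \<longlonglongrightarrow> F (z R)"
      by (rule continuous_on_tendsto_compose[OF F_cont[of UNIV] ul[OF R(1)]]) auto
    moreover have "(\<lambda>n. vs (k n) R) \<longlonglongrightarrow> V R"
    proof -
      have "(\<lambda>n. vel N (G (k n)) R - \<Psi> (k n) / R ^ (N - 1)) \<longlonglongrightarrow> V R - 0 / R ^ (N - 1)"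
        by (intro tendsto_intros vl sub[OF \<Psi>l]) (use R in auto)
      then have "(\<lambda>n. vel N (G (k n)) R - \<Psi> (k n) / R ^ (N - 1)) \<longlonglongrightarrow> V R" by simp
      then show ?thesis
        by (rule Lim_transform_eventually) (use ev\<rho>[OF R(1)] vs in \<open>auto elim!: eventually_mono\<close>)
    qed
    ultimately have "(\<lambda>n. energy (us (k n)) (vs (k n)) R) \<longlonglongrightarrow> energy z V R"
      unfolding energy_def by (intro tendsto_intros) auto
    then show ?thesis by (rule order_tendstoD(2)) (rule R(3))
  qed
  moreover have "\<forall>\<^sub>F n in sequentially. M * (\<rho> (k n))\<^sup>2 < c1"
    by (rule order_tendstoD(2)[OF tendsto_mult_right_zero[OF sub[OF \<rho>2]] c1])
  ultimately have "\<forall>\<^sub>F n in sequentially. (\<forall>t\<in>{0..R}. pos N (z0 (k n)) (G (k n)) t > 0) \<and>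
      energy (us (k n)) (vs (k n)) R < 0 \<and> M * (\<rho> (k n))\<^sup>2 < c1 \<and> \<rho> (k n) < R"
    using ev\<rho>[OF R(1)] by (intro eventually_conj)
  from eventually_happens'[OF sequentially_bot this]
  obtain n where n: "\<forall>t\<in>{0..R}. pos N (z0 (k n)) (G (k n)) t > 0"
      "energy (us (k n)) (vs (k n)) R < 0" "M * (\<rho> (k n))\<^sup>2 < c1" "\<rho> (k n) < R"
    by (elim exE conjE)
  let ?j = "k n"
  interpret S: free_solution N "gs ?j" b \<beta> "Ms ?j" "\<alpha> + \<delta>" "us ?j" "vs ?j" by (rule FS)
  have L: "\<alpha> \<in> us ?j ` desc (vs ?j)" by (rule SP(1))
  have \<Psi>0: "\<Psi> ?j \<ge> 0"
  proof -
    have "\<rho> ?j ^ (N - 2) * (M * (\<rho> ?j)\<^sup>2) \<le> \<rho> ?j ^ (N - 2) * (\<rho> ?j * P ?j)"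
      using n(3) X(1)[of ?j] \<rho>0[of ?j] by (intro mult_left_mono) auto
    then show ?thesis using \<Psi>[of ?j] by linarith
  qed
  have up: "us ?j t > 0" if t: "0 \<le> t" "t \<le> R" for t
  proof (cases "t < \<rho> ?j")
    case True
    then have "us ?j (\<rho> ?j) < us ?j t"
      unfolding \<rho>_def using t by (intro S.u_decreasing[OF S.r_desc[OF L]]) auto
    then show ?thesis using S.u_r[OF L] \<alpha> b_pos b_less unfolding \<rho>_def by simp
  next
    case False
    then have le: "\<rho> ?j \<le> t" by simp
    have "\<Psi> ?j / c * inverse (t ^ (N - 2)) \<ge> 0" using \<Psi>0 c t by simp
    then show ?thesis using us[OF le] n(1) t by (simp add: add_pos_nonneg)
  qed
  have "S.energy (us ?j) (vs ?j) R \<ge> 0"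
    by (rule S.energy_nonneg_if_pos) (use R(1) up in auto)
  moreover have "S.energy (us ?j) (vs ?j) R = energy (us ?j) (vs ?j) R"
  proof -
    have le: "us ?j R \<le> \<alpha>" by (rule S.stays_below[OF \<alpha> ad]) (use n(4) in \<open>simp add: \<rho>_def\<close>)
    have "integral {0..us ?j R} (gs ?j) = integral {0..us ?j R} g"
    proof (rule Henstock_Kurzweil_Integration.integral_cong)
      fix x assume "x \<in> {0..us ?j R}"
      then have "x \<le> \<alpha>" using le by simp
      then show "gs ?j x = g x" by (rule agree)
    qed
    then show ?thesis unfolding S.energy_def energy_def primitive0_def by simp
  qed
  ultimately show False using n(2) by simp
qed

section \<open>From radial profiles to functions on Euclidean space\<close>

text \<open>
  For the origin, where the chain rule is of no use since the norm is not differentiable.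
\<close>
lemma has_derivative_at_via_bound:
  fixes f :: "'a::real_normed_vector \<Rightarrow> real"
  assumes D: "bounded_linear D" and c: "(c \<longlongrightarrow> 0) (at x)"
    and le: "\<And>y. y \<noteq> x \<Longrightarrow> \<bar>f y - f x - D (y - x)\<bar> \<le> c y * norm (y - x)"
  shows "(f has_derivative D) (at x)"
  unfolding has_derivative_iff_norm
proof (intro conjI D)
  show "((\<lambda>y. norm (f y - f x - D (y - x)) / norm (y - x)) \<longlongrightarrow> 0) (at x)"
  proof (rule Lim_null_comparison[OF _ c])
    show "\<forall>\<^sub>F y in at x. norm (norm (f y - f x - D (y - x)) / norm (y - x)) \<le> c y"
      unfolding eventually_at by (intro exI[of _ 1]) (use le in \<open>auto simp: divide_le_eq\<close>)
  qed
qed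

lemma norm_has_derivative_vec:
  fixes x :: "real ^ 'n"
  assumes "x \<noteq> 0"
  shows "(norm has_derivative (\<lambda>y. x \<bullet> y / norm x)) (at x)"
proof -
  have "(\<lambda>y. x \<bullet> y / norm x) = (\<lambda>y. y \<bullet> sgn x)"
    by (rule ext) (simp add: sgn_div_norm inner_commute divide_inverse)
  then show ?thesis using has_derivative_norm[OF assms] by simp
qed

lemma norm_tendsto_within: "filterlim norm (at 0 within {0::real..}) (at (0 :: 'a::real_normed_vector))"
  unfolding filterlim_at
proof
  show "\<forall>\<^sub>F x in at (0::'a). norm x \<in> {0..} \<and> norm x \<noteq> 0"
    unfolding eventually_at by (intro exI[of _ 1]) auto
  show "(norm \<longlongrightarrow> 0) (at (0::'a))" by (rule tendsto_norm_zero) (rule tendsto_ident_at)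
qed

definition radial_lift :: "(real \<Rightarrow> real) \<Rightarrow> real ^ 'n::finite \<Rightarrow> real" where
  "radial_lift u x = u (norm x)"

locale radial_profile =
  fixes N :: nat and g :: "real \<Rightarrow> real" and a :: real and u v :: "real \<Rightarrow> real"
  assumes N2: "2 \<le> N" and g_cont: "continuous_on UNIV g" and sol: "rsol N g a u v"
begin

abbreviation n where "n \<equiv> real N"
abbreviation w :: "real ^ 'n::finite \<Rightarrow> real" where "w \<equiv> radial_lift u"

text \<open>
  With h = v/r the gradient of the lift is h x and its Hessian is h I + A x x^T/|x|^2, where A = r h' = u'' - h;
  the equation turns u'' into - (N - 1) h - g u. The singular factor is harmless because A is continuous with
  A 0 = 0.
\<close>
definition h :: "real \<Rightarrow> real" where "h r = (if r = 0 then - g a / n else v r / r)"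
definition A :: "real \<Rightarrow> real" where "A r = - n * h r - g (u r)"

lemma n_pos: "n > 0" using N2 by simp

lemma vr: "v r = h r * r"
  using rsol_D(2)[OF sol] by (simp add: h_def)

lemma h_deriv:
  assumes r: "r > 0" shows "(h has_real_derivative (A r / r)) (at r)"
proof -
  have "((\<lambda>r. v r / r) has_real_derivative ((- (n - 1) / r * v r - g (u r)) * r - v r * 1) / (r * r)) (at r)"
    by (intro DERIV_divide rsol_D(6)[OF sol r] DERIV_ident) (use r in simp)
  moreover have "((- (n - 1) / r * v r - g (u r)) * r - v r * 1) / (r * r) = A r / r"
    using r unfolding A_def vr[of r] by (simp add: field_simps)
  ultimately have "((\<lambda>r. v r / r) has_real_derivative A r / r) (at r)" by simp
  then show ?thesis
    by (rule has_field_derivative_transform_within[of _ _ _ _ r])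
       (use r in \<open>auto simp: h_def dist_real_def\<close>)
qed

lemma h_cont: "continuous_on {0..} h"
  unfolding continuous_on_eq_continuous_within
proof
  fix r :: real assume "r \<in> {0..}"
  show "continuous (at r within {0..}) h"
  proof (cases "r = 0")
    case False
    with \<open>r \<in> {0..}\<close> have r: "r > 0" by simp
    have "isCont h r" by (rule DERIV_isCont[OF h_deriv[OF r]])
    then show ?thesis by (rule continuous_at_imp_continuous_at_within)
  next
    case True
    have "((\<lambda>t. vel N (\<lambda>r. g (u r)) t / t) \<longlongrightarrow> - g (u 0) / n) (at_right 0)"
      by (rule vel_over_r_tendsto[OF rsol_comp_continuous[OF sol g_cont] N2])
    then have "(h \<longlongrightarrow> - g (u 0) / n) (at_right 0)"
      by (rule Lim_transform_eventually)
         (auto simp: eventually_at_right_field h_def rsol_vel[OF sol N2 g_cont] intro!: exI[of _ 1])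
    then have "(h \<longlongrightarrow> h 0) (at_right 0)" by (simp add: h_def rsol_D(1)[OF sol])
    moreover have "at 0 within {0::real..} = at_right 0"
      by (rule at_within_nhd[of _ UNIV]) auto
    ultimately show ?thesis using True by (simp add: continuous_within)
  qed
qed

lemma A_cont: "continuous_on {0..} A"
  unfolding A_def[abs_def]
  by (intro continuous_intros h_cont rsol_comp_continuous[OF sol g_cont])

lemma A_0: "A 0 = 0"
  using n_pos rsol_D(1)[OF sol] by (simp add: A_def h_def)

lemma norm_comp_cont: "continuous_on {0..} f \<Longrightarrow> isCont (\<lambda>x::real^'n::finite. f (norm x)) x" for f :: "real \<Rightarrow> real"
proof -
  assume f: "continuous_on {0..} f"
  have "continuous_on UNIV (\<lambda>x::real^'n. f (norm x))"
    by (rule continuous_on_compose2[OF f]) (auto intro!: continuous_intros)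
  then show "isCont (\<lambda>x::real^'n. f (norm x)) x" by (simp add: continuous_on_eq_continuous_at)
qed

lemma w_deriv: fixes x :: "real ^ 'n::finite" shows "(w has_derivative (\<lambda>y. h (norm x) * (x \<bullet> y))) (at x)"
proof (cases "x = 0")
  case False
  then have r: "norm x > 0" by simp
  have "(u has_derivative (\<lambda>y. v (norm x) * y)) (at (norm x))"
    using rsol_D(5)[OF sol r] by (simp add: has_field_derivative_def)
  from has_derivative_compose[OF norm_has_derivative_vec[OF False] this]
  have "((\<lambda>x. u (norm x)) has_derivative (\<lambda>y. v (norm x) * (x \<bullet> y / norm x))) (at x)" .
  moreover have "(\<lambda>y. v (norm x) * (x \<bullet> y / norm x)) = (\<lambda>y. h (norm x) * (x \<bullet> y))"
    using r by (intro ext) (simp add: vr[of "norm x"])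
  ultimately show ?thesis unfolding radial_lift_def[abs_def] by simp
next
  case True
  have "((\<lambda>r. (u r - u 0) / (r - 0)) \<longlongrightarrow> v 0) (at 0 within {0..})"
    using sol unfolding rsol_def has_field_derivative_iff by auto
  from filterlim_compose[OF this norm_tendsto_within]
  have "((\<lambda>y::real^'n. (u (norm y) - u 0) / (norm y - 0)) \<longlongrightarrow> 0) (at 0)" using rsol_D(2)[OF sol] by simp
  then have "((\<lambda>y::real^'n. \<bar>(u (norm y) - u 0) / norm y\<bar>) \<longlongrightarrow> 0) (at 0)"
    unfolding diff_0_right by (rule tendsto_rabs_zero)
  then have "(w has_derivative (\<lambda>y. 0)) (at (0 :: real ^ 'n))"
    by (rule has_derivative_at_via_bound[rotated]) (auto simp: radial_lift_def)
  then show ?thesis using True by simp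
qed

lemma partial_w: fixes i :: "'n::finite" shows "partial_deriv i w = (\<lambda>x. h (norm x) * x $ i)"
proof
  fix x :: "real ^ 'n"
  have "frechet_derivative w (at x) = (\<lambda>y. h (norm x) * (x \<bullet> y))"
    by (rule frechet_derivative_at[OF w_deriv, symmetric])
  then show "partial_deriv i w x = h (norm x) * x $ i" by (simp add: partial_deriv_def inner_axis)
qed

lemma gradient_deriv:
  fixes x :: "real ^ 'n::finite"
  shows "((\<lambda>x. h (norm x) * x $ i) has_derivative
     (\<lambda>y. A (norm x) * ((x \<bullet> y) * x $ i / (norm x)\<^sup>2) + h (norm x) * y $ i)) (at x)"
proof (cases "x = 0")
  case False
  then have r: "norm x > 0" by simp
  have "(h has_derivative (*) (A (norm x) / norm x)) (at (norm x))"
    using h_deriv[OF r] by (simp add: has_field_derivative_def)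
  from has_derivative_compose[OF norm_has_derivative_vec[OF False] this]
  have 1: "((\<lambda>x. h (norm x)) has_derivative (\<lambda>y. A (norm x) / norm x * (x \<bullet> y / norm x))) (at x)" .
  have 2: "((\<lambda>x::real^'n. x $ i) has_derivative (\<lambda>y. y $ i)) (at x)"
    by (rule bounded_linear_imp_has_derivative[OF bounded_linear_vec_nth])
  have "((\<lambda>x. h (norm x) * x $ i) has_derivative
      (\<lambda>y. h (norm x) * y $ i + A (norm x) / norm x * (x \<bullet> y / norm x) * x $ i)) (at x)"
    by (rule has_derivative_mult[OF 1 2])
  moreover have "(\<lambda>y. h (norm x) * y $ i + A (norm x) / norm x * (x \<bullet> y / norm x) * x $ i)
      = (\<lambda>y. A (norm x) * ((x \<bullet> y) * x $ i / (norm x)\<^sup>2) + h (norm x) * y $ i)"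
    by (rule ext) (simp add: power2_eq_square)
  ultimately show ?thesis by simp
next
  case True
  have "((\<lambda>y::real^'n. h (norm y)) \<longlongrightarrow> h (norm (0::real^'n))) (at 0)"
    using norm_comp_cont[OF h_cont, of 0] unfolding isCont_def .
  then have "((\<lambda>y::real^'n. \<bar>h (norm y) - h 0\<bar>) \<longlongrightarrow> 0) (at 0)"
    by (simp add: LIM_zero tendsto_rabs_zero)
  then have "((\<lambda>x::real^'n. h (norm x) * x $ i) has_derivative (\<lambda>y. h 0 * y $ i)) (at 0)"
  proof (rule has_derivative_at_via_bound[rotated])
    show "bounded_linear (\<lambda>y::real^'n. h 0 * y $ i)"
      by (rule bounded_linear_const_mult[OF bounded_linear_vec_nth])
    fix y :: "real ^ 'n"
    have "h (norm y) * y $ i - h (norm (0::real^'n)) * (0::real^'n) $ i - h 0 * (y - 0) $ i = (h (norm y) - h 0) * y $ i"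
      by (simp add: algebra_simps)
    then show "\<bar>h (norm y) * y $ i - h (norm (0::real^'n)) * (0::real^'n) $ i - h 0 * (y - 0) $ i\<bar>
        \<le> \<bar>h (norm y) - h 0\<bar> * norm (y - 0)"
      using component_le_norm_cart[of y i] by (simp add: abs_mult mult_left_mono)
  qed
  then show ?thesis using True by simp
qed

lemma partial_partial_w:
  fixes i j :: "'n::finite"
  shows "partial_deriv j (partial_deriv i w) = (\<lambda>x. A (norm x) * (x $ j * x $ i / (norm x)\<^sup>2) + h (norm x) * (if i = j then 1 else 0))"
proof
  fix x :: "real ^ 'n"
  have "frechet_derivative (partial_deriv i w) (at x) = (\<lambda>y. A (norm x) * ((x \<bullet> y) * x $ i / (norm x)\<^sup>2) + h (norm x) * y $ i)"
    unfolding partial_w by (rule frechet_derivative_at[OF gradient_deriv, symmetric])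
  then show "partial_deriv j (partial_deriv i w) x
      = A (norm x) * (x $ j * x $ i / (norm x)\<^sup>2) + h (norm x) * (if i = j then 1 else 0)"
    by (simp add: partial_deriv_def inner_axis, simp add: axis_def)
qed

lemma partial_partial_cont: fixes i j :: "'n::finite" shows "continuous_on UNIV (partial_deriv j (partial_deriv i w))"
proof -
  have m: "isCont (\<lambda>x. A (norm x) * (x $ j * x $ i / (norm x)\<^sup>2)) x" for x :: "real ^ 'n"
  proof (cases "x = 0")
    case False
    then show ?thesis
      by (intro continuous_intros norm_comp_cont[OF A_cont]) auto
  next
    case True
    have "((\<lambda>y::real^'n. A (norm y)) \<longlongrightarrow> A (norm (0::real^'n))) (at 0)"
      using norm_comp_cont[OF A_cont, of 0] unfolding isCont_def .
    then have l: "((\<lambda>y::real^'n. \<bar>A (norm y)\<bar>) \<longlongrightarrow> 0) (at 0)" using A_0 by (simp add: tendsto_rabs_zero)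
    have "((\<lambda>x::real^'n. A (norm x) * (x $ j * x $ i / (norm x)\<^sup>2)) \<longlongrightarrow> 0) (at 0)"
    proof (rule Lim_null_comparison[OF _ l])
      have "\<bar>A (norm x) * (x $ j * x $ i / (norm x)\<^sup>2)\<bar> \<le> \<bar>A (norm x)\<bar>" for x :: "real ^ 'n"
      proof -
        have "\<bar>x $ j\<bar> * \<bar>x $ i\<bar> \<le> norm x * norm x"
          by (intro mult_mono component_le_norm_cart) auto
        then have "\<bar>x $ j * x $ i / (norm x)\<^sup>2\<bar> \<le> 1"
        proof -
          assume "\<bar>x $ j\<bar> * \<bar>x $ i\<bar> \<le> norm x * norm x"
          then have "\<bar>x $ j * x $ i\<bar> / (norm x)\<^sup>2 \<le> (norm x)\<^sup>2 / (norm x)\<^sup>2"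
            by (intro divide_right_mono) (simp_all add: abs_mult power2_eq_square)
          also have "\<dots> \<le> 1" by simp
          finally show ?thesis by simp
        qed
        then have "\<bar>A (norm x)\<bar> * \<bar>x $ j * x $ i / (norm x)\<^sup>2\<bar> \<le> \<bar>A (norm x)\<bar> * 1"
          by (intro mult_left_mono) auto
        then show ?thesis by (simp add: abs_mult)
      qed
      then show "\<forall>\<^sub>F x in at 0. norm (A (norm x) * (x $ j * x $ i / (norm x)\<^sup>2)) \<le> \<bar>A (norm (x::real^'n))\<bar>"
        by (intro always_eventually) simp
    qed
    then show ?thesis using True by (simp add: isCont_def)
  qed
  show ?thesis
    unfolding partial_partial_w
    by (intro continuous_at_imp_continuous_on ballI, rule continuous_add[OF m],
        intro continuous_mult norm_comp_cont[OF h_cont] continuous_const)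
qed

lemma twice_cont_diff_lift: "twice_cont_diff (w :: real ^ 'n::finite \<Rightarrow> real)"
  unfolding twice_cont_diff_def
proof (intro conjI allI)
  show "(w :: real ^ 'n \<Rightarrow> real) differentiable (at x)" for x using w_deriv unfolding differentiable_def by blast
  show "partial_deriv i (w :: real ^ 'n \<Rightarrow> real) differentiable (at x)" for i x
    unfolding partial_w differentiable_def using gradient_deriv by blast
qed (rule partial_partial_cont)

lemma laplacian_w: fixes x :: "real ^ 'n::finite" assumes N: "N = CARD('n)" shows "laplacian w x + g (w x) = 0"
proof -
  have "laplacian w x = A (norm x) * ((\<Sum>i\<in>UNIV. x $ i * x $ i) / (norm x)\<^sup>2) + n * h (norm x)"
    unfolding laplacian_def partial_partial_w
    by (simp add: sum.distrib sum_distrib_left sum_divide_distrib N)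
  also have "(\<Sum>i\<in>UNIV. x $ i * x $ i) = (norm x)\<^sup>2"
    by (simp add: power2_norm_eq_inner inner_vec_def)
  also have "A (norm x) * ((norm x)\<^sup>2 / (norm x)\<^sup>2) = A (norm x)"
    using A_0 by (cases "x = 0") auto
  finally have "laplacian w x = - g (u (norm x))" by (simp add: A_def)
  then show ?thesis by (simp add: radial_lift_def[of u x])
qed

lemma radial_ground_state:
  assumes N: "N = CARD('n::finite)" and pos: "\<And>r. 0 \<le> r \<Longrightarrow> u r > 0" and lim: "(u \<longlongrightarrow> 0) at_top"
    and D: "\<And>r. 0 \<le> r \<Longrightarrow> u r \<in> D" "\<And>r. 0 \<le> r \<Longrightarrow> f (u r) = g (u r)"
  shows "radially_symmetric (w :: real ^ 'n \<Rightarrow> real)" "ground_state D f (w :: real ^ 'n \<Rightarrow> real)"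
proof -
  let ?w = "w :: real ^ 'n \<Rightarrow> real"
  show "radially_symmetric ?w" by (simp add: radially_symmetric_def radial_lift_def)
  have lw: "(?w \<longlongrightarrow> 0) at_infinity"
    unfolding radial_lift_def[abs_def] by (rule filterlim_compose[OF lim filterlim_norm_at_top])
  have "\<not> ?w constant_on UNIV"
  proof
    assume "?w constant_on UNIV"
    then obtain c where c: "\<And>x. ?w x = c" unfolding constant_on_def by auto
    have wc: "?w = (\<lambda>x. c)" by (rule ext) (rule c)
    have "c = 0"
      by (rule tendsto_unique[OF trivial_limit_at_infinity tendsto_const lw[unfolded wc]])
    then show False using c[of 0] pos[of 0] by (simp add: radial_lift_def)
  qed
  moreover have "laplacian ?w x + f (?w x) = 0" for x
  proof -
    have "f (?w x) = g (?w x)" unfolding radial_lift_def by (rule D(2)) simp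
    then show ?thesis using laplacian_w[OF N, of x] by simp
  qed
  ultimately show "ground_state D f ?w"
    unfolding ground_state_def using twice_cont_diff_lift lw pos D(1)
    by (intro conjI allI) (simp_all only: radial_lift_def norm_ge_zero not_False_eq_True)
qed

end

section \<open>Truncated and glued nonlinearities\<close>

text \<open>
  The energy is nonincreasing and at least F u, which tends to 0. With the initial value 0 the energy would vanish
  identically, and so would the derivative.
\<close>
lemma (in nonlinearity) decaying_solution_free:
  assumes s: "rsol N g a u v" and pos: "\<And>r. r > 0 \<Longrightarrow> u r > 0" and lim: "(u \<longlongrightarrow> 0) at_top"
  shows "\<not> trapped u v" "a > 0"
proof -
  have "((\<lambda>x. F (u x)) \<longlongrightarrow> F 0) at_top"
    by (rule continuous_on_tendsto_compose[OF F_cont[of UNIV] lim]) auto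
  then have l: "((\<lambda>x. F (u x)) \<longlongrightarrow> 0) at_top" using F_zero[of 0] by simp
  have E: "energy u v r \<ge> 0" if r: "r \<ge> 0" for r
  proof (rule tendsto_upperbound[OF l])
    show "\<forall>\<^sub>F x in at_top. F (u x) \<le> energy u v r"
      using eventually_ge_at_top[of r]
    proof eventually_elim
      case (elim x)
      have "F (u x) \<le> energy u v x" by (simp add: energy_def)
      also have "\<dots> \<le> energy u v r" by (rule energy_antimono[OF s r elim])
      finally show ?case .
    qed
  qed simp
  show "\<not> trapped u v" unfolding trapped_def using E by (meson not_le)
  have "(u \<longlongrightarrow> u 0) (at 0 within {0..})"
    using rsol_D(4)[OF s] unfolding continuous_on_def by force
  then have "(u \<longlongrightarrow> u 0) (at_right 0)" by (rule tendsto_within_subset) auto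
  moreover have "\<forall>\<^sub>F x in at_right 0. 0 \<le> u x"
    unfolding eventually_at_right_field using pos by (intro exI[of _ 1]) (auto simp: less_imp_le)
  ultimately have "0 \<le> u 0" by (rule tendsto_lowerbound) simp
  moreover have "a \<noteq> 0"
  proof
    assume a: "a = 0"
    have z: "energy u v r = 0" if "r \<ge> 0" for r
      using E[OF that] energy_antimono[OF s order_refl that] energy_0[OF s] a F_zero[of 0] by simp
    have v0: "v r = 0" if r: "r > 0" for r
    proof -
      have "((\<lambda>_. 0) has_real_derivative 0) (at r)" by simp
      then have "(energy u v has_real_derivative 0) (at r)"
        by (rule has_field_derivative_transform_within[of _ _ _ _ r]) (use r z in \<open>auto simp: dist_real_def\<close>)
      from DERIV_unique[OF this energy_deriv[OF s r]] show ?thesis using r N3 by simp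
    qed
    have "u 1 = u 0"
    proof (rule DERIV_isconst2[of 0 1])
      show "continuous_on {0..1} u" by (rule continuous_on_subset[OF rsol_D(4)[OF s]]) auto
      show "(u has_real_derivative 0) (at x)" if "0 < x" "x < 1" for x
        using rsol_D(5)[OF s that(1)] v0[OF that(1)] by simp
    qed auto
    then show False using pos[of 1] rsol_D(1)[OF s] a by simp
  qed
  ultimately show "a > 0" using rsol_D(1)[OF s] by simp
qed

text \<open>
  By \<open>descent\<close> the solution decreases at all radii, and by \<open>all_levels\<close> it passes every positive level below
  a.
\<close>
lemma (in free_solution) positive_solution_decays:
  assumes pos: "\<And>t. 0 \<le> t \<Longrightarrow> u t > 0"
  shows "0 \<le> t \<Longrightarrow> u t \<le> a" "(u \<longlongrightarrow> 0) at_top"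
proof -
  have d: "t \<in> desc v" if "0 < t" for t
  proof -
    have "v x < 0" if x: "0 < x" for x
      by (rule descent[OF sol, of x]) (use x pos energy_nonneg_if_pos[of x] in auto)
    then show ?thesis using that by (simp add: desc_def)
  qed
  show "0 \<le> t \<Longrightarrow> u t \<le> a"
    using lev_less[OF imageI[OF d[of t]]] u_0 by (cases "t = 0") auto
  show "(u \<longlongrightarrow> 0) at_top"
  proof (rule tendstoI)
    fix e :: real assume e: "e > 0"
    define e' where "e' = min e (a / 2)"
    have a0: "a > 0" using ab b_pos by simp
    have e': "0 < e'" "e' < a" "e' \<le> e" using e a0 unfolding e'_def by auto
    have L: "e' \<in> lev" by (rule all_levels[OF e'(1,2)])
    show "\<forall>\<^sub>F x in at_top. dist (u x) 0 < e"
      using eventually_gt_at_top[of "r e'"]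
    proof eventually_elim
      case (elim x)
      have x: "x > 0" using elim r_pos[OF L] by simp
      have "u x < e'" using u_less_iff[OF d[OF x] L] elim by simp
      then show ?case using pos[of x] x e'(3) by (simp add: dist_real_def)
    qed
  qed
qed

definition truncate :: "real \<Rightarrow> (real \<Rightarrow> real) \<Rightarrow> real \<Rightarrow> real" where
  "truncate c f s = f (max 0 (min c s))"

lemma truncate_eq [simp]: "0 \<le> s \<Longrightarrow> s \<le> c \<Longrightarrow> truncate c f s = f s"
  by (simp add: truncate_def)

lemma primitive0_cong:
  assumes "\<And>x. 0 \<le> x \<Longrightarrow> x \<le> s \<Longrightarrow> f x = g x" shows "primitive0 f s = primitive0 g s"
  unfolding primitive0_def by (rule Henstock_Kurzweil_Integration.integral_cong) (use assms in auto)

lemma nonlinearity_truncate: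
  assumes N: "3 \<le> N" and f: "continuous_on {0..c} f" "f 0 = 0" and b: "0 < b" "b < \<beta>" and c: "\<beta> < c"
    and sgn: "\<And>s. 0 \<le> s \<Longrightarrow> s \<le> b \<Longrightarrow> f s \<le> 0" "\<And>s. b < s \<Longrightarrow> s \<le> c \<Longrightarrow> 0 < f s"
    and F: "primitive0 f \<beta> = 0" "\<And>s. 0 < s \<Longrightarrow> s < \<beta> \<Longrightarrow> primitive0 f s < 0"
  shows "\<exists>M. nonlinearity N (truncate c f) b \<beta> M"
proof -
  have "compact (f ` {0..c})" by (intro compact_continuous_image f) simp
  then obtain M where M: "\<And>s. s \<in> {0..c} \<Longrightarrow> \<bar>f s\<bar> \<le> M"
    using compact_imp_bounded bounded_real by (metis imageI)
  have P: "primitive0 (truncate c f) s = primitive0 f s" if "s \<le> c" for s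
    by (rule primitive0_cong) (use that in auto)
  have c0: "0 \<le> c" using b c by simp
  have "nonlinearity N (truncate c f) b \<beta> M"
  proof
    show "continuous_on UNIV (truncate c f)"
      unfolding truncate_def[abs_def]
      by (rule continuous_on_compose2[OF f(1)]) (use c0 in \<open>auto intro!: continuous_intros\<close>)
    show "\<bar>truncate c f s\<bar> \<le> M" for s unfolding truncate_def by (rule M) (use c0 in auto)
    show "truncate c f s = 0" if "s \<le> 0" for s
    proof -
      have "max 0 (min c s) = 0" using that by auto
      then show ?thesis using f(2) by (simp add: truncate_def)
    qed
    show "truncate c f s \<le> 0" if "0 \<le> s" "s \<le> b" for s
      using that sgn(1) b c by simp
    show "0 < truncate c f s" if "b < s" for s
      unfolding truncate_def by (rule sgn(2)) (use that b c in auto)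
    show "primitive0 (truncate c f) \<beta> = 0" using P[of \<beta>] c F by simp
    show "primitive0 (truncate c f) s < 0" if "0 < s" "s < \<beta>" for s using P[of s] that c F by simp
  qed (use N b in auto)
  then show ?thesis by blast
qed

text \<open>
  These are the hypotheses on the unmodified nonlinearity, which may be unbounded. The comparison theorem is
  transferred to any bounded nonlinearity that agrees with it up to the larger initial value.
\<close>
locale radial_data =
  fixes N :: nat and f :: "real \<Rightarrow> real" and b \<beta> :: real
  assumes N3: "3 \<le> N" and f_cont: "continuous_on {0..} f" and f_0: "f 0 = 0"
    and f_diff: "\<And>s. 0 < s \<Longrightarrow> \<exists>d. (f has_real_derivative d) (at s)"
    and b_pos: "0 < b" and b_less: "b < \<beta>"
    and f_nonpos: "\<And>s. 0 \<le> s \<Longrightarrow> s \<le> b \<Longrightarrow> f s \<le> 0" and f_pos: "\<And>s. b < s \<Longrightarrow> 0 < f s"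
    and F_beta: "primitive0 f \<beta> = 0" and F_neg: "\<And>s. 0 < s \<Longrightarrow> s < \<beta> \<Longrightarrow> primitive0 f s < 0"
    and subcritical: "\<And>s. \<beta> < s \<Longrightarrow> (real N - 2) / (2 * real N) < deriv (\<lambda>t. primitive0 f t / f t) s"
    and quot_mono: "mono_on {b<..} (\<lambda>s. f s / (s - b))"
begin

lemma quotient_deriv:
  assumes g: "\<And>s. 0 \<le> s \<Longrightarrow> s \<le> c \<Longrightarrow> g s = f s" and s: "\<beta> < s" "s < c"
  shows "((\<lambda>t. primitive0 g t / g t) has_real_derivative deriv (\<lambda>t. primitive0 f t / f t) s) (at s)"
proof -
  have s0: "s > 0" and fs: "f s > 0" using s b_pos b_less f_pos[of s] by auto
  have 1: "(primitive0 f has_real_derivative f s) (at s)"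
    unfolding primitive0_def[abs_def] using integral_deriv[OF f_cont, of s] s0 by (simp add: at_within_nonneg)
  obtain d where 2: "(f has_real_derivative d) (at s)" using f_diff[OF s0] by blast
  have "((\<lambda>t. primitive0 f t / f t) has_real_derivative (f s * f s - primitive0 f s * d) / (f s * f s)) (at s)"
    by (rule DERIV_divide[OF 1 2]) (use fs in simp)
  then have q: "((\<lambda>t. primitive0 f t / f t) has_real_derivative deriv (\<lambda>t. primitive0 f t / f t) s) (at s)"
    using DERIV_imp_deriv by metis
  show ?thesis
  proof (rule has_field_derivative_transform_within[OF q, of "min s (c - s)"])
    fix t assume "dist t s < min s (c - s)"
    then have t: "0 < t" "t < c" by (auto simp: dist_real_def)
    have "primitive0 f t = primitive0 g t" by (rule primitive0_cong) (use t g in auto)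
    then show "primitive0 f t / f t = primitive0 g t / g t" using g t by simp
  qed (use s s0 in auto)
qed

lemma larger_crosses:
  assumes nl: "nonlinearity N g b \<beta> M" and g: "\<And>s. 0 \<le> s \<Longrightarrow> s \<le> a2 \<Longrightarrow> g s = f s"
    and s1: "rsol N g a1 u1 v1" "a1 > 0" "\<not> nonlinearity.trapped g u1 v1"
    and s2: "rsol N g a2 u2 v2" and a12: "a1 < a2"
  shows "\<exists>t>0. u2 t < 0"
proof -
  interpret S1: free_solution N g b \<beta> M a1 u1 v1
    by (rule nonlinearity.free_solutionI[OF nl s1])
  interpret S2: radial_solution N g b \<beta> M a2 u2 v2
    by unfold_locales (use s2 S1.ab a12 in auto)
  interpret ordered_pair N g b \<beta> M a1 u1 v1 a2 u2 v2 "deriv (\<lambda>t. primitive0 f t / f t)"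
  proof
    show "((\<lambda>t. primitive0 g t / g t) has_real_derivative deriv (\<lambda>t. primitive0 f t / f t) s) (at s)"
      if "\<beta> < s" "s < a2" for s by (rule quotient_deriv[OF g that])
    show "(real N - 2) / (2 * real N) < deriv (\<lambda>t. primitive0 f t / f t) s" if "\<beta> < s" "s < a2" for s
      by (rule subcritical[OF that(1)])
    show "g s / (s - b) \<le> g t / (t - b)" if "b < s" "s \<le> t" "t \<le> a2" for s t
      using monotone_onD[OF quot_mono, of s t] that g[of s] g[of t] b_pos by simp
  qed (rule a12)
  show ?thesis by (rule larger_solution_crosses)
qed

end

lemma rsol_if_radial_ivp:
  assumes "radial_ivp N f a u"
  obtains v where "rsol N f a u v"
proof -
  obtain v where v: "u 0 = a" "v 0 = 0" "continuous_on {0..} v"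
    "\<And>r. r \<ge> 0 \<Longrightarrow> (u has_real_derivative v r) (at r within {0..})"
    "\<And>r. r > 0 \<Longrightarrow> \<exists>w. (v has_real_derivative w) (at r) \<and> w + (real N - 1) / r * v r + f (u r) = 0"
    using assms unfolding radial_ivp_def by blast
  have "(v has_real_derivative (- (real N - 1) / r * v r - f (u r))) (at r)" if r: "r > 0" for r
  proof -
    obtain w where w: "(v has_real_derivative w) (at r)" "w + (real N - 1) / r * v r + f (u r) = 0"
      using v(5)[OF r] by blast
    have "w = - (real N - 1) / r * v r - f (u r)"
      using w(2) by (simp only: minus_divide_left[symmetric] mult_minus_left)
    then show ?thesis using w(1) by simp
  qed
  then have "rsol N f a u v" unfolding rsol_def using v by blast
  then show thesis by (rule that)
qed

lemma rsol_cong: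
  assumes "rsol N f a u v" "\<And>r. r > 0 \<Longrightarrow> g (u r) = f (u r)"
  shows "rsol N g a u v"
  using assms unfolding rsol_def by simp

lemma glued_continuous:
  assumes f1: "continuous_on {0..} f1" and f2: "continuous_on {a..c} f2" and e: "0 < e"
  shows "continuous_on {0..c} (glued f1 f2 a e A)"
proof -
  let ?ch = "chord (a + e) (f1 (a + e)) (a + e + e) (A\<^sup>2 * f2 (a + e + e))"
  have ends: "?ch (a + e) = f1 (a + e)" "?ch (a + e + e) = A\<^sup>2 * f2 (a + e + e)"
    using e by (simp_all add: chord_def)
  have "continuous_on {0..c} (\<lambda>s. if s \<le> a + e then f1 s else if s \<le> a + e + e then ?ch s else A\<^sup>2 * f2 s)"
  proof (rule continuous_on_cases_le[where h = "\<lambda>s. s"])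
    show "continuous_on {t \<in> {0..c}. t \<le> a + e} f1" by (rule continuous_on_subset[OF f1]) auto
    show "continuous_on {t \<in> {0..c}. a + e \<le> t} (\<lambda>s. if s \<le> a + e + e then ?ch s else A\<^sup>2 * f2 s)"
    proof (rule continuous_on_cases_le[where h = "\<lambda>s. s"])
      show "continuous_on {t \<in> {t \<in> {0..c}. a + e \<le> t}. t \<le> a + e + e} ?ch"
        unfolding chord_def[abs_def] by (intro continuous_intros) (use e in auto)
      show "continuous_on {t \<in> {t \<in> {0..c}. a + e \<le> t}. a + e + e \<le> t} (\<lambda>s. A\<^sup>2 * f2 s)"
        by (intro continuous_intros continuous_on_subset[OF f2]) (use e in auto)
    qed (use ends in \<open>auto intro!: continuous_intros\<close>)
  qed (use ends e in \<open>auto intro!: continuous_intros\<close>)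
  then show ?thesis
    by (simp add: glued_def[abs_def] Let_def)
qed

lemma glued_low: "s \<le> a + e \<Longrightarrow> glued f1 f2 a e A s = f1 s"
  by (simp add: glued_def Let_def)

lemma glued_high: "0 < e \<Longrightarrow> a + 2 * e \<le> s \<Longrightarrow> glued f1 f2 a e A s = A\<^sup>2 * f2 s"
  by (cases "s = a + e + e") (auto simp: glued_def Let_def chord_def)

lemma glued_between:
  assumes e: "0 < e" and s: "a \<le> s" "s \<le> c" and ae: "a + 2 * e \<le> c"
    and lo: "\<And>s. a \<le> s \<Longrightarrow> s \<le> c \<Longrightarrow> l < f1 s" "\<And>s. a \<le> s \<Longrightarrow> s \<le> c \<Longrightarrow> l < A\<^sup>2 * f2 s"
    and hi: "\<And>s. a \<le> s \<Longrightarrow> s \<le> c \<Longrightarrow> f1 s \<le> h" "\<And>s. a \<le> s \<Longrightarrow> s \<le> c \<Longrightarrow> A\<^sup>2 * f2 s \<le> h"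
  shows "l < glued f1 f2 a e A s \<and> glued f1 f2 a e A s \<le> h"
proof -
  consider "s \<le> a + e" | "a + e < s" "s \<le> a + e + e" | "a + e + e < s" by linarith
  then show ?thesis
  proof cases
    case 1
    then show ?thesis using lo(1)[OF s] hi(1)[OF s] by (simp add: glued_low)
  next
    case 3
    then show ?thesis using lo(2)[OF s] hi(2)[OF s] e by (simp add: glued_high)
  next
    case 2
    define q where "q = (s - (a + e)) / e"
    have q: "0 \<le> q" "q \<le> 1" using 2 e unfolding q_def by (auto simp: divide_le_eq)
    let ?y0 = "f1 (a + e)" and ?y1 = "A\<^sup>2 * f2 (a + e + e)"
    have v: "glued f1 f2 a e A s = (1 - q) * ?y0 + q * ?y1"
      using 2 e unfolding glued_def Let_def chord_def q_def by (simp add: field_simps)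
    have y: "l < ?y0" "l < ?y1" "?y0 \<le> h" "?y1 \<le> h" using e ae by (auto intro!: lo hi)
    have "(1 - q) * l + q * l < (1 - q) * ?y0 + q * ?y1"
    proof (cases "q = 0")
      case False
      then have "q * l < q * ?y1" using q y by simp
      moreover have "(1 - q) * l \<le> (1 - q) * ?y0" using q y by (intro mult_left_mono) auto
      ultimately show ?thesis by simp
    qed (use y in simp)
    moreover have "(1 - q) * ?y0 + q * ?y1 \<le> (1 - q) * h + q * h"
      using q y by (intro add_mono mult_left_mono) auto
    ultimately show ?thesis unfolding v by (simp add: algebra_simps)
  qed
qed

section \<open>Two ground states\<close>

context radial_data
begin

lemma truncate_nonlinearity: "\<beta> < c \<Longrightarrow> \<exists>M. nonlinearity N (truncate c f) b \<beta> M"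
  by (rule nonlinearity_truncate[OF N3 continuous_on_subset[OF f_cont] f_0 b_pos b_less _ f_nonpos f_pos F_beta F_neg]) auto

text \<open>
  The theory above needs a bounded nonlinearity. A ground state is bounded, so it also solves the equation truncated at a
  bound B; there the general results show that it starts above \<beta> and never exceeds its initial value a. Hence
  only the values on [0, a] matter.
\<close>
lemma ground_state_data:
  assumes ivp: "radial_ivp N f a u" and pos': "\<forall>r>0. u r > 0" and lim: "(u \<longlongrightarrow> 0) at_top"
  shows "\<exists>v. \<beta> < a \<and> (\<forall>r\<ge>0. 0 < u r \<and> u r \<le> a) \<and>
    (\<forall>g. (\<forall>s. 0 \<le> s \<longrightarrow> s \<le> a \<longrightarrow> g s = f s) \<longrightarrow> rsol N g a u v)"
proof -
  have pos: "u r > 0" if "r > 0" for r using pos' that by blast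
  obtain v where s: "rsol N f a u v" by (rule rsol_if_radial_ivp[OF ivp])
  have "\<forall>\<^sub>F r in at_top. u r < 1" by (rule order_tendstoD(2)[OF lim]) simp
  then obtain T where T: "\<And>r. r \<ge> T \<Longrightarrow> u r < 1" unfolding eventually_at_top_linorder by blast
  have "compact (u ` {0..max T 0})"
    by (intro compact_continuous_image continuous_on_subset[OF rsol_D(4)[OF s]]) auto
  then have "bounded (u ` {0..max T 0})" by (rule compact_imp_bounded)
  then obtain B0 where B0: "\<forall>y\<in>u ` {0..max T 0}. \<bar>y\<bar> \<le> B0"
    unfolding bounded_real by (elim exE)
  define B where "B = max (max B0 1) (\<beta> + 1)"
  have uB: "u r \<le> B" if "0 \<le> r" for r
  proof (cases "r \<le> max T 0")
    case True
    then have "\<bar>u r\<bar> \<le> B0" using that by (intro bspec[OF B0] imageI) simp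
    then show ?thesis unfolding B_def by linarith
  next
    case False
    then have "u r < 1" by (intro T) simp
    then show ?thesis unfolding B_def by linarith
  qed
  have "\<beta> < B" unfolding B_def by simp
  then obtain M where nl: "nonlinearity N (truncate B f) b \<beta> M" using truncate_nonlinearity by blast
  interpret nonlinearity N "truncate B f" b \<beta> M by (rule nl)
  have sB: "rsol N (truncate B f) a u v"
    by (rule rsol_cong[OF s]) (use pos uB in \<open>auto simp: less_imp_le\<close>)
  note D = decaying_solution_free[OF sB pos lim]
  interpret S: free_solution N "truncate B f" b \<beta> M a u v by (rule free_solutionI[OF sB D(2) D(1)])
  have pos0: "u r > 0" if "0 \<le> r" for r using pos[of r] S.u_0 D(2) that by (cases "r = 0") auto
  have le: "u r \<le> a" if "0 \<le> r" for r by (rule S.positive_solution_decays(1)[OF pos0 that])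
  have "rsol N g a u v" if g: "\<forall>s. 0 \<le> s \<longrightarrow> s \<le> a \<longrightarrow> g s = f s" for g
  proof (rule rsol_cong[OF s])
    fix r :: real assume "0 < r"
    then show "g (u r) = f (u r)" using g pos0[of r] le[of r] by simp
  qed
  then show ?thesis using S.a_beta pos0 le by blast
qed

end

lemma primitive0_negative_below_beta:
  assumes f: "continuous_on {0..} f" and b: "0 < b" and neg: "0 < e" "\<And>s. 0 < s \<Longrightarrow> s < e \<Longrightarrow> f s < 0"
    and nonpos: "\<And>s. 0 \<le> s \<Longrightarrow> s \<le> b \<Longrightarrow> f s \<le> 0" and pos: "\<And>s. b < s \<Longrightarrow> f s > (0::real)"
    and \<beta>: "b \<le> \<beta>" "primitive0 f \<beta> = 0" and s: "0 < s" "s \<le> b \<or> s < \<beta>"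
  shows "primitive0 f s < 0"
proof -
  have d: "(primitive0 f has_real_derivative f x) (at x)" if "x > 0" for x
    unfolding primitive0_def[abs_def] using integral_deriv[OF f, of x] that by (simp add: at_within_nonneg)
  have c: "continuous_on {x..y} (primitive0 f)" if "0 \<le> x" for x y
  proof (rule DERIV_continuous_on)
    fix t assume "t \<in> {x..y}"
    then show "(primitive0 f has_real_derivative f t) (at t within {x..y})"
      unfolding primitive0_def[abs_def] using that by (intro DERIV_subset[OF integral_deriv[OF f]]) auto
  qed
  have low: "primitive0 f s < 0" if s: "0 < s" "s \<le> b" for s
  proof -
    define x where "x = min s (e / 2)"
    have x: "0 < x" "x \<le> s" "x < e" using s neg(1) unfolding x_def by auto
    have "primitive0 f x < primitive0 f 0"
    proof (rule DERIV_neg_imp_decreasing_open[OF x(1) _ c])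
      fix t assume "0 < t" "t < x"
      then show "\<exists>y. (primitive0 f has_real_derivative y) (at t) \<and> y < 0"
        using d[of t] neg(2)[of t] x(3) by (intro exI[of _ "f t"]) simp
    qed simp
    moreover have "primitive0 f s \<le> primitive0 f x"
    proof (rule DERIV_nonpos_imp_decreasing_open[OF x(2) _ c])
      fix t assume "x < t" "t < s"
      then show "\<exists>y. (primitive0 f has_real_derivative y) (at t) \<and> y \<le> 0"
        using d[of t] nonpos[of t] x(1) s by (intro exI[of _ "f t"]) simp
    qed (use x in simp)
    ultimately show ?thesis by (simp add: primitive0_def)
  qed
  show ?thesis
  proof (cases "s \<le> b")
    case True
    then show ?thesis using low s by simp
  next
    case False
    then have sb: "b < s" "s < \<beta>" using s by auto
    have "primitive0 f s < primitive0 f \<beta>"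
    proof (rule DERIV_pos_imp_increasing_open[OF sb(2) _ c])
      fix t assume "s < t" "t < \<beta>"
      then show "\<exists>y. (primitive0 f has_real_derivative y) (at t) \<and> 0 < y"
        using d[of t] pos[of t] sb b by (intro exI[of _ "f t"]) simp
    qed (use sb b in simp)
    then show ?thesis using \<beta> by simp
  qed
qed

theorem theorem1p1:
  fixes f1 f2 :: "real \<Rightarrow> real" and b \<beta> \<alpha>s :: real and \<gamma> :: ereal
  assumes N: "CARD('n::finite) > 2"
    and f1_cont: "continuous_on {0..} f1"
    and f1_C1: "f1 C1_differentiable_on {0<..}"
    and f1_0: "f1 0 = 0"
    and b_nonneg: "b \<ge> 0"
    and f1_pos: "\<And>s. s > b \<Longrightarrow> f1 s > 0"
    and f1_nonpos: "\<And>s. s \<in> {0..b} \<Longrightarrow> f1 s \<le> 0"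
    and f1_neg: "\<exists>\<epsilon>>0. \<forall>s\<in>{0<..<\<epsilon>}. f1 s < 0"
    and beta: "\<beta> \<ge> b" "primitive0 f1 \<beta> = 0"
    and beta_unique: "\<And>s. s \<ge> b \<Longrightarrow> primitive0 f1 s = 0 \<Longrightarrow> s = \<beta>"
    and subcritical: "\<And>s. s > \<beta> \<Longrightarrow>
          deriv (\<lambda>t. primitive0 f1 t / f1 t) s > (real CARD('n) - 2) / (2 * real CARD('n))"
    and quot_mono: "mono_on {b<..} (\<lambda>s. f1 s / (s - b))"
    and alpha_ground: "\<exists>u. radial_ivp CARD('n) f1 \<alpha>s u \<and> (\<forall>r>0. u r > 0) \<and> (u \<longlongrightarrow> 0) at_top"
    and gamma: "ereal \<alpha>s < \<gamma>"
    and f2_cont: "continuous_on {s. \<alpha>s \<le> s \<and> ereal s < \<gamma>} f2"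
    and f2_pos: "\<And>s. \<alpha>s \<le> s \<Longrightarrow> ereal s < \<gamma> \<Longrightarrow> f2 s > 0"
  shows "\<exists>\<epsilon>bar>0. \<exists>Abar>0. \<forall>\<epsilon>1 A2. 0 < \<epsilon>1 \<and> \<epsilon>1 < \<epsilon>bar \<and> A2 > Abar \<longrightarrow>
           ereal (\<alpha>s + 2 * \<epsilon>1) < \<gamma> \<and>
           (\<exists>u1 u2 :: real ^ 'n \<Rightarrow> real.
              u1 \<noteq> u2 \<and>
              radially_symmetric u1 \<and>
              ground_state {s. 0 \<le> s \<and> ereal s < \<gamma>} (glued f1 f2 \<alpha>s \<epsilon>1 A2) u1 \<and>
              radially_symmetric u2 \<and>
              ground_state {s. 0 \<le> s \<and> ereal s < \<gamma>} (glued f1 f2 \<alpha>s \<epsilon>1 A2) u2)"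
proof -
  define N where "N = CARD('n)"
  have N3: "3 \<le> N" using assms(1) unfolding N_def by simp
  obtain e where e: "0 < e" "\<And>s. 0 < s \<Longrightarrow> s < e \<Longrightarrow> f1 s < 0" using f1_neg by auto
  have b_pos: "0 < b"
  proof (rule ccontr)
    assume "\<not> 0 < b"
    then show False using f1_pos[of "e / 2"] e(2)[of "e / 2"] e(1) b_nonneg by simp
  qed
  have Fn: "primitive0 f1 s < 0" if s: "0 < s" "s \<le> b \<or> s < \<beta>" for s
  proof (rule primitive0_negative_below_beta[where b = b and e = e and \<beta> = \<beta>])
    show "f1 x \<le> 0" if "0 \<le> x" "x \<le> b" for x using f1_nonpos that by simp
  qed (use f1_cont b_pos e f1_pos beta s in auto)
  have b_less: "b < \<beta>"
    using Fn[of b] b_pos beta by (cases "b = \<beta>") auto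
  interpret radial_data N f1 b \<beta>
  proof
    show "\<exists>d. (f1 has_real_derivative d) (at s)" if "0 < s" for s
      using f1_C1 that unfolding C1_differentiable_on_def has_real_derivative_iff_has_vector_derivative by auto
  qed (use N3 f1_cont f1_0 b_pos b_less f1_nonpos f1_pos beta Fn subcritical quot_mono in \<open>auto simp: N_def\<close>)
  obtain u0 where u0': "radial_ivp N f1 \<alpha>s u0" "\<forall>r>0. u0 r > 0" "(u0 \<longlongrightarrow> 0) at_top"
    using alpha_ground unfolding N_def by blast
  have u0: "radial_ivp N f1 \<alpha>s u0" "\<And>r. r > 0 \<Longrightarrow> u0 r > 0" "(u0 \<longlongrightarrow> 0) at_top"
    using u0' by simp_all
  from ground_state_data[OF u0']
  obtain v0 where \<alpha>\<beta>: "\<beta> < \<alpha>s" and u0r': "\<forall>r\<ge>0. 0 < u0 r \<and> u0 r \<le> \<alpha>s"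
    and s0': "\<forall>g. (\<forall>s. 0 \<le> s \<longrightarrow> s \<le> \<alpha>s \<longrightarrow> g s = f1 s) \<longrightarrow> rsol N g \<alpha>s u0 v0"
    by (elim exE conjE)
  have u0r: "0 < u0 r \<and> u0 r \<le> \<alpha>s" if "0 \<le> r" for r using u0r' that by simp
  have s0: "rsol N g \<alpha>s u0 v0" if "\<And>s. 0 \<le> s \<Longrightarrow> s \<le> \<alpha>s \<Longrightarrow> g s = f1 s" for g
    using s0' that by blast
  have \<alpha>0: "0 < \<alpha>s" using \<alpha>\<beta> b_pos b_less by simp
  have free0: "\<not> nonlinearity.trapped g u0 v0"
    if "nonlinearity N g b \<beta> M" "\<And>s. 0 \<le> s \<Longrightarrow> s \<le> \<alpha>s \<Longrightarrow> g s = f1 s" for g M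
    by (rule nonlinearity.decaying_solution_free(1)[OF that(1) s0[OF that(2)] u0(2,3)])
  obtain c :: real where c: "\<alpha>s < c" "ereal c < \<gamma>"
    using ereal_dense2[OF gamma] by auto
  have in\<gamma>: "ereal s < \<gamma>" if "s \<le> c" for s using c(2) that by (meson ereal_less_eq(3) le_less_trans)
  have f2c: "continuous_on {\<alpha>s..c} f2" by (rule continuous_on_subset[OF f2_cont]) (use in\<gamma> in auto)
  have f1c: "continuous_on {\<alpha>s..c} f1" by (rule continuous_on_subset[OF f1_cont]) (use \<alpha>0 in auto)
  have ne: "compact {\<alpha>s..c}" "{\<alpha>s..c} \<noteq> {}" using c by auto
  obtain x1 where x1: "x1 \<in> {\<alpha>s..c}" "\<And>s. s \<in> {\<alpha>s..c} \<Longrightarrow> f2 x1 \<le> f2 s"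
    using continuous_attains_inf[OF ne f2c] by blast
  obtain x2 where x2: "x2 \<in> {\<alpha>s..c}" "\<And>s. s \<in> {\<alpha>s..c} \<Longrightarrow> f2 s \<le> f2 x2"
    using continuous_attains_sup[OF ne f2c] by blast
  obtain x3 where x3: "x3 \<in> {\<alpha>s..c}" "\<And>s. s \<in> {\<alpha>s..c} \<Longrightarrow> f1 s \<le> f1 x3"
    using continuous_attains_sup[OF ne f1c] by blast
  define m where "m = f2 x1"
  \<comment> \<open>the glued function is at least m A^2 between \<alpha>* + 2 \<epsilon> and c and, when A \<ge> 1,
    at most Mb A^2 between \<alpha>* and c\<close>
  define Mb where "Mb = f2 x2 + f1 x3"
  have m: "0 < m" unfolding m_def using x1(1) in\<gamma> by (intro f2_pos) auto
  have f13: "0 < f1 x3" using x3(1) \<alpha>\<beta> b_less by (intro f1_pos) auto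
  have mM: "m \<le> Mb" unfolding m_def Mb_def using x1(2)[OF x2(1)] f13 by linarith
  have Mb: "0 < Mb" using m mM by simp
  define k where "k = real N - 2"
  have k: "0 < k" using N3 unfolding k_def by simp
  \<comment> \<open>small enough that the initial values of the limit problem, which are at least
    \<alpha>* - (8 Mb/m) \<delta>/(N - 2), are positive\<close>
  define \<delta> where "\<delta> = min (c - \<alpha>s) (\<alpha>s * m * k / (16 * Mb))"
  have \<delta>: "0 < \<delta>" unfolding \<delta>_def using c \<alpha>0 m k Mb by simp
  have \<delta>c: "\<alpha>s + \<delta> \<le> c" unfolding \<delta>_def by simp
  have small: "8 * Mb * \<delta> / m / (real N - 2) < \<alpha>s"
  proof -
    have "8 * Mb * \<delta> \<le> 8 * Mb * (\<alpha>s * m * k / (16 * Mb))"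
      unfolding \<delta>_def using Mb by (intro mult_left_mono) auto
    also have "\<dots> = \<alpha>s * m * k / 2" using Mb by simp
    also have "\<dots> < \<alpha>s * m * k" using \<alpha>0 m k by simp
    finally have "8 * Mb * \<delta> < \<alpha>s * m * k" .
    then show ?thesis using m k unfolding k_def[symmetric] by (simp add: divide_less_eq mult.commute mult.left_commute)
  qed
  \<comment> \<open>the gap 2 \<epsilon> has to be small compared with \<delta> in \<open>steep_passage\<close>\<close>
  define \<epsilon>0 where "\<epsilon>0 = min (\<delta> / 4) (\<delta> * m / (4 * Mb * k))"
  have \<epsilon>0: "0 < \<epsilon>0" unfolding \<epsilon>0_def using \<delta> m Mb k by simp
  have \<epsilon>1: "2 * \<epsilon> \<le> \<delta> / 2" and \<epsilon>2: "2 * \<epsilon> * (real N - 2) \<le> \<delta> * m / (2 * Mb)" if "\<epsilon> < \<epsilon>0" for \<epsilon>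
  proof -
    show "2 * \<epsilon> \<le> \<delta> / 2" using that unfolding \<epsilon>0_def by simp
    have "\<epsilon> \<le> \<delta> * m / (4 * Mb * k)" using that unfolding \<epsilon>0_def by simp
    then have "2 * \<epsilon> * k \<le> 2 * (\<delta> * m / (4 * Mb * k)) * k" using k by (intro mult_right_mono mult_left_mono) auto
    also have "\<dots> = \<delta> * m / (2 * Mb)" using k Mb by (simp add: field_simps)
    finally show "2 * \<epsilon> * (real N - 2) \<le> \<delta> * m / (2 * Mb)" unfolding k_def .
  qed
  \<comment> \<open>solutions with initial values up to \<alpha>* + \<delta> do not notice the truncation\<close>
  define G where "G \<epsilon> A = truncate (\<alpha>s + \<delta>) (glued f1 f2 \<alpha>s \<epsilon> A)" for \<epsilon> A
  have ab: "\<alpha>s < \<alpha>s + \<delta>" using \<delta> by simp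
  have G_low: "G \<epsilon> A s = f1 s" if "0 \<le> s" "s \<le> \<alpha>s + \<epsilon>" "0 < \<epsilon>" "\<epsilon> < \<epsilon>0" for \<epsilon> A s
    using that \<epsilon>1[OF that(4)] \<delta> unfolding G_def by (simp add: glued_low)
  have between: "0 < glued f1 f2 \<alpha>s \<epsilon> A s \<and> glued f1 f2 \<alpha>s \<epsilon> A s \<le> Mb * A\<^sup>2"
    if \<epsilon>: "0 < \<epsilon>" "\<epsilon> < \<epsilon>0" and A: "1 \<le> A" and s: "\<alpha>s \<le> s" "s \<le> \<alpha>s + \<delta>" for \<epsilon> A s
  proof (rule glued_between[OF \<epsilon>(1) s])
    show "\<alpha>s + 2 * \<epsilon> \<le> \<alpha>s + \<delta>" using \<epsilon>1[OF \<epsilon>(2)] \<delta> by simp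
    have A2: "1 \<le> A\<^sup>2" using A by simp
    fix x assume x: "\<alpha>s \<le> x" "x \<le> \<alpha>s + \<delta>"
    then have xc: "x \<in> {\<alpha>s..c}" using \<delta>c by simp
    show "0 < f1 x" using x \<alpha>\<beta> b_less by (intro f1_pos) simp
    have f2x: "0 < f2 x" using xc in\<gamma> by (intro f2_pos) auto
    then show "0 < A\<^sup>2 * f2 x" using A by simp
    have f2m: "0 \<le> f2 x2" using f2x x2(2)[OF xc] by simp
    have "f1 x \<le> Mb" using x3(2)[OF xc] f2m unfolding Mb_def by simp
    also have "\<dots> \<le> Mb * A\<^sup>2" using Mb A2 by simp
    finally show "f1 x \<le> Mb * A\<^sup>2" .
    have "f2 x \<le> Mb" using x2(2)[OF xc] f13 unfolding Mb_def by simp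
    then show "A\<^sup>2 * f2 x \<le> Mb * A\<^sup>2" using A by (simp add: mult.commute)
  qed
  have G_nl: "\<exists>M. nonlinearity N (G \<epsilon> A) b \<beta> M" if \<epsilon>: "0 < \<epsilon>" "\<epsilon> < \<epsilon>0" and A: "1 \<le> A" for \<epsilon> A
    unfolding G_def
  proof (rule nonlinearity_truncate[OF N3 _ _ b_pos b_less])
    have low: "glued f1 f2 \<alpha>s \<epsilon> A s = f1 s" if "s \<le> \<alpha>s" for s using that \<epsilon> by (intro glued_low) simp
    have P: "primitive0 (glued f1 f2 \<alpha>s \<epsilon> A) s = primitive0 f1 s" if "s \<le> \<alpha>s" for s
      by (rule primitive0_cong) (use low that in auto)
    show "continuous_on {0..\<alpha>s + \<delta>} (glued f1 f2 \<alpha>s \<epsilon> A)"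
      by (rule glued_continuous[OF f1_cont continuous_on_subset[OF f2c] \<epsilon>(1)]) (use \<delta>c in auto)
    show "glued f1 f2 \<alpha>s \<epsilon> A 0 = 0" using low[of 0] \<alpha>0 f1_0 by simp
    show "\<beta> < \<alpha>s + \<delta>" using \<alpha>\<beta> \<delta> by simp
    show "glued f1 f2 \<alpha>s \<epsilon> A s \<le> 0" if "0 \<le> s" "s \<le> b" for s
      using low[of s] that f_nonpos b_less \<alpha>\<beta> by simp
    show "0 < glued f1 f2 \<alpha>s \<epsilon> A s" if "b < s" "s \<le> \<alpha>s + \<delta>" for s
      using low[of s] between[OF \<epsilon> A, of s] that f1_pos[of s] by (cases "s \<le> \<alpha>s") auto
    show "primitive0 (glued f1 f2 \<alpha>s \<epsilon> A) \<beta> = 0" using P[of \<beta>] \<alpha>\<beta> beta by simp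
    show "primitive0 (glued f1 f2 \<alpha>s \<epsilon> A) s < 0" if "0 < s" "s < \<beta>" for s
      using P[of s] Fn[of s] that \<alpha>\<beta> by simp
  qed
  obtain M0 where nl0: "nonlinearity N (truncate \<alpha>s f1) b \<beta> M0"
    using truncate_nonlinearity[OF \<alpha>\<beta>] by blast
  \<comment> \<open>an untrapped solution from below \<alpha>* would force the given ground state to change sign\<close>
  have trap0: "nonlinearity.trapped (truncate \<alpha>s f1) u v"
    if l: "0 < l" "l < \<alpha>s" and s: "rsol N (truncate \<alpha>s f1) l u v" for l u v
  proof (rule ccontr)
    assume "\<not> ?thesis"
    from larger_crosses[OF nl0 _ s l(1) this s0 l(2)] obtain t where "t > 0" "u0 t < 0" by auto
    then show False using u0r[of t] by simp
  qed
  \<comment> \<open>uniformly in \<epsilon>, solutions from \<alpha>* + \<delta> are trapped for large A\<close>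
  have "\<exists>A0>0. \<forall>\<epsilon> A. 0 < \<epsilon> \<and> \<epsilon> < \<epsilon>0 \<and> A0 < A \<longrightarrow>
      (\<forall>u v. rsol N (G \<epsilon> A) (\<alpha>s + \<delta>) u v \<longrightarrow> nonlinearity.trapped (G \<epsilon> A) u v)"
  proof (rule ccontr)
    assume no: "\<not> ?thesis"
    let ?bad = "\<lambda>n \<epsilon> A u v. 0 < \<epsilon> \<and> \<epsilon> < \<epsilon>0 \<and> real (Suc n) < A \<and>
        rsol N (G \<epsilon> A) (\<alpha>s + \<delta>) u v \<and> \<not> nonlinearity.trapped (G \<epsilon> A) u v"
    have "\<forall>n. \<exists>\<epsilon> A u v. ?bad n \<epsilon> A u v"
    proof (intro allI, rule ccontr)
      fix n assume none: "\<not> (\<exists>\<epsilon> A u v. ?bad n \<epsilon> A u v)"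
      have "\<forall>\<epsilon> A. 0 < \<epsilon> \<and> \<epsilon> < \<epsilon>0 \<and> real (Suc n) < A \<longrightarrow>
          (\<forall>u v. rsol N (G \<epsilon> A) (\<alpha>s + \<delta>) u v \<longrightarrow> nonlinearity.trapped (G \<epsilon> A) u v)"
        using none by blast
      with no show False by (meson of_nat_0_less_iff zero_less_Suc)
    qed
    from choice2[OF this] obtain \<epsilon> A where "\<forall>n. \<exists>u v. ?bad n (\<epsilon> n) (A n) u v" by (elim exE)
    from choice2[OF this] obtain us vs where q: "\<forall>n. ?bad n (\<epsilon> n) (A n) (us n) (vs n)" by (elim exE)
    have Q: "0 < \<epsilon> n" "\<epsilon> n < \<epsilon>0" "real (Suc n) < A n" "rsol N (G (\<epsilon> n) (A n)) (\<alpha>s + \<delta>) (us n) (vs n)"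
      "\<not> nonlinearity.trapped (G (\<epsilon> n) (A n)) (us n) (vs n)" for n
      using spec[OF q, of n] by blast+
    have A1: "1 \<le> A n" for n using Q(3)[of n] by simp
    have "\<forall>n. \<exists>M. nonlinearity N (G (\<epsilon> n) (A n)) b \<beta> M" using G_nl[OF Q(1,2) A1] by blast
    from choice[OF this] obtain Ms where Ms: "\<And>n. nonlinearity N (G (\<epsilon> n) (A n)) b \<beta> (Ms n)" by blast
    have FS: "free_solution N (G (\<epsilon> n) (A n)) b \<beta> (Ms n) (\<alpha>s + \<delta>) (us n) (vs n)" for n
      by (rule nonlinearity.free_solutionI[OF Ms Q(4) _ Q(5)]) (use \<alpha>0 \<delta> in simp)
    show False
    proof (rule nonlinearity.steep_sequence_absurd[where gs = "\<lambda>n. G (\<epsilon> n) (A n)" and \<epsilon> = \<epsilon>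
          and K = "\<lambda>n. (A n)\<^sup>2", OF nl0 \<alpha>\<beta> _ \<delta> m mM small FS])
      show "nonlinearity.trapped (truncate \<alpha>s f1) u v"
        if "0 < l" "l < \<alpha>s" "rsol N (truncate \<alpha>s f1) l u v" for l u v
        by (rule trap0[OF that])
      fix n and s :: real
      show "G (\<epsilon> n) (A n) s = truncate \<alpha>s f1 s" if s: "s \<le> \<alpha>s"
      proof (cases "0 \<le> s")
        case True
        then show ?thesis using G_low[OF True _ Q(1,2)] s Q(1)[of n] by simp
      next
        case False
        then show ?thesis
          using nonlinearity.g_zero[OF Ms[of n], of s] nonlinearity.g_zero[OF nl0, of s] by simp
      qed
      show "0 < \<epsilon> n" by (rule Q(1))
      show "2 * \<epsilon> n \<le> \<delta> / 2" by (rule \<epsilon>1[OF Q(2)])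
      show "2 * \<epsilon> n * (real N - 2) \<le> \<delta> * m / (2 * Mb)" by (rule \<epsilon>2[OF Q(2)])
      have "A n \<le> (A n)\<^sup>2" using A1[of n] by (simp add: power2_eq_square)
      then show "real (Suc n) \<le> (A n)\<^sup>2" using Q(3)[of n] by linarith
      have cl: "max 0 (min (\<alpha>s + \<delta>) s) = min (\<alpha>s + \<delta>) s" if "\<alpha>s \<le> s" using that \<alpha>0 \<delta> by simp
      show "m * (A n)\<^sup>2 \<le> G (\<epsilon> n) (A n) s" if s: "\<alpha>s + 2 * \<epsilon> n \<le> s"
      proof -
        have s': "\<alpha>s \<le> s" "\<alpha>s + 2 * \<epsilon> n \<le> min (\<alpha>s + \<delta>) s" using s Q(1)[of n] \<epsilon>1[OF Q(2)[of n]] \<delta> by auto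
        have "m \<le> f2 (min (\<alpha>s + \<delta>) s)" unfolding m_def by (rule x1(2)) (use s' \<delta>c \<delta> in auto)
        then have "m * (A n)\<^sup>2 \<le> f2 (min (\<alpha>s + \<delta>) s) * (A n)\<^sup>2"
          by (rule mult_right_mono) simp
        then have "m * (A n)\<^sup>2 \<le> (A n)\<^sup>2 * f2 (min (\<alpha>s + \<delta>) s)"
          by (simp only: mult.commute)
        then show ?thesis
          unfolding G_def truncate_def cl[OF s'(1)] glued_high[OF Q(1) s'(2)] .
      qed
      show "G (\<epsilon> n) (A n) s \<le> Mb * (A n)\<^sup>2" if s: "\<alpha>s \<le> s"
        using between[OF Q(1,2) A1, of "min (\<alpha>s + \<delta>) s" n n] s \<delta> unfolding G_def truncate_def cl[OF s] by auto
    qed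
  qed
  then obtain A0 where A0: "0 < A0" "\<And>\<epsilon> A u v. 0 < \<epsilon> \<Longrightarrow> \<epsilon> < \<epsilon>0 \<Longrightarrow> A0 < A \<Longrightarrow>
      rsol N (G \<epsilon> A) (\<alpha>s + \<delta>) u v \<Longrightarrow> nonlinearity.trapped (G \<epsilon> A) u v" by blast
  show ?thesis
  proof (rule exI[of _ \<epsilon>0], rule conjI[OF \<epsilon>0], rule exI[of _ "max A0 1"], intro conjI allI impI)
    show "0 < max A0 1" by simp
    fix \<epsilon> A assume "0 < \<epsilon> \<and> \<epsilon> < \<epsilon>0 \<and> max A0 1 < A"
    then have \<epsilon>: "0 < \<epsilon>" "\<epsilon> < \<epsilon>0" and A: "A0 < A" "1 \<le> A" by auto
    show "ereal (\<alpha>s + 2 * \<epsilon>) < \<gamma>" using \<epsilon>1[OF \<epsilon>(2)] \<delta>c \<delta> by (intro in\<gamma>) simp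
    obtain M where nl: "nonlinearity N (G \<epsilon> A) b \<beta> M" using G_nl[OF \<epsilon> A(2)] by blast
    interpret nonlinearity N "G \<epsilon> A" b \<beta> M by (rule nl)
    have low: "G \<epsilon> A s = f1 s" if "0 \<le> s" "s \<le> \<alpha>s" for s using G_low[of s \<epsilon> A] that \<epsilon> by simp
    have sol0: "rsol N (G \<epsilon> A) \<alpha>s u0 v0" by (rule s0[OF low])
    have fr0: "\<not> trapped u0 v0" by (rule free0[OF nl low])
    have "\<exists>\<alpha>\<in>{\<alpha>s + \<epsilon>..\<alpha>s + \<delta>}. \<exists>u v. rsol N (G \<epsilon> A) \<alpha> u v \<and> (\<forall>t\<ge>0. u t > 0) \<and> \<not> trapped u v"
    proof (rule shooting[OF sol0 _ fr0])
      show "u0 t > 0" if "0 \<le> t" for t using u0r[OF that] by simp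
      show "0 < \<alpha>s + \<epsilon>" using \<alpha>0 \<epsilon> by simp
      show "\<alpha>s + \<epsilon> < \<alpha>s + \<delta>" using \<epsilon>1[OF \<epsilon>(2)] \<delta> by simp
      show "\<exists>t\<ge>0. u t < 0" if s: "rsol N (G \<epsilon> A) (\<alpha>s + \<epsilon>) u v" for u v
      proof -
        have "\<exists>t>0. u t < 0"
          by (rule larger_crosses[OF nl _ sol0 \<alpha>0 fr0 s]) (use G_low \<epsilon> in auto)
        then show ?thesis by (auto intro: less_imp_le)
      qed
      show "trapped u v" if "rsol N (G \<epsilon> A) (\<alpha>s + \<delta>) u v" for u v by (rule A0(2)[OF \<epsilon> A(1) that])
    qed
    then obtain \<alpha> u v where \<alpha>: "\<alpha>s + \<epsilon> \<le> \<alpha>" "\<alpha> \<le> \<alpha>s + \<delta>" and sol: "rsol N (G \<epsilon> A) \<alpha> u v"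
      and up: "\<And>t. 0 \<le> t \<Longrightarrow> u t > 0" and fr: "\<not> trapped u v" by auto
    have \<alpha>p: "\<alpha> > 0" using \<alpha> \<alpha>0 \<epsilon> by simp
    interpret S: free_solution N "G \<epsilon> A" b \<beta> M \<alpha> u v by (rule free_solutionI[OF sol \<alpha>p fr])
    have ub: "u t \<le> \<alpha>s + \<delta>" if "0 \<le> t" for t
      using S.positive_solution_decays(1)[OF up that] \<alpha> by simp
    have ulim: "(u \<longlongrightarrow> 0) at_top" by (rule S.positive_solution_decays(2)[OF up])
    have inD: "s \<in> {s. 0 \<le> s \<and> ereal s < \<gamma>}" and GG: "glued f1 f2 \<alpha>s \<epsilon> A s = G \<epsilon> A s"
      if "0 < s" "s \<le> \<alpha>s + \<delta>" for s
      using that in\<gamma>[of s] \<delta>c unfolding G_def by auto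
    have u0b: "0 < u0 t" "u0 t \<le> \<alpha>s + \<delta>" if "0 \<le> t" for t using u0r[OF that] \<delta> by auto
    interpret R0: radial_profile N "G \<epsilon> A" \<alpha>s u0 v0 by unfold_locales (rule N2 g_cont sol0)+
    interpret R1: radial_profile N "G \<epsilon> A" \<alpha> u v by unfold_locales (rule N2 g_cont sol)+
    let ?w0 = "radial_lift u0 :: real ^ 'n \<Rightarrow> real" and ?w1 = "radial_lift u :: real ^ 'n \<Rightarrow> real"
    let ?D = "{s. 0 \<le> s \<and> ereal s < \<gamma>}"
    note g0 = R0.radial_ground_state[OF N_def u0b(1) u0(3) inD[OF u0b] GG[OF u0b]]
    note g1 = R1.radial_ground_state[OF N_def up ulim inD[OF up ub] GG[OF up ub]]
    have ne0: "?w0 0 \<noteq> ?w1 0"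
      using rsol_D(1)[OF sol0] rsol_D(1)[OF sol] \<alpha> \<epsilon> by (simp add: radial_lift_def)
    have "?w0 \<noteq> ?w1"
    proof
      assume "?w0 = ?w1"
      then have "?w0 0 = ?w1 0" by (rule fun_cong)
      with ne0 show False by contradiction
    qed
    with g0 g1 show "\<exists>u1 u2 :: real ^ 'n \<Rightarrow> real. u1 \<noteq> u2 \<and> radially_symmetric u1 \<and>
        ground_state ?D (glued f1 f2 \<alpha>s \<epsilon> A) u1 \<and> radially_symmetric u2 \<and>
        ground_state ?D (glued f1 f2 \<alpha>s \<epsilon> A) u2"
      by (intro exI[of _ ?w0] exI[of _ ?w1] conjI)
  qed
qed

end
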